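(* Let $k\ge 1$ be an integer. The finite element $(\Omega,\mathcal U^{(0),k}(\Omega),\Sigma^{(0),k})$ is $H^1$-conforming and unisolvent. That is: (i) (conforming) $\mathcal U^{(0),k}(\Omega)\subset H^1(\Omega)$ and, for every face $F$ of $\Omega$ and every $p\in \mathcal U^{(0),k}(\Omega)$, all vertex, edge and face degrees of freedom in $\Sigma^{(0),k}$ associated with $F$, with the edges of $F$ and with the vertices of $F$ vanish on $p$ if and only if $p\equiv 0$ on $F$; (ii) (unisolvent) for every family of real numbers $(u_m)_{m\in\Sigma^{(0),k}}$ there is exactly one $u\in\mathcal U^{(0),k}(\Omega)$ with $m(u)=u_m$ for all $m\in\Sigma^{(0),k}$.
   Context: Finite pyramid: $\Omega=\{(\xi,\eta,\zeta)\in\mathbb R^3:\xi,\eta,\zeta\ge0,\ \xi\le1-\zeta,\ \eta\le1-\zeta\}$, with four triangular faces $S_{i,\Omega}$ ($i=1,\dots,4$), square base face $B$, five vertices and eight edges. Infinite pyramid: $\Omega_\infty=\{(x,y,z): 0\le x,y\le1,\ z\ge0\}$ (together with a point $\infty$). Map: $\phi:\Omega_\infty\to\Omega$, $\phi(x,y,z)=\left(\frac{x}{1+z},\frac{y}{1+z},\frac{z}{1+z}\right)$, $\phi(\infty)=(0,0,1)$. $Q^{l,m,n}$: polynomials of degree at most $l,m,n$ in $x,y,z$ respectively; $Q^{l,m,n}_k=\{u/(1+z)^k:u\in Q^{l,m,n}\}$. $P^n_k[w,z]=\{u(w,z)/(1+z)^k: u$ a polynomial of total degree $\le n\}$. Polynomial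 spaces with a negative degree are $\{0\}$. $\overline{\mathcal U^{(0),k}}(\Omega_\infty)=Q_k^{k,k,k-1}\oplus \mathrm{span}\{z^k/(1+z)^k\}$. $\mathcal U^{(0),k}(\Omega_\infty)$ is the set of $u\in\overline{\mathcal U^{(0),k}}(\Omega_\infty)$ whose restrictions to the vertical faces $y=0$ and $y=1$ lie in $P^k_k[x,z]$ and whose restrictions to the vertical faces $x=0$ and $x=1$ lie in $P^k_k[y,z]$. $\mathcal U^{(0),k}(\Omega)=\{u\circ\phi^{-1}:u\in\mathcal U^{(0),k}(\Omega_\infty)\}$; these functions extend continuously to the apex $(0,0,1)$. $\mathcal U^{(0),k}_0(\Omega)$ is the subspace of functions vanishing on $\partial\Omega$. For a finite-dimensional space $P$, $\mathcal B[P]$ denotes an arbitrary (fixed) basis. $P^n(\cdot)$ is the space of polynomials of total degree $\le n$ on an edge or face; $Q^{m,n}(B)$ is the space of polynomials on $B$ of degree $\le m$ in $\xi$ and $\le n$ in $\eta$. Degrees of freedom $\Sigma^{(0),k}$ (linear functionals of $p$): vertices: $p\mapsto p(v_i)$ for the five vertices $v_i$; edges: $p\mapsto\int_e pq\,ds$, $q\in\mathcal B[P^{k-2}(e)]$, for each of the eight edges $e$; triangular faces: $p\mapsto\int_{S_{i,\Omega}}pq\,dA$, $q\in\mathcal B[P^{k-3}(S_{i,\Omega})]$, $i=1,\dots,4$; base: $p\mapsto\int_B pq\,dA$, $q\in\mathcal B[Q^{k-2,k-2}(B)]$; volume: $p\mapsto\int_\Omega\nabla p\cdot\nabla q\,dV$,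 $q\in\mathcal B[\mathcal U^{(0),k}_0(\Omega)]$. *)

theory Defs
  imports "HOL-Analysis.Analysis" "HOL-Library.Function_Algebras"
begin

section \<open>Real-valued functions as a vector space\<close>

instantiation "fun" :: (type, real_vector) real_vector
begin

definition scaleR_fun_def: "c *\<^sub>R f = (\<lambda>x. c *\<^sub>R f x)"

instance
  by standard (auto simp: scaleR_fun_def fun_eq_iff scaleR_add_right scaleR_add_left)

end

type_synonym point = "real^3"
type_synonym scalar_field = "point \<Rightarrow> real"

text \<open>A function on a set \<open>A\<close> is represented by its extension by zero, so that equality of
  functions on \<open>A\<close> is equality in HOL and function spaces on \<open>A\<close> are real subspaces.\<close>

definition ext0 :: "point set \<Rightarrow> scalar_field \<Rightarrow> scalar_field" where
  "ext0 A f = (\<lambda>x. if x \<in> A then f x else 0)"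

definition basis_of :: "'a::real_vector set \<Rightarrow> 'a set \<Rightarrow> bool" where
  "basis_of B V \<longleftrightarrow> independent B \<and> span B = V"

section \<open>The finite and the infinite pyramid\<close>

definition pyramid :: "point set" where
  "pyramid = {p. 0 \<le> p$1 \<and> 0 \<le> p$2 \<and> 0 \<le> p$3 \<and> p$1 \<le> 1 - p$3 \<and> p$2 \<le> 1 - p$3}"

definition apex :: point where
  "apex = vector [0, 0, 1]"

definition vertices :: "point set" where
  "vertices = {vector [0,0,0], vector [1,0,0], vector [1,1,0], vector [0,1,0], apex}"

text \<open>Edges are given by their end points and triangular faces by their corners.\<close>

definition edges :: "(point \<times> point) set" where
  "edges =
    {(vector [0,0,0], vector [1,0,0]), (vector [1,0,0], vector [1,1,0]),
     (vector [1,1,0], vector [0,1,0]), (vector [0,1,0], vector [0,0,0]),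
     (vector [0,0,0], apex), (vector [1,0,0], apex),
     (vector [1,1,0], apex), (vector [0,1,0], apex)}"

definition triangles :: "(point \<times> point \<times> point) set" where
  "triangles =
    {(vector [0,0,0], vector [1,0,0], apex), (vector [1,0,0], vector [1,1,0], apex),
     (vector [1,1,0], vector [0,1,0], apex), (vector [0,1,0], vector [0,0,0], apex)}"

fun edge_set :: "point \<times> point \<Rightarrow> point set" where
  "edge_set (v, w) = closed_segment v w"

fun triangle_set :: "point \<times> point \<times> point \<Rightarrow> point set" where
  "triangle_set (a, b, c) = convex hull {a, b, c}"

definition base :: "point set" where
  "base = {p \<in> pyramid. p$3 = 0}"

definition faces :: "point set set" where
  "faces = insert base (triangle_set ` triangles)"

definition inf_pyramid :: "point set" where
  "inf_pyramid = {p. 0 \<le> p$1 \<and> p$1 \<le> 1 \<and> 0 \<le> p$2 \<and> p$2 \<le> 1 \<and> 0 \<le> p$3}"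

definition \<phi> :: "point \<Rightarrow> point" where
  "\<phi> p = vector [p$1 / (1 + p$3), p$2 / (1 + p$3), p$3 / (1 + p$3)]"

section \<open>Polynomial and rational spaces\<close>

text \<open>Degree bounds are integers: a negative bound yields \<open>span {} = {0}\<close>.\<close>

definition Q_poly :: "int \<Rightarrow> int \<Rightarrow> int \<Rightarrow> scalar_field set" where
  "Q_poly l m n = span {\<lambda>p. p$1 ^ a * p$2 ^ b * p$3 ^ c | a b c.
     int a \<le> l \<and> int b \<le> m \<and> int c \<le> n}"

definition P_poly :: "int \<Rightarrow> scalar_field set" where
  "P_poly n = span {\<lambda>p. p$1 ^ a * p$2 ^ b * p$3 ^ c | a b c. int (a + b + c) \<le> n}"

definition P2_poly :: "int \<Rightarrow> (real \<times> real \<Rightarrow> real) set" where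
  "P2_poly n = span {\<lambda>(w, z). w ^ a * z ^ b | a b. int (a + b) \<le> n}"

text \<open>On an edge or a face, which lies in an affine subspace, the polynomials of degree at most
  \<open>n\<close> are the restrictions of those in the ambient coordinates.\<close>

definition P_on :: "int \<Rightarrow> point set \<Rightarrow> scalar_field set" where
  "P_on n A = ext0 A ` P_poly n"

definition Q_base :: "int \<Rightarrow> int \<Rightarrow> scalar_field set" where
  "Q_base m n = ext0 base ` Q_poly m n 0"

definition Q_frac :: "nat \<Rightarrow> int \<Rightarrow> int \<Rightarrow> int \<Rightarrow> scalar_field set" where
  "Q_frac k l m n = {ext0 inf_pyramid (\<lambda>p. u p / (1 + p$3) ^ k) | u. u \<in> Q_poly l m n}"

definition P2_frac :: "nat \<Rightarrow> int \<Rightarrow> (real \<times> real \<Rightarrow> real) set" where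
  "P2_frac k n = {\<lambda>(w, z). u (w, z) / (1 + z) ^ k | u. u \<in> P2_poly n}"

section \<open>The approximation space\<close>

definition U_bar_inf :: "nat \<Rightarrow> scalar_field set" where
  "U_bar_inf k = {f + g | f g. f \<in> Q_frac k (int k) (int k) (int k - 1) \<and>
     g \<in> span {ext0 inf_pyramid (\<lambda>p. p$3 ^ k / (1 + p$3) ^ k)}}"

definition U_inf :: "nat \<Rightarrow> scalar_field set" where
  "U_inf k = {u \<in> U_bar_inf k.
     (\<forall>c\<in>{0, 1}.
       (\<exists>g\<in>P2_frac k (int k). \<forall>p\<in>inf_pyramid. p$2 = c \<longrightarrow> u p = g (p$1, p$3)) \<and>
       (\<exists>g\<in>P2_frac k (int k). \<forall>p\<in>inf_pyramid. p$1 = c \<longrightarrow> u p = g (p$2, p$3)))}"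

text \<open>\<open>\<phi>\<close> maps \<open>inf_pyramid\<close> onto the pyramid without its apex; the value at the apex is that of
  the continuous extension.\<close>

definition push :: "scalar_field \<Rightarrow> scalar_field" where
  "push u = ext0 pyramid
     (\<lambda>x. if x = apex then Lim (at apex within pyramid) (\<lambda>y. u (inv_into inf_pyramid \<phi> y))
          else u (inv_into inf_pyramid \<phi> x))"

definition U_space :: "nat \<Rightarrow> scalar_field set" where
  "U_space k = push ` U_inf k"

definition U0_space :: "nat \<Rightarrow> scalar_field set" where
  "U0_space k = {p \<in> U_space k. \<forall>x\<in>frontier pyramid. p x = 0}"

section \<open>The Sobolev space\<close>

definition partial :: "3 \<Rightarrow> scalar_field \<Rightarrow> scalar_field" where
  "partial i f = (\<lambda>x. frechet_derivative f (at x) (axis i 1))"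

primrec Ck :: "nat \<Rightarrow> scalar_field \<Rightarrow> bool" where
  "Ck 0 f \<longleftrightarrow> continuous_on UNIV f"
| "Ck (Suc n) f \<longleftrightarrow> (\<forall>x. f differentiable at x) \<and> (\<forall>i. Ck n (partial i f))"

definition test_function :: "point set \<Rightarrow> scalar_field \<Rightarrow> bool" where
  "test_function D f \<longleftrightarrow> (\<forall>n. Ck n f) \<and>
     compact (closure {x. f x \<noteq> 0}) \<and> closure {x. f x \<noteq> 0} \<subseteq> D"

definition in_L2 :: "point set \<Rightarrow> scalar_field \<Rightarrow> bool" where
  "in_L2 D f \<longleftrightarrow> set_borel_measurable lebesgue D f \<and> set_integrable lebesgue D (\<lambda>x. (f x)\<^sup>2)"

definition weak_partial :: "point set \<Rightarrow> 3 \<Rightarrow> scalar_field \<Rightarrow> scalar_field \<Rightarrow> bool" where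
  "weak_partial D i f g \<longleftrightarrow> (\<forall>h. test_function D h \<longrightarrow>
     (LINT x:D|lebesgue. f x * partial i h x) = - (LINT x:D|lebesgue. g x * h x))"

text \<open>\<open>D\<close> is meant to be open.\<close>

definition in_H1 :: "point set \<Rightarrow> scalar_field \<Rightarrow> bool" where
  "in_H1 D f \<longleftrightarrow> in_L2 D f \<and> (\<forall>i. \<exists>g. in_L2 D g \<and> weak_partial D i f g)"

section \<open>Degrees of freedom\<close>

definition grad :: "scalar_field \<Rightarrow> point \<Rightarrow> point" where
  "grad f x = (\<chi> i. partial i f x)"

fun edge_integral :: "point \<times> point \<Rightarrow> scalar_field \<Rightarrow> real" where
  "edge_integral (v, w) f = dist v w * (LINT t:{0..1}|lebesgue. f (linepath v w t))"

text \<open>The factor is the area element of the affine parametrisation over the unit triangle.\<close>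

fun triangle_integral :: "point \<times> point \<times> point \<Rightarrow> scalar_field \<Rightarrow> real" where
  "triangle_integral (a, b, c) f = norm (cross3 (b - a) (c - a)) *
     (LINT st:{(s::real, t::real). 0 \<le> s \<and> 0 \<le> t \<and> s + t \<le> 1}|lebesgue.
        f (a + fst st *\<^sub>R (b - a) + snd st *\<^sub>R (c - a)))"

definition base_integral :: "scalar_field \<Rightarrow> real" where
  "base_integral f = (LINT st:{0..1} \<times> {0..1}|lebesgue. f (vector [fst st, snd st, 0]))"

text \<open>The boundary is left out because functions are extended by zero beyond it and need not be
  differentiable there; it is a null set.\<close>

definition pyramid_integral :: "scalar_field \<Rightarrow> real" where
  "pyramid_integral f = (LINT x:interior pyramid|lebesgue. f x)"

text \<open>Names of functionals: the geometric entity together with the weight function.\<close>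

datatype dof =
    Vertex_dof point
  | Edge_dof "point \<times> point" scalar_field
  | Triangle_dof "point \<times> point \<times> point" scalar_field
  | Base_dof scalar_field
  | Volume_dof scalar_field

primrec dof_eval :: "dof \<Rightarrow> scalar_field \<Rightarrow> real" where
  "dof_eval (Vertex_dof v) p = p v"
| "dof_eval (Edge_dof e q) p = edge_integral e (\<lambda>x. p x * q x)"
| "dof_eval (Triangle_dof s q) p = triangle_integral s (\<lambda>x. p x * q x)"
| "dof_eval (Base_dof q) p = base_integral (\<lambda>x. p x * q x)"
| "dof_eval (Volume_dof q) p = pyramid_integral (\<lambda>x. grad p x \<bullet> grad q x)"

primrec dof_entity :: "dof \<Rightarrow> point set" where
  "dof_entity (Vertex_dof v) = {v}"
| "dof_entity (Edge_dof e q) = edge_set e"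
| "dof_entity (Triangle_dof s q) = triangle_set s"
| "dof_entity (Base_dof q) = base"
| "dof_entity (Volume_dof q) = pyramid"

text \<open>\<open>BE e\<close>, \<open>BT s\<close>, \<open>BB\<close>, \<open>BV\<close> are the chosen bases of weight functions.\<close>

definition dofs ::
  "(point \<times> point \<Rightarrow> scalar_field set) \<Rightarrow> (point \<times> point \<times> point \<Rightarrow> scalar_field set) \<Rightarrow>
   scalar_field set \<Rightarrow> scalar_field set \<Rightarrow> dof set" where
  "dofs BE BT BB BV =
     Vertex_dof ` vertices \<union>
     {Edge_dof e q | e q. e \<in> edges \<and> q \<in> BE e} \<union>
     {Triangle_dof s q | s q. s \<in> triangles \<and> q \<in> BT s} \<union>
     Base_dof ` BB \<union>
     Volume_dof ` BV"

text \<open>An entity contained in a face is the face itself, one of its edges or one of its vertices.\<close>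

definition face_dofs :: "dof set \<Rightarrow> point set \<Rightarrow> dof set" where
  "face_dofs \<Sigma> F = {m \<in> \<Sigma>. dof_entity m \<subseteq> F}"

definition H1_conforming :: "scalar_field set \<Rightarrow> dof set \<Rightarrow> bool" where
  "H1_conforming U \<Sigma> \<longleftrightarrow> (\<forall>p\<in>U. in_H1 (interior pyramid) p) \<and>
     (\<forall>F\<in>faces. \<forall>p\<in>U. (\<forall>m\<in>face_dofs \<Sigma> F. dof_eval m p = 0) \<longleftrightarrow> (\<forall>x\<in>F. p x = 0))"

definition unisolvent :: "scalar_field set \<Rightarrow> dof set \<Rightarrow> bool" where
  "unisolvent U \<Sigma> \<longleftrightarrow> (\<forall>c :: dof \<Rightarrow> real. \<exists>!u. u \<in> U \<and> (\<forall>m\<in>\<Sigma>. dof_eval m u = c m))"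

end

theory Submission
  imports Defs
begin

text \<open>
  Pulled back to the finite pyramid, the space is spanned by \<open>\<zeta>^k\<close> and by the functions
  \<open>(\<xi>/(1-\<zeta>))^a (\<eta>/(1-\<zeta>))^b \<zeta>^c (1-\<zeta>)^d\<close> with \<open>d \<ge> 1\<close>, which are continuous up to
  the apex and have bounded gradient, whence \<open>H^1\<close>. On a triangular face the traces are polynomials
  of degree \<open>k\<close>, on the base they lie in \<open>Q^{k,k}\<close>. A trace vanishing on the boundary of an edge or
  face is a bubble times a polynomial of the degree of the weight functions; tested against that very
  polynomial it must vanish. A function with vanishing boundary values that is orthogonal to itself
  in the Dirichlet form is constant, hence zero.

  For existence no dimension is counted. Vertices, edges, triangles, base and volume are treated in
  this order: for each entity there are functions in the space whose trace is a bubble times an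
  arbitrary weight function and which vanish on all entities treated before and on the others of the
  same kind, and the corresponding Gram matrix is that of a definite form. All functions needed for
  the vertices, edges and triangles have the form \<open>\<lambda>\<^sub>j \<lambda>\<^sub>j\<^sub>+\<^sub>3 / (1-\<zeta>) * r(\<lambda>\<^sub>j\<^sub>+\<^sub>1, \<zeta>)\<close>, where
  \<open>\<lambda>\<^sub>j\<close> runs cyclically through \<open>1-\<zeta>-\<eta>\<close>, \<open>\<xi>\<close>, \<open>\<eta>\<close>, \<open>1-\<zeta>-\<xi>\<close>.
\<close>

section \<open>Linear functionals and definite forms\<close>

text \<open>The pullback turns \<open>z/(1+z)\<close> into zeta and \<open>1/(1+z)\<close> into
  \<open>1 - zeta\<close>, so a numerator of degree c in z receives the factor
  \<open>(1-zeta)^(k-c)\<close>. The bound k-1 on that degree makes all these functions vanish at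
  the apex; \<open>zeta^k\<close> is the one generator with a nonzero value there. The obstacle is
  the trace condition on the vertical faces: it is not visible on the generators, so no basis of the
  space is at hand. Explicit members are found through the identity lambda_j + lambda_{j+2} = 1 -
  zeta. On the face lambda_{j+2} = 0 the denominator cancels against lambda_j, on the face
  lambda_{j+1} = 0 against lambda_{j+3}, and on the other two faces the numerator vanishes. Taking r
  divisible by its first argument removes the trace on lambda_{j+1} = 0, by its second argument the
  trace on the base. The gradients are bounded but may have no limit at the apex. Integration by
  parts is therefore done only against test functions supported inside the open pyramid, where the
  functions have continuous partial derivatives.\<close>

lemma subspace_pointwise:
  fixes V :: "('a \<Rightarrow> real) set"
  assumes "subspace V"
  shows "(\<lambda>x. 0) \<in> V"
    and "f \<in> V \<Longrightarrow> g \<in> V \<Longrightarrow> (\<lambda>x. f x + g x) \<in> V"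
    and "f \<in> V \<Longrightarrow> g \<in> V \<Longrightarrow> (\<lambda>x. f x - g x) \<in> V"
    and "f \<in> V \<Longrightarrow> (\<lambda>x. c * f x) \<in> V"
proof -
  show "(\<lambda>x. 0) \<in> V" using subspace_0[OF assms] by (simp add: zero_fun_def)
  show "f \<in> V \<Longrightarrow> g \<in> V \<Longrightarrow> (\<lambda>x. f x + g x) \<in> V"
    using subspace_add[OF assms, of f g] by (simp add: plus_fun_def)
  show "f \<in> V \<Longrightarrow> g \<in> V \<Longrightarrow> (\<lambda>x. f x - g x) \<in> V"
    using subspace_diff[OF assms, of f g] by (simp add: fun_diff_def)
  show "f \<in> V \<Longrightarrow> (\<lambda>x. c * f x) \<in> V"
    using subspace_scale[OF assms, of f c] by (simp add: scaleR_fun_def)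
qed

lemma subspace_pointwise_sum:
  fixes V :: "('a \<Rightarrow> real) set"
  assumes "subspace V" "\<And>i. i \<in> I \<Longrightarrow> f i \<in> V"
  shows "(\<lambda>x. \<Sum>i\<in>I. f i x) \<in> V"
  using assms(2)
  by (induction I rule: infinite_finite_induct)
    (auto intro: subspace_pointwise[OF assms(1)])

text \<open>Composition with a map followed by multiplication with a weight is linear in
  \<open>f\<close>, so membership is decided on generators. All later transfers of polynomial spaces
  (substitution, products, \<open>lift\<close>, \<open>base_lift\<close>) are instances.\<close>

lemma span_weighted_compose:
  fixes f :: "'a \<Rightarrow> real" and w :: "'b \<Rightarrow> real"
  assumes "f \<in> span S" "subspace V" and "\<And>g. g \<in> S \<Longrightarrow> (\<lambda>x. w x * g (A x)) \<in> V"
  shows "(\<lambda>x. w x * f (A x)) \<in> V"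
  using assms(1)
proof (induction rule: span_induct_alt)
  case base
  show ?case using subspace_pointwise(1)[OF assms(2)] by simp
next
  case (step c g h)
  have "(\<lambda>x. c * (w x * g (A x)) + w x * h (A x)) \<in> V"
    using step assms(3) by (intro subspace_pointwise(2,4)[OF assms(2)])
  then show ?case by (simp add: scaleR_fun_def algebra_simps)
qed

lemma span_compose:
  fixes f :: "'a \<Rightarrow> real"
  assumes "f \<in> span S" and "\<And>g. g \<in> S \<Longrightarrow> (\<lambda>x. g (A x)) \<in> span T"
  shows "(\<lambda>x. f (A x)) \<in> span T"
  using span_weighted_compose[OF assms(1) subspace_span, of "\<lambda>_. 1" A T] assms(2) by simp

lemma span_mult:
  fixes f g :: "'a \<Rightarrow> real"
  assumes f: "f \<in> span S" and g: "g \<in> span T"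
    and ST: "\<And>u v. u \<in> S \<Longrightarrow> v \<in> T \<Longrightarrow> (\<lambda>x. u x * v x) \<in> span R"
  shows "(\<lambda>x. f x * g x) \<in> span R"
proof -
  have "(\<lambda>x. g x * u x) \<in> span R" if "u \<in> S" for u
    using span_weighted_compose[OF g subspace_span, of u "\<lambda>x. x" R] ST[OF that] by (simp add: mult.commute)
  then show ?thesis
    using span_weighted_compose[OF f subspace_span, of g "\<lambda>x. x" R] by (simp add: mult.commute)
qed

text \<open>Linearity is asked on \<open>V\<close> only: the degrees of freedom are integrals and
  derivatives, which are additive on the functions of the space but not on arbitrary
  functions.\<close>

definition linear_functional_on :: "'a::real_vector set \<Rightarrow> ('a \<Rightarrow> real) \<Rightarrow> bool" where
  "linear_functional_on V F \<longleftrightarrow>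
     (\<forall>x\<in>V. \<forall>y\<in>V. F (x + y) = F x + F y) \<and> (\<forall>x\<in>V. \<forall>c. F (c *\<^sub>R x) = c * F x)"

lemma linear_functional_onD:
  assumes "linear_functional_on V F" "subspace V" "x \<in> V" "y \<in> V"
  shows "F (x + y) = F x + F y" "F (c *\<^sub>R x) = c * F x" "F 0 = 0" "F (x - y) = F x - F y"
proof -
  show add: "F (x + y) = F x + F y" and scale: "F (c *\<^sub>R x) = c * F x"
    using assms by (auto simp: linear_functional_on_def)
  have "F (0 *\<^sub>R x) = 0 * F x" using assms by (auto simp only: linear_functional_on_def)
  then show "F 0 = 0" by simp
  have "F (x + (-1) *\<^sub>R y) = F x + (-1) * F y"
    using assms subspace_scale[of V y "-1"] unfolding linear_functional_on_def by metis
  then show "F (x - y) = F x - F y" by simp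
qed

lemma linear_functional_on_span_zero:
  assumes "linear_functional_on V F" "subspace V" "B \<subseteq> V"
    and "\<And>q. q \<in> B \<Longrightarrow> F q = 0" and "x \<in> span B"
  shows "F x = 0"
proof -
  have "subspace {x \<in> V. F x = 0}"
    using assms(1,2) linear_functional_onD[OF assms(1,2)]
    by (auto simp: subspace_def)
  then have "span B \<subseteq> {x \<in> V. F x = 0}"
    using assms(3,4) by (intro span_minimal) auto
  then show ?thesis using assms(5) by auto
qed

text \<open>Gram--Schmidt. Symmetry of the form is irrelevant; what matters is that it is definite.\<close>

lemma definite_form_solve:
  fixes b :: "'a::real_vector \<Rightarrow> 'a \<Rightarrow> real"
  assumes V: "subspace V"
    and lin1: "\<And>y. y \<in> V \<Longrightarrow> linear_functional_on V (\<lambda>x. b x y)"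
    and lin2: "\<And>x. x \<in> V \<Longrightarrow> linear_functional_on V (b x)"
    and definite: "\<And>x. x \<in> V \<Longrightarrow> b x x = 0 \<Longrightarrow> x = 0"
    and "finite B" "independent B" "B \<subseteq> V"
  shows "\<exists>v\<in>span B. \<forall>q\<in>B. b v q = c q"
  using \<open>finite B\<close> \<open>independent B\<close> \<open>B \<subseteq> V\<close>
proof (induction B arbitrary: c rule: finite_induct)
  case empty
  then show ?case using span_zero by blast
next
  case (insert x B)
  have indep: "independent B" and x: "x \<notin> span B"
    using insert.prems(1) insert.hyps(2) by (auto simp: independent_insert)
  have sub: "span B \<subseteq> V" and xV: "x \<in> V" and BV: "B \<subseteq> V"
    using insert.prems V by (auto simp: span_minimal)
  obtain v0 where v0: "v0 \<in> span B" "\<forall>q\<in>B. b v0 q = c q"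
    using insert.IH[OF indep, of c] insert.prems by auto
  \<comment> \<open>The induction hypothesis, applied with the values of \<open>b x\<close> as
    right-hand side, already yields the projection of \<open>x\<close> to
    \<open>span B\<close>.\<close>
  obtain p where p: "p \<in> span B" "\<forall>q\<in>B. b p q = b x q"
    using insert.IH[OF indep, of "b x"] insert.prems by auto
  define x' where "x' = x - p"
  have x'V: "x' \<in> V" unfolding x'_def using xV p sub V by (auto intro: subspace_diff)
  have pV: "p \<in> V" "v0 \<in> V" using p v0 sub by auto
  have orth: "b x' q = 0" if "q \<in> B" for q
    using linear_functional_onD(4)[OF lin1 V xV pV(1), of q] that BV p(2) by (auto simp: x'_def)
  have orth': "b x' y = 0" if "y \<in> span B" for y
    using linear_functional_on_span_zero[OF lin2[OF x'V] V BV orth that] .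
  have "x' \<noteq> 0" using x p unfolding x'_def by auto
  then have nz: "b x' x' \<noteq> 0" using definite x'V by blast
  \<comment> \<open>Since \<open>b x' p = 0\<close>, pairing \<open>x'\<close> with the new basis
    vector gives the nonzero number \<open>b x' x'\<close>. A multiple of \<open>x'\<close> thus
    adjusts the value at \<open>x\<close> and leaves those at \<open>B\<close> alone.\<close>
  have xx: "b x' x = b x' x'"
    using linear_functional_onD(4)[OF lin2[OF x'V] V xV pV(1)] orth'[OF p(1)] by (simp add: x'_def)
  define t where "t = (c x - b v0 x) / b x' x'"
  have b_eq: "b (v0 + t *\<^sub>R x') q = b v0 q + t * b x' q" if "q \<in> V" for q
    using linear_functional_onD(1)[OF lin1[OF that] V pV(2) subspace_scale[OF V x'V, of t]]
      linear_functional_onD(2)[OF lin1[OF that] V x'V x'V, of t] by simp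
  have "v0 + t *\<^sub>R x' \<in> span (insert x B)"
    unfolding x'_def using v0(1) p(1)
    by (intro span_add span_scale span_diff) (auto intro: span_base span_mono[THEN subsetD])
  moreover have "b (v0 + t *\<^sub>R x') q = c q" if "q \<in> insert x B" for q
    using that b_eq[of q] xV BV orth v0(2) nz xx by (auto simp: t_def field_simps)
  ultimately show ?case by blast
qed

definition interpolates :: "'a::real_vector set \<Rightarrow> ('m \<Rightarrow> 'a \<Rightarrow> real) \<Rightarrow> 'm set \<Rightarrow> bool" where
  "interpolates U F M \<longleftrightarrow> (\<forall>c. \<exists>u\<in>U. \<forall>m\<in>M. F m u = c m)"

lemma interpolates_empty: "subspace U \<Longrightarrow> interpolates U F {}"
  unfolding interpolates_def using subspace_0 by blast

text \<open>Block triangular elimination: the values on \<open>M\<close> are fixed first, and the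
  defect on \<open>N\<close> is corrected inside the common kernel of \<open>M\<close>.\<close>

lemma interpolates_Un:
  assumes U: "subspace U"
    and lin: "\<And>m. m \<in> M \<union> N \<Longrightarrow> linear_functional_on U (F m)"
    and M: "interpolates U F M"
    and N: "interpolates {u\<in>U. \<forall>m\<in>M. F m u = 0} F N"
  shows "interpolates U F (M \<union> N)"
  unfolding interpolates_def
proof
  fix c
  obtain u where u: "u \<in> U" "\<forall>m\<in>M. F m u = c m"
    using M unfolding interpolates_def by blast
  obtain w where w: "w \<in> U" "\<forall>m\<in>M. F m w = 0" "\<forall>m\<in>N. F m w = c m - F m u"
    using N[unfolded interpolates_def, rule_format, of "\<lambda>m. c m - F m u"] by auto
  have "F m (u + w) = c m" if "m \<in> M \<union> N" for m
    using linear_functional_onD(1)[OF lin[OF that] U u(1) w(1)] that u w by auto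
  then show "\<exists>u\<in>U. \<forall>m\<in>M \<union> N. F m u = c m"
    using subspace_add[OF U u(1) w(1)] by blast
qed

text \<open>Functions for block \<open>i\<close> that vanish on all other blocks vanish in
  particular on those already treated, so the finite family can be added one block at a time in any
  order.\<close>

lemma interpolates_UN:
  assumes U: "subspace U"
    and lin: "\<And>m. m \<in> M \<union> (\<Union>i\<in>I. N i) \<Longrightarrow> linear_functional_on U (F m)"
    and M: "interpolates U F M"
    and "finite I"
    and N: "\<And>i. i \<in> I \<Longrightarrow>
       interpolates {u\<in>U. \<forall>m\<in>M \<union> (\<Union>j\<in>I - {i}. N j). F m u = 0} F (N i)"
  shows "interpolates U F (M \<union> (\<Union>i\<in>I. N i))"
proof -
  have "interpolates U F (M \<union> (\<Union>i\<in>J. N i))" if "finite J" "J \<subseteq> I" for J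
    using that
  proof (induction J rule: finite_induct)
    case empty
    then show ?case using M by simp
  next
    case (insert i J)
    have "interpolates {u\<in>U. \<forall>m\<in>M \<union> (\<Union>j\<in>J. N j). F m u = 0} F (N i)"
      unfolding interpolates_def
    proof
      fix c
      obtain u where "u \<in> U" "\<forall>m\<in>M \<union> (\<Union>j\<in>I - {i}. N j). F m u = 0" "\<forall>m\<in>N i. F m u = c m"
        using N[of i] insert.prems unfolding interpolates_def by fastforce
      moreover have "J \<subseteq> I - {i}" using insert by auto
      ultimately show "\<exists>u\<in>{u\<in>U. \<forall>m\<in>M \<union> (\<Union>j\<in>J. N j). F m u = 0}. \<forall>m\<in>N i. F m u = c m"
        by (intro bexI[of _ u]) auto
    qed
    moreover have "interpolates U F (M \<union> (\<Union>j\<in>J. N j))" using insert by simp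
    moreover have "linear_functional_on U (F m)" if "m \<in> M \<union> (\<Union>j\<in>J. N j) \<union> N i" for m
      using that insert.prems by (intro lin) auto
    ultimately have "interpolates U F ((M \<union> (\<Union>j\<in>J. N j)) \<union> N i)"
      using interpolates_Un[OF U, of "M \<union> (\<Union>j\<in>J. N j)" "N i" F] by blast
    then show ?case by (simp add: Un_ac)
  qed
  from this[OF \<open>finite I\<close>] show ?thesis by simp
qed

section \<open>Vanishing integrals of nonnegative continuous functions\<close>

lemma set_integrable_lebesgue_compact:
  fixes f :: "'a::euclidean_space \<Rightarrow> real"
  assumes "compact K" "continuous_on K f"
  shows "set_integrable lebesgue K f"
  using borel_integrable_compact[OF assms] integrable_completion borel_measurable_integrable
  unfolding set_integrable_def by blast

text \<open>The set where \<open>g\<close> is nonzero inside \<open>K\<close> is open and contained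
  in a null set, and a nonempty open set is not negligible.\<close>

lemma nonneg_set_integral_zero_interior:
  fixes g :: "'a::euclidean_space \<Rightarrow> real"
  assumes int: "set_integrable lebesgue K g" and zero: "(LINT x:K|lebesgue. g x) = 0"
    and nonneg: "\<And>x. x \<in> K \<Longrightarrow> 0 \<le> g x" and cont: "continuous_on (interior K) g"
    and x: "x \<in> interior K"
  shows "g x = 0"
proof (rule ccontr)
  assume "g x \<noteq> 0"
  let ?S = "interior K \<inter> g -` (- {0})"
  have "open ?S" using cont by (intro continuous_open_preimage) auto
  moreover have "negligible ?S"
  proof -
    have "0 \<le> indicator K x *\<^sub>R g x" for x using nonneg[of x] by (cases "x \<in> K") auto
    then have "AE x in lebesgue. 0 \<le> indicator K x *\<^sub>R g x" by (intro AE_I2)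
    from integral_nonneg_eq_0_iff_AE[OF int[unfolded set_integrable_def] this]
    have "AE x in lebesgue. indicator K x *\<^sub>R g x = 0"
      using zero unfolding set_lebesgue_integral_def by simp
    then obtain N where N: "N \<in> null_sets lebesgue" "{x. \<not> (indicator K x *\<^sub>R g x = 0)} \<subseteq> N"
      by (auto simp: eventually_ae_filter)
    have "?S \<subseteq> {x. \<not> (indicator K x *\<^sub>R g x = 0)}"
      using interior_subset[of K] by (auto simp: indicator_def)
    with N(2) have "?S \<subseteq> N" by (rule order_trans[rotated])
    moreover have "negligible N" using N(1) by (simp add: negligible_iff_null_sets)
    ultimately show ?thesis by (rule negligible_subset[rotated])
  qed
  moreover have "x \<in> ?S" using x \<open>g x \<noteq> 0\<close> by simp
  ultimately show False using open_not_negligible[of ?S] by (metis empty_iff)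
qed

text \<open>The integrand is \<open>w\<close> times a square. It vanishes in the interior, where
  \<open>w\<close> can be divided out; on the boundary, where a bubble is zero, \<open>R\<close>
  vanishes by continuity from the interior.\<close>

lemma positive_weight_integral_zero:
  fixes w R :: "'a::euclidean_space \<Rightarrow> real"
  assumes "compact K" and K: "K \<subseteq> closure (interior K)"
    and w: "continuous_on K w" "\<And>x. x \<in> K \<Longrightarrow> 0 \<le> w x" "\<And>x. x \<in> interior K \<Longrightarrow> 0 < w x"
    and R: "continuous_on K R"
    and zero: "(LINT x:K|lebesgue. w x * R x * R x) = 0"
    and "x \<in> K"
  shows "R x = 0"
proof -
  have cont: "continuous_on K (\<lambda>x. w x * R x * R x)" using w R by (intro continuous_intros)
  have int0: "R x = 0" if "x \<in> interior K" for x
  proof -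
    have "w x * R x * R x = 0"
      using continuous_on_subset[OF cont interior_subset] w(2) that
      by (intro nonneg_set_integral_zero_interior[OF set_integrable_lebesgue_compact[OF \<open>compact K\<close> cont] zero])
        (auto simp: mult.assoc)
    then show ?thesis using w(3)[OF that] by auto
  qed
  have "closure (interior K) \<subseteq> K"
    using \<open>compact K\<close> closure_minimal compact_imp_closed interior_subset by blast
  with K have "closure (interior K) = K" by auto
  then show ?thesis
    using continuous_constant_on_closure[of "interior K" R 0 x] R int0 \<open>x \<in> K\<close> by auto
qed

section \<open>Polynomial spaces and divisibility by bubbles\<close>

lemma P2_poly_span:
  "P2_poly n = span {\<lambda>x. fst x ^ a * snd x ^ b | a b. int (a + b) \<le> n}"
  unfolding P2_poly_def by (simp add: case_prod_unfold)

lemma P2_poly_monomial: "int (a + b) \<le> n \<Longrightarrow> (\<lambda>x. fst x ^ a * snd x ^ b) \<in> P2_poly n"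
  unfolding P2_poly_span by (rule span_base) blast

lemma P_poly_monomial:
  "int (a + b + c) \<le> n \<Longrightarrow> (\<lambda>p. p$1 ^ a * p$2 ^ b * p$3 ^ c) \<in> P_poly n"
  unfolding P_poly_def by (rule span_base) blast

lemma Q_poly_monomial:
  "int a \<le> l \<Longrightarrow> int b \<le> m \<Longrightarrow> int c \<le> n \<Longrightarrow>
   (\<lambda>p. p$1 ^ a * p$2 ^ b * p$3 ^ c) \<in> Q_poly l m n"
  unfolding Q_poly_def by (rule span_base) blast

lemma subspace_P2_poly: "subspace (P2_poly n)"
  by (simp add: P2_poly_def)

lemma subspace_P_poly: "subspace (P_poly n)"
  by (simp add: P_poly_def)

lemma subspace_Q_poly: "subspace (Q_poly l m n)"
  by (simp add: Q_poly_def)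

lemma P2_poly_mult: "f \<in> P2_poly m \<Longrightarrow> g \<in> P2_poly n \<Longrightarrow> (\<lambda>x. f x * g x) \<in> P2_poly (m + n)"
  unfolding P2_poly_span
proof (erule (1) span_mult, goal_cases)
  case (1 u v)
  then obtain a b a' b' where "u = (\<lambda>x. fst x ^ a * snd x ^ b)" "v = (\<lambda>x. fst x ^ a' * snd x ^ b')"
    "int (a + b) \<le> m" "int (a' + b') \<le> n" by auto
  moreover have "(\<lambda>x. fst x ^ (a + a') * snd x ^ (b + b')) \<in> P2_poly (m + n)"
    using calculation by (intro P2_poly_monomial) auto
  ultimately show ?case by (simp add: P2_poly_span power_add mult_ac)
qed

lemma P_poly_mult: "f \<in> P_poly m \<Longrightarrow> g \<in> P_poly n \<Longrightarrow> (\<lambda>x. f x * g x) \<in> P_poly (m + n)"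
  unfolding P_poly_def
proof (erule (1) span_mult, goal_cases)
  case (1 u v)
  then obtain a b c a' b' c' where "u = (\<lambda>p. p$1 ^ a * p$2 ^ b * p$3 ^ c)"
    "v = (\<lambda>p. p$1 ^ a' * p$2 ^ b' * p$3 ^ c')"
    "int (a + b + c) \<le> m" "int (a' + b' + c') \<le> n" by auto
  moreover have "(\<lambda>p. p$1 ^ (a + a') * p$2 ^ (b + b') * p$3 ^ (c + c')) \<in> P_poly (m + n)"
    using calculation by (intro P_poly_monomial) auto
  ultimately show ?case by (simp add: P_poly_def power_add mult_ac)
qed

lemma P2_poly_mono: "m \<le> n \<Longrightarrow> f \<in> P2_poly m \<Longrightarrow> f \<in> P2_poly n"
  unfolding P2_poly_def by (erule span_mono[THEN subsetD, rotated]) force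

lemma P_poly_mono: "m \<le> n \<Longrightarrow> f \<in> P_poly m \<Longrightarrow> f \<in> P_poly n"
  unfolding P_poly_def by (erule span_mono[THEN subsetD, rotated]) force

lemma P2_poly_const: "0 \<le> n \<Longrightarrow> (\<lambda>x. c) \<in> P2_poly n"
  using subspace_pointwise(4)[OF subspace_P2_poly P2_poly_monomial[of 0 0 n], of c] by simp

lemma P_poly_const: "0 \<le> n \<Longrightarrow> (\<lambda>x. c) \<in> P_poly n"
  using subspace_pointwise(4)[OF subspace_P_poly P_poly_monomial[of 0 0 0 n], of c] by simp

lemma P2_poly_coord: "1 \<le> n \<Longrightarrow> fst \<in> P2_poly n" "1 \<le> n \<Longrightarrow> snd \<in> P2_poly n"
  using P2_poly_monomial[of 1 0 n] P2_poly_monomial[of 0 1 n] by simp_all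

lemma P_poly_coord: "1 \<le> n \<Longrightarrow> (\<lambda>p. p$i) \<in> P_poly n"
  using P_poly_monomial[of 1 0 0 n] P_poly_monomial[of 0 1 0 n] P_poly_monomial[of 0 0 1 n]
    exhaust_3[of i] by auto

lemma P2_poly_power: "f \<in> P2_poly 1 \<Longrightarrow> (\<lambda>x. f x ^ a) \<in> P2_poly (int a)"
proof (induction a)
  case 0
  then show ?case by (simp add: P2_poly_const)
next
  case (Suc a)
  then show ?case using P2_poly_mult[of f 1 "\<lambda>x. f x ^ a" "int a"] by simp
qed

lemma P_poly_power: "f \<in> P_poly 1 \<Longrightarrow> (\<lambda>x. f x ^ a) \<in> P_poly (int a)"
proof (induction a)
  case 0
  then show ?case by (simp add: P_poly_const)
next
  case (Suc a)
  then show ?case using P_poly_mult[of f 1 "\<lambda>x. f x ^ a" "int a"] by simp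
qed

lemma P2_poly_compose:
  assumes "r \<in> P2_poly n" "f \<in> P2_poly 1" "g \<in> P2_poly 1"
  shows "(\<lambda>x. r (f x, g x)) \<in> P2_poly n"
  using assms(1) unfolding P2_poly_span[of n]
proof (rule span_compose)
  fix u :: "real \<times> real \<Rightarrow> real"
  assume "u \<in> {\<lambda>x. fst x ^ a * snd x ^ b |a b. int (a + b) \<le> n}"
  then obtain a b where u: "u = (\<lambda>x. fst x ^ a * snd x ^ b)" "int (a + b) \<le> n" by auto
  have "(\<lambda>x. f x ^ a * g x ^ b) \<in> P2_poly (int a + int b)"
    using assms P2_poly_mult P2_poly_power by blast
  then show "(\<lambda>x. u (f x, g x)) \<in> span {\<lambda>x. fst x ^ a * snd x ^ b |a b. int (a + b) \<le> n}"
    unfolding P2_poly_span[symmetric] u(1) using u(2) P2_poly_mono[of "int a + int b" n] by simp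
qed

lemma P2_poly_compose_P:
  assumes "r \<in> P2_poly n" "f \<in> P_poly 1" "g \<in> P_poly 1"
  shows "(\<lambda>x. r (f x, g x)) \<in> P_poly n"
  using assms(1) unfolding P2_poly_span[of n] P_poly_def[of n]
proof (rule span_compose)
  fix u :: "real \<times> real \<Rightarrow> real"
  assume "u \<in> {\<lambda>x. fst x ^ a * snd x ^ b |a b. int (a + b) \<le> n}"
  then obtain a b where u: "u = (\<lambda>x. fst x ^ a * snd x ^ b)" "int (a + b) \<le> n" by auto
  have "(\<lambda>x. f x ^ a * g x ^ b) \<in> P_poly (int a + int b)"
    using assms P_poly_mult P_poly_power by blast
  then show "(\<lambda>x. u (f x, g x)) \<in> span {\<lambda>p. p$1 ^ a * p$2 ^ b * p$3 ^ c |a b c. int (a + b + c) \<le> n}"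
    unfolding P_poly_def[symmetric] u(1) using u(2) P_poly_mono[of "int a + int b" n] by simp
qed

lemma P_poly_compose_P2:
  assumes "q \<in> P_poly n" "\<And>i. (\<lambda>x. A x $ i) \<in> P2_poly 1"
  shows "(\<lambda>x. q (A x)) \<in> P2_poly n"
  using assms(1) unfolding P2_poly_span[of n] P_poly_def[of n]
proof (rule span_compose)
  fix u :: scalar_field
  assume "u \<in> {\<lambda>p. p$1 ^ a * p$2 ^ b * p$3 ^ c |a b c. int (a + b + c) \<le> n}"
  then obtain a b c where u: "u = (\<lambda>p. p$1 ^ a * p$2 ^ b * p$3 ^ c)" "int (a + b + c) \<le> n" by auto
  have "(\<lambda>x. (A x $ 1) ^ a * (A x $ 2) ^ b * (A x $ 3) ^ c) \<in> P2_poly (int a + int b + int c)"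
    by (intro P2_poly_mult P2_poly_power assms)
  then show "(\<lambda>x. u (A x)) \<in> span {\<lambda>x. fst x ^ a * snd x ^ b |a b. int (a + b) \<le> n}"
    unfolding P2_poly_span[symmetric] u(1) using u(2) P2_poly_mono[of "int a + int b + int c" n] by simp
qed

text \<open>The base space in its two parameters. Division by edge equations is carried out in
  parameter coordinates and only afterwards carried back to \<open>Q_base\<close>.\<close>

definition Q2_poly :: "int \<Rightarrow> int \<Rightarrow> (real \<times> real \<Rightarrow> real) set" where
  "Q2_poly m n = span {\<lambda>x. fst x ^ a * snd x ^ b | a b. int a \<le> m \<and> int b \<le> n}"

lemma Q2_poly_monomial:
  "int a \<le> m \<Longrightarrow> int b \<le> n \<Longrightarrow> (\<lambda>x. fst x ^ a * snd x ^ b) \<in> Q2_poly m n"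
  unfolding Q2_poly_def by (rule span_base) blast

lemma subspace_Q2_poly: "subspace (Q2_poly m n)"
  by (simp add: Q2_poly_def)

lemma Q2_poly_swap: "f \<in> Q2_poly m n \<Longrightarrow> (\<lambda>x. f (snd x, fst x)) \<in> Q2_poly n m"
  unfolding Q2_poly_def
  by (erule span_compose) (auto intro!: span_base, metis mult.commute)

text \<open>The binomial expansion of \<open>(1 - y) ^ b\<close> stays within degree
  \<open>b\<close>. The reflection moves the edge where the second coordinate is 1 to the edge where
  it is 0, so that one division lemma serves both.\<close>

lemma Q2_poly_reflect: "f \<in> Q2_poly m n \<Longrightarrow> (\<lambda>x. f (fst x, 1 - snd x)) \<in> Q2_poly m n"
proof -
  assume "f \<in> Q2_poly m n"
  then show ?thesis unfolding Q2_poly_def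
  proof (rule span_compose)
    fix g :: "real \<times> real \<Rightarrow> real"
    assume "g \<in> {\<lambda>x. fst x ^ a * snd x ^ b |a b. int a \<le> m \<and> int b \<le> n}"
    then obtain a b where g: "g = (\<lambda>x. fst x ^ a * snd x ^ b)" "int a \<le> m" "int b \<le> n" by auto
    have "(\<lambda>x. \<Sum>i\<le>b. (of_nat (b choose i) * (-1) ^ i) * (fst x ^ a * snd x ^ i)) \<in> Q2_poly m n"
      using g by (intro subspace_pointwise_sum subspace_pointwise(4) subspace_Q2_poly Q2_poly_monomial) auto
    also have "(\<lambda>x. \<Sum>i\<le>b. (of_nat (b choose i) * (-1) ^ i) * (fst x ^ a * snd x ^ i))
      = (\<lambda>x::real \<times> real. fst x ^ a * (1 - snd x) ^ b)"
    proof
      fix x :: "real \<times> real"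
      have "(1 - snd x) ^ b = (\<Sum>i\<le>b. of_nat (b choose i) * (- snd x) ^ i * 1 ^ (b - i))"
        using binomial_ring[of "- snd x" 1 b] by simp
      also have "\<dots> = (\<Sum>i\<le>b. of_nat (b choose i) * (-1) ^ i * snd x ^ i)"
        by (intro sum.cong) (auto simp: power_minus[of "snd x"])
      finally show "(\<Sum>i\<le>b. (of_nat (b choose i) * (-1) ^ i) * (fst x ^ a * snd x ^ i))
        = fst x ^ a * (1 - snd x) ^ b" by (simp add: sum_distrib_left mult_ac)
    qed
    finally show "(\<lambda>x. g (fst x, 1 - snd x)) \<in> span {\<lambda>x. fst x ^ a * snd x ^ b |a b. int a \<le> m \<and> int b \<le> n}"
      using g by (simp add: Q2_poly_def)
  qed
qed

lemma Q_poly_compose_Q2: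
  assumes "q \<in> Q_poly m n 0"
  shows "(\<lambda>x. q (vector [fst x, snd x, 0])) \<in> Q2_poly m n"
  using assms unfolding Q_poly_def Q2_poly_def
proof (rule span_compose, goal_cases)
  case (1 g)
  then obtain a b where g: "g = (\<lambda>p. p$1 ^ a * p$2 ^ b)" "int a \<le> m" "int b \<le> n" by auto
  then show ?case unfolding Q2_poly_def[symmetric] g(1) using Q2_poly_monomial[of a m b n] by simp
qed

lemma Q2_poly_compose_Q:
  assumes "r \<in> Q2_poly m n"
  shows "(\<lambda>p. r (p$1, p$2)) \<in> Q_poly m n 0"
  using assms unfolding Q_poly_def Q2_poly_def
proof (rule span_compose, goal_cases)
  case (1 g)
  then obtain a b where g: "g = (\<lambda>x. fst x ^ a * snd x ^ b)" "int a \<le> m" "int b \<le> n" by auto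
  then show ?case unfolding Q_poly_def[symmetric] g(1) using Q_poly_monomial[of a m b n 0 0] by simp
qed

section \<open>Division by edge equations and bubbles\<close>

text \<open>An arbitrary exponent set \<open>S\<close> lets one argument cover both the total degree
  and the coordinatewise degree; dividing by the second variable shifts \<open>S\<close> down by
  one.\<close>

lemma span_monomials_divide_snd:
  fixes S :: "(nat \<times> nat) set"
  assumes f: "f \<in> span {\<lambda>x. fst x ^ a * snd x ^ b | a b. (a, b) \<in> S}"
    and zero: "\<And>s. 0 < s \<Longrightarrow> s < 1 \<Longrightarrow> f (s, 0) = (0::real)"
  obtains r where "r \<in> span {\<lambda>x. fst x ^ a * snd x ^ b | a b. (a, Suc b) \<in> S}"
    "\<And>x. f x = snd x * r x"
proof -
  let ?T = "{\<lambda>x. fst x ^ a * snd x ^ b | a b. (a, Suc b) \<in> S} :: (real \<times> real \<Rightarrow> real) set"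
  \<comment> \<open>Splitting off the terms without the second variable: \<open>p\<close> is the
    trace on the line where that variable is 0.\<close>
  from f have "\<exists>p r. r \<in> span ?T \<and> (\<forall>x. f x = poly p (fst x) + snd x * r x)"
  proof (induction rule: span_induct_alt)
    case base
    show ?case
      using subspace_pointwise(1)[OF subspace_span, of ?T]
      by (intro exI[of _ "0::real poly"] exI[of _ "\<lambda>x. 0"]) simp
  next
    case (step c u v)
    then obtain p r where pr: "r \<in> span ?T" "\<And>x. v x = poly p (fst x) + snd x * r x" by auto
    obtain a b where u: "u = (\<lambda>x. fst x ^ a * snd x ^ b)" "(a, b) \<in> S" using step by auto
    show ?case
    proof (cases b)
      case 0
      show ?thesis
        by (rule exI[of _ "monom c a + p"], rule exI[of _ r])
          (use pr u 0 in \<open>auto simp: scaleR_fun_def poly_monom\<close>)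
    next
      case (Suc b')
      have "(\<lambda>x. fst x ^ a * snd x ^ b') \<in> span ?T" using u Suc by (intro span_base) auto
      then have "(\<lambda>x. c * (fst x ^ a * snd x ^ b') + r x) \<in> span ?T"
        using pr by (intro subspace_pointwise(2,4)[OF subspace_span])
      moreover have "(c *\<^sub>R u + v) x = poly p (fst x) + snd x * (c * (fst x ^ a * snd x ^ b') + r x)" for x
        using pr u Suc by (simp add: scaleR_fun_def algebra_simps)
      ultimately show ?thesis by blast
    qed
  qed
  then obtain p r where pr: "r \<in> span ?T" "\<And>x. f x = poly p (fst x) + snd x * r x" by auto
  \<comment> \<open>The trace \<open>p\<close> has a whole interval of roots, so it is the zero
    polynomial.\<close>
  have "{0<..<1} \<subseteq> {s. poly p s = 0}" using zero pr(2) by force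
  moreover have "infinite {0<..<1::real}" by simp
  ultimately have "infinite {s. poly p s = 0}" using infinite_super by blast
  then have "p = 0" using poly_roots_finite by blast
  with pr show thesis by (intro that) auto
qed

lemma P2_poly_divide_snd:
  assumes "f \<in> P2_poly n" "\<And>s. 0 < s \<Longrightarrow> s < 1 \<Longrightarrow> f (s, 0) = 0"
  obtains r where "r \<in> P2_poly (n - 1)" "\<And>x. f x = snd x * r x"
proof (rule span_monomials_divide_snd[of f "{(a, b). int (a + b) \<le> n}"])
  fix r assume "r \<in> span {\<lambda>x. fst x ^ a * snd x ^ b |a b. (a, Suc b) \<in> {(a, b). int (a + b) \<le> n}}"
    "\<And>x. f x = snd x * r x"
  moreover have "(int (Suc (a + b)) \<le> n) = (int (a + b) \<le> n - 1)" for a b by auto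
  ultimately show thesis using that by (auto simp: P2_poly_span simp del: of_nat_Suc of_nat_add)
qed (use assms in \<open>auto simp: P2_poly_span\<close>)

lemma P2_poly_divide_fst:
  assumes "f \<in> P2_poly n" "\<And>t. 0 < t \<Longrightarrow> t < 1 \<Longrightarrow> f (0, t) = 0"
  obtains r where "r \<in> P2_poly (n - 1)" "\<And>x. f x = fst x * r x"
proof -
  have "(\<lambda>x. f (snd x, fst x)) \<in> P2_poly n"
    using P2_poly_compose[OF assms(1) P2_poly_coord(2,1)] by simp
  from P2_poly_divide_snd[OF this] assms(2) obtain r
    where r: "r \<in> P2_poly (n - 1)" "\<And>x. f (snd x, fst x) = snd x * r x" by auto
  have "(\<lambda>x. r (snd x, fst x)) \<in> P2_poly (n - 1)"
    using P2_poly_compose[OF r(1) P2_poly_coord(2,1)] by simp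
  then show thesis using r(2) that[of "\<lambda>x. r (snd x, fst x)"]
    by (metis fst_conv snd_conv prod.collapse)
qed

text \<open>The affine involution \<open>(s, t) -> (s, 1 - s - t)\<close> exchanges the hypotenuse
  with the edge \<open>t = 0\<close> and preserves the total degree.\<close>

lemma P2_poly_divide_diagonal:
  assumes "f \<in> P2_poly n" "\<And>s. 0 < s \<Longrightarrow> s < 1 \<Longrightarrow> f (s, 1 - s) = 0"
  obtains r where "r \<in> P2_poly (n - 1)" "\<And>x. f x = (1 - fst x - snd x) * r x"
proof -
  have aff: "(\<lambda>x. 1 - fst x - snd x) \<in> P2_poly 1"
    by (intro subspace_pointwise(3)[OF subspace_P2_poly] P2_poly_const P2_poly_coord) auto
  have "(\<lambda>x. f (fst x, 1 - fst x - snd x)) \<in> P2_poly n"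
    using P2_poly_compose[OF assms(1) P2_poly_coord(1) aff] by simp
  from P2_poly_divide_snd[OF this] assms(2) obtain r
    where r: "r \<in> P2_poly (n - 1)" "\<And>x. f (fst x, 1 - fst x - snd x) = snd x * r x" by auto
  have "(\<lambda>x. r (fst x, 1 - fst x - snd x)) \<in> P2_poly (n - 1)"
    using P2_poly_compose[OF r(1) P2_poly_coord(1) aff] by simp
  moreover have "f x = (1 - fst x - snd x) * r (fst x, 1 - fst x - snd x)" for x
    using r(2)[of "(fst x, 1 - fst x - snd x)"] by simp
  ultimately show thesis by (rule that)
qed

abbreviation triangle_bubble :: "real \<times> real \<Rightarrow> real" where
  "triangle_bubble x \<equiv> fst x * snd x * (1 - fst x - snd x)"

abbreviation square_bubble :: "real \<times> real \<Rightarrow> real" where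
  "square_bubble x \<equiv> fst x * (1 - fst x) * (snd x * (1 - snd x))"

text \<open>The three edge equations are divided out in turn. A factor already removed is nonzero on
  the other open edges, so the quotient still vanishes there; this is why only open edges enter the
  hypotheses.\<close>

lemma P2_poly_triangle_bubble:
  assumes f: "f \<in> P2_poly n"
    and z1: "\<And>s. 0 < s \<Longrightarrow> s < 1 \<Longrightarrow> f (s, 0) = 0"
    and z2: "\<And>t. 0 < t \<Longrightarrow> t < 1 \<Longrightarrow> f (0, t) = 0"
    and z3: "\<And>s. 0 < s \<Longrightarrow> s < 1 \<Longrightarrow> f (s, 1 - s) = 0"
  obtains r where "r \<in> P2_poly (n - 3)" "\<And>x. f x = triangle_bubble x * r x"
proof -
  obtain r1 where r1: "r1 \<in> P2_poly (n - 1)" "\<And>x. f x = snd x * r1 x"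
    using P2_poly_divide_snd[OF f z1] by blast
  have "r1 (0, t) = 0" if "0 < t" "t < 1" for t using z2[OF that] r1(2)[of "(0, t)"] that by simp
  from P2_poly_divide_fst[OF r1(1) this] obtain r2
    where r2: "r2 \<in> P2_poly (n - 1 - 1)" "\<And>x. r1 x = fst x * r2 x" by blast
  have "r2 (s, 1 - s) = 0" if "0 < s" "s < 1" for s
    using z3[OF that] r1(2)[of "(s, 1 - s)"] r2(2)[of "(s, 1 - s)"] that by simp
  from P2_poly_divide_diagonal[OF r2(1) this] obtain r3
    where r3: "r3 \<in> P2_poly (n - 1 - 1 - 1)" "\<And>x. r2 x = (1 - fst x - snd x) * r3 x" by blast
  show thesis by (rule that[of r3]) (use r1 r2 r3 in \<open>auto simp: mult_ac\<close>)
qed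

text \<open>Polynomials in one variable are treated as bivariate ones in \<open>snd x\<close>, so
  that the division lemma for the plane applies at both end points.\<close>

lemma P2_poly_interval_bubble:
  assumes f: "(\<lambda>x. f (snd x)) \<in> P2_poly n" and "f 0 = 0" "f 1 = 0"
  obtains r where "(\<lambda>x. r (snd x)) \<in> P2_poly (n - 2)" "\<And>t. f t = t * (1 - t) * r t"
proof -
  obtain r1 where r1: "r1 \<in> P2_poly (n - 1)" "\<And>x. f (snd x) = snd x * r1 x"
    using P2_poly_divide_snd[OF f] \<open>f 0 = 0\<close> by auto
  have aff: "(\<lambda>x. 1 - snd x) \<in> P2_poly 1"
    by (intro subspace_pointwise(3)[OF subspace_P2_poly] P2_poly_const P2_poly_coord) auto
  have "(\<lambda>x. r1 (fst x, 1 - snd x)) \<in> P2_poly (n - 1)"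
    using P2_poly_compose[OF r1(1) P2_poly_coord(1) aff] by simp
  moreover have "r1 (s, 1) = 0" for s using r1(2)[of "(s, 1)"] \<open>f 1 = 0\<close> by simp
  ultimately obtain r2 where r2: "r2 \<in> P2_poly (n - 1 - 1)" "\<And>x. r1 (fst x, 1 - snd x) = snd x * r2 x"
    using P2_poly_divide_snd[of "\<lambda>x. r1 (fst x, 1 - snd x)" "n - 1"] by auto
  \<comment> \<open>The cofactor is only known as a function of both variables; freezing the first
    one at 0 leaves a polynomial in \<open>t\<close> of the same degree bound.\<close>
  have "(\<lambda>x. r2 (0, 1 - snd x)) \<in> P2_poly (n - 1 - 1)"
    using P2_poly_compose[OF r2(1) P2_poly_const[of 1 0] aff] by simp
  moreover have "f t = t * (1 - t) * r2 (0, 1 - t)" for t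
    using r1(2)[of "(0, t)"] r2(2)[of "(0, 1 - t)"] by simp
  ultimately show thesis by (intro that[of "\<lambda>t. r2 (0, 1 - t)"]) auto
qed

lemma Q2_poly_divide_snd:
  assumes "f \<in> Q2_poly m n" "\<And>s. 0 < s \<Longrightarrow> s < 1 \<Longrightarrow> f (s, 0) = 0"
  obtains r where "r \<in> Q2_poly m (n - 1)" "\<And>x. f x = snd x * r x"
proof (rule span_monomials_divide_snd[of f "{(a, b). int a \<le> m \<and> int b \<le> n}"])
  fix r assume "r \<in> span {\<lambda>x. fst x ^ a * snd x ^ b |a b. (a, Suc b) \<in> {(a, b). int a \<le> m \<and> int b \<le> n}}"
    "\<And>x. f x = snd x * r x"
  moreover have "(int (Suc b) \<le> n) = (int b \<le> n - 1)" for b by auto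
  ultimately show thesis using that by (auto simp: Q2_poly_def simp del: of_nat_Suc)
qed (use assms in \<open>auto simp: Q2_poly_def\<close>)

lemma Q2_poly_divide_snd_bubble:
  assumes f: "f \<in> Q2_poly m n"
    and z: "\<And>s. 0 < s \<Longrightarrow> s < 1 \<Longrightarrow> f (s, 0) = 0" "\<And>s. 0 < s \<Longrightarrow> s < 1 \<Longrightarrow> f (s, 1) = 0"
  obtains r where "r \<in> Q2_poly m (n - 2)" "\<And>x. f x = snd x * (1 - snd x) * r x"
proof -
  obtain r1 where r1: "r1 \<in> Q2_poly m (n - 1)" "\<And>x. f x = snd x * r1 x"
    using Q2_poly_divide_snd[OF f z(1)] by auto
  have "r1 (s, 1) = 0" if "0 < s" "s < 1" for s using r1(2)[of "(s, 1)"] z(2)[OF that] by simp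
  then obtain r2 where r2: "r2 \<in> Q2_poly m (n - 1 - 1)" "\<And>x. r1 (fst x, 1 - snd x) = snd x * r2 x"
    using Q2_poly_divide_snd[OF Q2_poly_reflect[OF r1(1)]] by auto
  have "f x = snd x * (1 - snd x) * r2 (fst x, 1 - snd x)" for x
    using r1(2)[of x] r2(2)[of "(fst x, 1 - snd x)"] by simp
  then show thesis using that[of "\<lambda>x. r2 (fst x, 1 - snd x)"] Q2_poly_reflect[OF r2(1)] by simp
qed

text \<open>The bubble in the second variable is divided out first. On the open vertical edges it is
  nonzero, so the quotient vanishes there and the swapped version of the same division
  applies.\<close>

lemma Q2_poly_square_bubble:
  assumes f: "f \<in> Q2_poly m n"
    and z: "\<And>s. 0 < s \<Longrightarrow> s < 1 \<Longrightarrow> f (s, 0) = 0" "\<And>s. 0 < s \<Longrightarrow> s < 1 \<Longrightarrow> f (s, 1) = 0"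
      "\<And>t. 0 < t \<Longrightarrow> t < 1 \<Longrightarrow> f (0, t) = 0" "\<And>t. 0 < t \<Longrightarrow> t < 1 \<Longrightarrow> f (1, t) = 0"
  obtains r where "r \<in> Q2_poly (m - 2) (n - 2)"
    "\<And>x. f x = square_bubble x * r x"
proof -
  obtain r1 where r1: "r1 \<in> Q2_poly m (n - 2)" "\<And>x. f x = snd x * (1 - snd x) * r1 x"
    using Q2_poly_divide_snd_bubble[OF f z(1,2)] by auto
  have "r1 (0, t) = 0" "r1 (1, t) = 0" if "0 < t" "t < 1" for t
    using r1(2)[of "(0, t)"] r1(2)[of "(1, t)"] z(3,4)[OF that] that by auto
  then obtain r2 where r2: "r2 \<in> Q2_poly (n - 2) (m - 2)"
    "\<And>x. r1 (snd x, fst x) = snd x * (1 - snd x) * r2 x"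
    using Q2_poly_divide_snd_bubble[OF Q2_poly_swap[OF r1(1)]] by auto
  have "f x = square_bubble x * r2 (snd x, fst x)" for x
    using r1(2)[of x] r2(2)[of "(snd x, fst x)"] by simp
  then show thesis using that[of "\<lambda>x. r2 (snd x, fst x)"] Q2_poly_swap[OF r2(1)] by simp
qed

lemma continuous_on_span:
  fixes f :: "'a::topological_space \<Rightarrow> real"
  assumes "f \<in> span S" "\<And>g. g \<in> S \<Longrightarrow> continuous_on A g"
  shows "continuous_on A f"
  using assms(1)
proof (induction rule: span_induct_alt)
  case (step c g h)
  then show ?case using assms(2)
    by (auto simp: plus_fun_def scaleR_fun_def intro!: continuous_intros)
qed (simp add: zero_fun_def)

lemma continuous_on_P_poly: "f \<in> P_poly n \<Longrightarrow> continuous_on A f"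
  unfolding P_poly_def by (erule continuous_on_span) (auto intro!: continuous_intros)

lemma continuous_on_Q_poly: "f \<in> Q_poly l m n \<Longrightarrow> continuous_on A f"
  unfolding Q_poly_def by (erule continuous_on_span) (auto intro!: continuous_intros)

section \<open>Cyclic coordinates on the pyramid\<close>

declare add_2_eq_Suc' [simp del]

text \<open>Indices are read modulo 4. Triangle \<open>j\<close> is the face where \<open>bar (j + 2)\<close> vanishes; on it
  \<open>bar (j + 1)\<close>, \<open>p $ 3\<close> and \<open>bar (j + 3)\<close> are the barycentric coordinates.\<close>

definition bar :: "nat \<Rightarrow> point \<Rightarrow> real" where
  "bar j p = (if j mod 4 = 0 then 1 - p$3 - p$2 else if j mod 4 = 1 then p$1
     else if j mod 4 = 2 then p$2 else 1 - p$3 - p$1)"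

definition corner :: "nat \<Rightarrow> point" where
  "corner j = (if j mod 4 = 0 then vector [0,0,0] else if j mod 4 = 1 then vector [1,0,0]
     else if j mod 4 = 2 then vector [1,1,0] else vector [0,1,0])"

definition tri :: "nat \<Rightarrow> point \<times> point \<times> point" where
  "tri j = (corner j, corner (j + 1), apex)"

text \<open>Reduces a claim about consecutive cyclic indices to four explicit cases. Everything
  after the elementary facts about \<open>bar\<close> and \<open>corner\<close> can then be stated
  once for a general \<open>j\<close>.\<close>

lemma mod4_cases:
  fixes j :: nat
  obtains "j mod 4 = 0" "(j + 1) mod 4 = 1" "(j + 2) mod 4 = 2" "(j + 3) mod 4 = 3"
  | "j mod 4 = 1" "(j + 1) mod 4 = 2" "(j + 2) mod 4 = 3" "(j + 3) mod 4 = 0"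
  | "j mod 4 = 2" "(j + 1) mod 4 = 3" "(j + 2) mod 4 = 0" "(j + 3) mod 4 = 1"
  | "j mod 4 = 3" "(j + 1) mod 4 = 0" "(j + 2) mod 4 = 1" "(j + 3) mod 4 = 2"
proof -
  have "j mod 4 < 4" by simp
  then consider "j mod 4 = 0" | "j mod 4 = 1" | "j mod 4 = 2" | "j mod 4 = 3" by linarith
  moreover have m: "(j + i) mod 4 = (j mod 4 + i) mod 4" for i by (simp add: mod_add_left_eq)
  ultimately show thesis
  proof cases
    case 1 then show ?thesis by (intro that(1)) (simp_all only: m, simp_all)
  next
    case 2 then show ?thesis by (intro that(2)) (simp_all only: m, simp_all)
  next
    case 3 then show ?thesis by (intro that(3)) (simp_all only: m, simp_all)
  next
    case 4 then show ?thesis by (intro that(4)) (simp_all only: m, simp_all)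
  qed
qed

lemma bar_mod: "i mod 4 = j mod 4 \<Longrightarrow> bar i = bar j"
  by (simp add: bar_def fun_eq_iff)

lemma corner_mod: "i mod 4 = j mod 4 \<Longrightarrow> corner i = corner j"
  by (simp add: corner_def)

text \<open>The planes of opposite triangles cut a horizontal section of the pyramid in parallel
  sides of a square of width \<open>1 - p$3\<close>. This identity is what cancels the denominator
  of \<open>lift\<close> on the faces.\<close>

lemma bar_opposite: "bar (j + 2) p = 1 - p$3 - bar j p"
  by (cases j rule: mod4_cases) (simp_all add: bar_def)

lemma bar_plus_3: "bar (j + 3) p = 1 - p$3 - bar (j + 1) p"
proof -
  have "j + 1 + 2 = j + 3" by simp
  then show ?thesis using bar_opposite[of "j + 1" p] by metis
qed

lemma bar_plus_4: "bar (j + 4) = bar j"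
  by (rule bar_mod) simp

lemma bar_P_poly: "bar j \<in> P_poly 1"
proof -
  have 1: "(\<lambda>p. 1 - p$3 - p$i) \<in> P_poly 1" for i
    by (intro subspace_pointwise(3)[OF subspace_P_poly] P_poly_const P_poly_coord) auto
  have 2: "(\<lambda>p. p$i) \<in> P_poly 1" for i by (rule P_poly_coord) simp
  show ?thesis
    by (cases j rule: mod4_cases) (simp_all add: bar_def[abs_def] 1 2)
qed

lemma pyramid_bar:
  "p \<in> pyramid \<longleftrightarrow>
    0 \<le> p$3 \<and> 0 \<le> bar j p \<and> 0 \<le> bar (j + 1) p \<and> 0 \<le> bar (j + 2) p \<and> 0 \<le> bar (j + 3) p"
  by (cases j rule: mod4_cases) (auto simp: bar_def pyramid_def)

lemma pyramid_bar_nonneg: "p \<in> pyramid \<Longrightarrow> 0 \<le> bar j p"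
  using pyramid_bar[of p j] by simp

lemma pyramid_bar_le: "p \<in> pyramid \<Longrightarrow> bar j p \<le> 1 - p$3"
  using pyramid_bar_nonneg[of p "j + 2"] bar_opposite[of j p] by simp

lemma pyramid_coord: "p \<in> pyramid \<Longrightarrow> 0 \<le> p$3" "p \<in> pyramid \<Longrightarrow> p$3 \<le> 1"
  by (auto simp: pyramid_def)

lemma pyramid_eq_apex: "p \<in> pyramid \<Longrightarrow> p$3 = 1 \<longleftrightarrow> p = apex"
  by (auto simp: pyramid_def apex_def vec_eq_iff forall_3)

lemma apex_in_pyramid: "apex \<in> pyramid"
  by (simp add: pyramid_def apex_def)

definition tri_param :: "nat \<Rightarrow> real \<times> real \<Rightarrow> point" where
  "tri_param j x = corner j + fst x *\<^sub>R (corner (j + 1) - corner j) + snd x *\<^sub>R (apex - corner j)"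

text \<open>The parameters are recovered from the point by the affine functions
  \<open>bar (j + 1)\<close> and \<open>p $ 3\<close>. Hence polynomials in the parameters and
  ambient polynomials on the triangle correspond with the same degree.\<close>

lemma tri_param_coords:
  "tri_param j x $ 3 = snd x" "bar (j + 1) (tri_param j x) = fst x"
  "bar j (tri_param j x) = 1 - snd x"
  by (cases j rule: mod4_cases; simp add: tri_param_def bar_def corner_def apex_def algebra_simps)+

lemma tri_param_bar:
  "bar (j + 2) (tri_param j x) = 0" "bar (j + 3) (tri_param j x) = 1 - fst x - snd x"
  using tri_param_coords[of j x] by (simp_all add: bar_opposite bar_plus_3)

lemma bar_eqI:
  assumes "p$3 = q$3" "bar j p = bar j q" "bar (j + 1) p = bar (j + 1) q"
  shows "p = q"
  using assms by (cases j rule: mod4_cases) (auto simp: bar_def vec_eq_iff forall_3)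

lemma tri_param_P2: "(\<lambda>x. tri_param j x $ i) \<in> P2_poly 1"
proof -
  have "(\<lambda>x. corner j $ i + (corner (j + 1) $ i - corner j $ i) * fst x
    + (apex $ i - corner j $ i) * snd x) \<in> P2_poly 1"
    by (intro subspace_pointwise(2,4)[OF subspace_P2_poly] P2_poly_const P2_poly_coord) auto
  then show ?thesis by (simp add: tri_param_def mult.commute)
qed

definition unit_triangle :: "(real \<times> real) set" where
  "unit_triangle = {(s, t). 0 \<le> s \<and> 0 \<le> t \<and> s + t \<le> 1}"

lemma triangle_set_image: "triangle_set (tri j) = tri_param j ` unit_triangle"
  unfolding tri_def triangle_set.simps convex_hull_3_alt unit_triangle_def tri_param_def
  by (auto simp: image_iff) force+

lemma triangle_set_tri: "triangle_set (tri j) = {p \<in> pyramid. bar (j + 2) p = 0}"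
proof (intro set_eqI iffI)
  fix p assume "p \<in> triangle_set (tri j)"
  then obtain x where x: "p = tri_param j x" "0 \<le> fst x" "0 \<le> snd x" "fst x + snd x \<le> 1"
    by (auto simp: triangle_set_image unit_triangle_def)
  show "p \<in> {p \<in> pyramid. bar (j + 2) p = 0}"
    using x tri_param_coords[of j x] tri_param_bar[of j x] by (simp add: pyramid_bar[of _ j])
next
  fix p assume p: "p \<in> {p \<in> pyramid. bar (j + 2) p = 0}"
  have "p = tri_param j (bar (j + 1) p, p$3)"
    using p tri_param_coords[of j "(bar (j + 1) p, p$3)"] bar_opposite[of j p]
    by (intro bar_eqI[of _ _ j]) auto
  moreover have "(bar (j + 1) p, p$3) \<in> unit_triangle"
    using p pyramid_bar_nonneg[of p "j + 1"] pyramid_bar_le[of p "j + 1"] pyramid_coord[of p]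
    by (auto simp: unit_triangle_def)
  ultimately show "p \<in> triangle_set (tri j)" unfolding triangle_set_image by blast
qed

lemma triangle_set_subset_pyramid: "triangle_set (tri j) \<subseteq> pyramid"
  by (auto simp: triangle_set_tri simp del: triangle_set.simps)

lemma tri_mod: "i mod 4 = j mod 4 \<Longrightarrow> tri i = tri j"
  using corner_mod[of i j] corner_mod[of "i + 1" "j + 1"] mod_add_cong[of i 4 j 1 1]
  by (simp add: tri_def)

text \<open>With \<open>tri j\<close> listed first, the other triangles have offsets 1, 2, 3, which
  is the form in which the traces of \<open>lift j\<close> are known.\<close>

lemma triangles_from: "triangles = {tri j, tri (j + 1), tri (j + 2), tri (j + 3)}"
proof -
  have *: "tri i = tri (i mod 4)" for i by (rule tri_mod) simp
  have "triangles = {tri 0, tri 1, tri 2, tri 3}"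
    by (simp add: triangles_def tri_def corner_def)
  moreover have "{tri j, tri (j + 1), tri (j + 2), tri (j + 3)}
    = {tri (j mod 4), tri ((j + 1) mod 4), tri ((j + 2) mod 4), tri ((j + 3) mod 4)}"
    by (simp only: *[symmetric])
  ultimately show ?thesis
    by (cases j rule: mod4_cases) (simp_all only: insert_commute)
qed

lemma triangles_tri: "s \<in> triangles \<longleftrightarrow> (\<exists>j. s = tri j)"
  using triangles_from by blast

lemma edges_corner: "e \<in> edges \<longleftrightarrow> (\<exists>j. e = (corner j, corner (j + 1)) \<or> e = (corner j, apex))"
proof
  assume "e \<in> edges"
  then have "\<exists>j\<in>{0, 1, 2, 3}. e = (corner j, corner (j + 1)) \<or> e = (corner j, apex)"
    unfolding edges_def corner_def by auto
  then show "\<exists>j. e = (corner j, corner (j + 1)) \<or> e = (corner j, apex)" by blast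
next
  assume "\<exists>j. e = (corner j, corner (j + 1)) \<or> e = (corner j, apex)"
  then obtain j where "e = (corner j, corner (j + 1)) \<or> e = (corner j, apex)" by blast
  then show "e \<in> edges"
    by (cases j rule: mod4_cases) (auto simp: edges_def corner_def)
qed

lemma vertices_corner: "v \<in> vertices \<longleftrightarrow> v = apex \<or> (\<exists>j. v = corner j)"
proof
  assume "v \<in> vertices"
  then have "v = apex \<or> (\<exists>j\<in>{0, 1, 2, 3}. v = corner j)"
    unfolding vertices_def corner_def by auto
  then show "v = apex \<or> (\<exists>j. v = corner j)" by blast
next
  assume "v = apex \<or> (\<exists>j. v = corner j)"
  then consider "v = apex" | j where "v = corner j" by blast
  then show "v \<in> vertices"
  proof cases
    case 2 then show ?thesis by (cases j rule: mod4_cases) (auto simp: vertices_def corner_def)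
  qed (auto simp: vertices_def)
qed

lemma finite_entities: "finite vertices" "finite edges" "finite triangles"
  by (simp_all add: vertices_def edges_def triangles_def)

section \<open>The approximation space in finite coordinates\<close>

text \<open>The function \<open>x^a y^b z^c / (1+z)^(c+d)\<close> of the infinite pyramid, written
  in the finite coordinates.\<close>

definition pyr_monomial :: "nat \<Rightarrow> nat \<Rightarrow> nat \<Rightarrow> nat \<Rightarrow> scalar_field" where
  "pyr_monomial a b c d =
     (\<lambda>p. (p$1 / (1 - p$3)) ^ a * (p$2 / (1 - p$3)) ^ b * p$3 ^ c * (1 - p$3) ^ d)"

text \<open>At the apex the quotients are \<open>x / 0 = 0\<close>; since \<open>d \<ge> 1\<close>, this agrees with the continuous
  extension.\<close>

definition pyr_space :: "nat \<Rightarrow> scalar_field set" where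
  "pyr_space k = span (insert (\<lambda>p. p$3 ^ k)
     {pyr_monomial a b c d | a b c d. a \<le> k \<and> b \<le> k \<and> 1 \<le> d \<and> c + d \<le> k})"

lemma subspace_pyr_space: "subspace (pyr_space k)"
  by (simp add: pyr_space_def)

lemma pyr_monomial_mem:
  "a \<le> k \<Longrightarrow> b \<le> k \<Longrightarrow> 1 \<le> d \<Longrightarrow> c + d \<le> k \<Longrightarrow> pyr_monomial a b c d \<in> pyr_space k"
  unfolding pyr_space_def by (rule span_base) blast

lemma continuous_on_pyr_monomial:
  "continuous_on {p. p$3 < 1} (pyr_monomial a b c d)"
  unfolding pyr_monomial_def by (intro continuous_intros) auto

text \<open>On the pyramid both quotients lie between 0 and 1, also at the apex where they are 0 by
  convention. For \<open>d >= 1\<close> the bound gives continuity at the apex, for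
  \<open>d = 0\<close> it gives boundedness of the gradients.\<close>

lemma pyr_monomial_bound:
  assumes "p \<in> pyramid" shows "\<bar>pyr_monomial a b c d p\<bar> \<le> \<bar>1 - p$3\<bar> ^ d"
proof -
  have x: "\<bar>p$i / (1 - p$3)\<bar> \<le> 1" if "i = 1 \<or> i = 2" for i
  proof (cases "p$3 = 1")
    case False
    with assms have "p$3 < 1" by (auto simp: pyramid_def)
    then show ?thesis using assms that by (auto simp: pyramid_def divide_simps)
  qed simp
  have "\<bar>pyr_monomial a b c d p\<bar>
    = \<bar>p$1 / (1 - p$3)\<bar> ^ a * \<bar>p$2 / (1 - p$3)\<bar> ^ b * \<bar>p$3\<bar> ^ c * \<bar>1 - p$3\<bar> ^ d"
    by (simp only: pyr_monomial_def abs_mult power_abs)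
  also have "\<dots> \<le> 1 * 1 * 1 * \<bar>1 - p$3\<bar> ^ d"
    using x assms pyramid_coord[of p]
    by (intro mult_mono power_le_one) auto
  finally show ?thesis by simp
qed

lemma continuous_on_pyramid_pyr_monomial:
  assumes "1 \<le> d" shows "continuous_on pyramid (pyr_monomial a b c d)"
  unfolding continuous_on_eq_continuous_within
proof
  fix x assume x: "x \<in> pyramid"
  show "continuous (at x within pyramid) (pyr_monomial a b c d)"
  proof (cases "x$3 < 1")
    case True
    have "open {p::point. p$3 < 1}" by (intro open_Collect_less continuous_intros)
    then have "isCont (pyr_monomial a b c d) x"
      using continuous_on_pyr_monomial True by (simp add: continuous_on_eq_continuous_at)
    then show ?thesis by (rule continuous_at_imp_continuous_at_within)
  next
    case False
    with x have 1: "x$3 = 1" by (auto simp: pyramid_def)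
    have lim: "((\<lambda>p. \<bar>1 - p$3\<bar> ^ d) \<longlongrightarrow> \<bar>1 - x$3\<bar> ^ d) (at x within pyramid)"
      by (intro tendsto_intros)
    have "(pyr_monomial a b c d \<longlongrightarrow> 0) (at x within pyramid)"
    proof (rule Lim_null_comparison)
      show "\<forall>\<^sub>F p in at x within pyramid. norm (pyr_monomial a b c d p) \<le> \<bar>1 - p$3\<bar> ^ d"
        using pyr_monomial_bound by (auto simp: eventually_at_filter)
      show "((\<lambda>p. \<bar>1 - p$3\<bar> ^ d) \<longlongrightarrow> 0) (at x within pyramid)"
        using lim by (simp only: 1 zero_power[OF less_le_trans[OF zero_less_one assms]] diff_self abs_zero)
    qed
    moreover have "pyr_monomial a b c d x = 0" using 1 assms by (simp add: pyr_monomial_def)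
    ultimately show ?thesis by (simp add: continuous_within)
  qed
qed

lemma continuous_on_pyr_space:
  assumes "f \<in> pyr_space k" shows "continuous_on pyramid f"
  using assms unfolding pyr_space_def
  by (rule continuous_on_span)
    (auto intro!: continuous_intros continuous_on_pyramid_pyr_monomial)

lemma pyr_space_poly_mem:
  fixes P Q :: "real poly"
  assumes "degree P \<le> k" "degree Q \<le> k" "1 \<le> d" "c + d \<le> k"
  shows "(\<lambda>p. poly P (p$1 / (1 - p$3)) * poly Q (p$2 / (1 - p$3)) * p$3 ^ c * (1 - p$3) ^ d) \<in> pyr_space k"
proof -
  have "(\<lambda>p. \<Sum>i\<le>degree P. \<Sum>j\<le>degree Q. coeff P i * coeff Q j * pyr_monomial i j c d p) \<in> pyr_space k"
    using assms
    by (intro subspace_pointwise_sum subspace_pyr_space subspace_pointwise(4) pyr_monomial_mem) auto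
  moreover have "(\<lambda>p. \<Sum>i\<le>degree P. \<Sum>j\<le>degree Q. coeff P i * coeff Q j * pyr_monomial i j c d p)
    = (\<lambda>p. poly P (p$1 / (1 - p$3)) * poly Q (p$2 / (1 - p$3)) * p$3 ^ c * (1 - p$3) ^ d)"
    unfolding poly_altdef pyr_monomial_def sum_product sum_distrib_right
    by (intro ext sum.cong refl) (simp add: sum_distrib_left mult_ac)
  ultimately show ?thesis by simp
qed

section \<open>Transport from the infinite pyramid\<close>

lemma convex_pyramid: "convex pyramid"
  unfolding convex_def
proof (intro ballI allI impI)
  fix x y :: point and u v :: real
  assume xy: "x \<in> pyramid" "y \<in> pyramid" and uv: "0 \<le> u" "0 \<le> v" "u + v = 1"
  have b: "bar j (u *\<^sub>R x + v *\<^sub>R y) = u * bar j x + v * bar j y" for j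
  proof -
    have "1 = u + v" using uv by simp
    then show ?thesis unfolding bar_def by (auto simp: algebra_simps)
  qed
  show "u *\<^sub>R x + v *\<^sub>R y \<in> pyramid"
    using xy uv by (auto simp: pyramid_bar[of _ 0] b intro!: add_nonneg_nonneg mult_nonneg_nonneg)
qed

text \<open>Makes the limit used by \<open>push\<close> at the apex unique.\<close>

lemma apex_limit_point: "\<not> trivial_limit (at apex within pyramid)"
proof -
  have "apex islimpt pyramid"
  proof (rule connected_imp_perfect)
    show "connected pyramid" by (rule convex_connected[OF convex_pyramid])
    have "0 \<in> pyramid" "0 \<noteq> apex" by (auto simp: pyramid_def apex_def vec_eq_iff intro!: exI[of _ 3])
    then show "pyramid \<noteq> {x}" for x
      using apex_in_pyramid by (metis singletonD)
    show "apex \<in> pyramid" by (rule apex_in_pyramid)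
  qed
  then show ?thesis by (simp add: trivial_limit_within)
qed

lemma phi_inverse:
  assumes "y \<in> pyramid" "y \<noteq> apex"
  shows "inv_into inf_pyramid \<phi> y \<in> inf_pyramid" "\<phi> (inv_into inf_pyramid \<phi> y) = y"
proof -
  have "y$3 < 1" using pyramid_eq_apex[OF assms(1)] assms by (auto simp: pyramid_def)
  then have p: "1 - y$3 > 0" by simp
  let ?x = "vector [y$1 / (1 - y$3), y$2 / (1 - y$3), y$3 / (1 - y$3)] :: point"
  have "?x \<in> inf_pyramid" using assms p by (auto simp: inf_pyramid_def pyramid_def divide_simps)
  moreover have "1 + y$3 / (1 - y$3) = 1 / (1 - y$3)" using p by (simp add: field_simps)
  then have "\<phi> ?x = y" using p by (simp add: \<phi>_def vec_eq_iff forall_3)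
  ultimately have "y \<in> \<phi> ` inf_pyramid" by (metis image_eqI)
  then show "inv_into inf_pyramid \<phi> y \<in> inf_pyramid" "\<phi> (inv_into inf_pyramid \<phi> y) = y"
    by (auto simp: inv_into_into f_inv_into_f)
qed

lemma phi_coords:
  assumes "p \<in> inf_pyramid"
  shows "\<phi> p \<in> pyramid" "\<phi> p \<noteq> apex"
    "\<phi> p $ 1 / (1 - \<phi> p $ 3) = p$1" "\<phi> p $ 2 / (1 - \<phi> p $ 3) = p$2" "1 - \<phi> p $ 3 = 1 / (1 + p$3)"
    "\<phi> p $ 1 = p$1 / (1 + p$3)" "\<phi> p $ 2 = p$2 / (1 + p$3)" "\<phi> p $ 3 = p$3 / (1 + p$3)"
proof -
  have z: "1 + p$3 > 0" using assms by (auto simp: inf_pyramid_def)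
  show coords: "\<phi> p $ 1 = p$1 / (1 + p$3)" "\<phi> p $ 2 = p$2 / (1 + p$3)" "\<phi> p $ 3 = p$3 / (1 + p$3)"
    by (simp_all add: \<phi>_def)
  show inv: "1 - \<phi> p $ 3 = 1 / (1 + p$3)" using z by (simp add: coords field_simps)
  show "\<phi> p $ 1 / (1 - \<phi> p $ 3) = p$1" "\<phi> p $ 2 / (1 - \<phi> p $ 3) = p$2"
    using z by (simp_all add: inv coords(1,2))
  show "\<phi> p \<noteq> apex" using inv z by (auto simp: apex_def)
  show "\<phi> p \<in> pyramid" using z assms unfolding pyramid_def inf_pyramid_def
    by (simp add: inv coords divide_simps)
qed

text \<open>Away from the apex the chosen preimage is mapped back to the point itself, so
  \<open>push\<close> returns \<open>f\<close>; at the apex the limit is \<open>f apex\<close> by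
  continuity.\<close>

lemma push_compose_phi:
  assumes "continuous_on pyramid f"
  shows "push (ext0 inf_pyramid (\<lambda>p. f (\<phi> p))) = ext0 pyramid f"
proof -
  have eq: "ext0 inf_pyramid (\<lambda>p. f (\<phi> p)) (inv_into inf_pyramid \<phi> y) = f y"
    if "y \<in> pyramid" "y \<noteq> apex" for y
    using phi_inverse[OF that] by (simp add: ext0_def)
  have "(f \<longlongrightarrow> f apex) (at apex within pyramid)"
    using assms apex_in_pyramid by (simp add: continuous_on_def)
  then have "((\<lambda>y. ext0 inf_pyramid (\<lambda>p. f (\<phi> p)) (inv_into inf_pyramid \<phi> y)) \<longlongrightarrow> f apex)
      (at apex within pyramid)"
    by (rule Lim_transform_eventually) (auto simp: eventually_at_filter eq)
  then have "Lim (at apex within pyramid)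
      (\<lambda>y. ext0 inf_pyramid (\<lambda>p. f (\<phi> p)) (inv_into inf_pyramid \<phi> y)) = f apex"
    by (rule tendsto_Lim[OF apex_limit_point])
  then show ?thesis
    using eq unfolding push_def by (intro ext) (simp add: ext0_def[of pyramid])
qed

text \<open>A monomial with exponents a, b, c over \<open>(1+z)^k\<close> becomes
  \<open>pyr_monomial a b c (k - c)\<close>. The bound \<open>c <= k - 1\<close> is exactly what
  gives \<open>k - c >= 1\<close>.\<close>

lemma Q_frac_pyr_space:
  assumes "u \<in> Q_poly (int k) (int k) (int k - 1)"
  shows "\<exists>h\<in>pyr_space k. \<forall>p\<in>inf_pyramid. u p / (1 + p$3) ^ k = h (\<phi> p)"
  using assms unfolding Q_poly_def
proof (induction rule: span_induct_alt)
  case base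
  then show ?case using subspace_pointwise(1)[OF subspace_pyr_space[of k]] by (auto intro!: bexI[of _ "\<lambda>x. 0"])
next
  case (step \<alpha> g v)
  then obtain h where h: "h \<in> pyr_space k" "\<forall>p\<in>inf_pyramid. v p / (1 + p$3) ^ k = h (\<phi> p)" by auto
  obtain a b c where g: "g = (\<lambda>p. p$1 ^ a * p$2 ^ b * p$3 ^ c)" "a \<le> k" "b \<le> k" "int c \<le> int k - 1"
    using step by auto
  then have c: "c < k" by simp
  have "(\<lambda>p. \<alpha> * pyr_monomial a b c (k - c) p + h p) \<in> pyr_space k"
    using g c h by (intro subspace_pointwise(2,4)[OF subspace_pyr_space] pyr_monomial_mem) auto
  moreover have "(\<alpha> *\<^sub>R g + v) p / (1 + p$3) ^ k = \<alpha> * pyr_monomial a b c (k - c) (\<phi> p) + h (\<phi> p)"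
    if p: "p \<in> inf_pyramid" for p
  proof -
    have z: "1 + p$3 > 0" using p by (auto simp: inf_pyramid_def)
    have "(1 + p$3) ^ k = (1 + p$3) ^ c * (1 + p$3) ^ (k - c)"
      using c by (simp flip: power_add)
    then have "pyr_monomial a b c (k - c) (\<phi> p) = g p / (1 + p$3) ^ k"
      unfolding pyr_monomial_def g(1) phi_coords(3,4)[OF p]
      unfolding phi_coords(5)[OF p] unfolding phi_coords(8)[OF p]
      using z by (simp add: power_divide)
    then show ?thesis using h p by (simp add: scaleR_fun_def add_divide_distrib)
  qed
  ultimately show ?case
    by (intro bexI[of _ "\<lambda>p. \<alpha> * pyr_monomial a b c (k - c) p + h p"] ballI)
qed

text \<open>When \<open>c + d < k\<close>, the fraction is expanded by \<open>(1+z)^(k-c-d)\<close>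
  to reach the denominator \<open>(1+z)^k\<close>. The resulting degree in z is at most
  \<open>k - d\<close>, hence at most \<open>k - 1\<close>.\<close>

lemma pyr_space_Q_frac:
  assumes "f \<in> pyr_space k"
  shows "\<exists>u\<in>Q_poly (int k) (int k) (int k - 1). \<exists>\<alpha>. \<forall>p\<in>inf_pyramid.
    f (\<phi> p) = u p / (1 + p$3) ^ k + \<alpha> * (p$3 ^ k / (1 + p$3) ^ k)"
  using assms unfolding pyr_space_def
proof (induction rule: span_induct_alt)
  case base
  then show ?case using subspace_pointwise(1)[OF subspace_Q_poly[of "int k" "int k" "int k - 1"]]
    by (auto intro!: bexI[of _ "\<lambda>x. 0"] exI[of _ 0])
next
  case (step \<beta> g v)
  then obtain u \<alpha> where u: "u \<in> Q_poly (int k) (int k) (int k - 1)"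
    "\<forall>p\<in>inf_pyramid. v (\<phi> p) = u p / (1 + p$3) ^ k + \<alpha> * (p$3 ^ k / (1 + p$3) ^ k)" by auto
  from step(1) consider "g = (\<lambda>p. p$3 ^ k)"
    | a b c d where "g = pyr_monomial a b c d" "a \<le> k" "b \<le> k" "1 \<le> d" "c + d \<le> k" by auto
  then show ?case
  proof cases
    case 1
    have "(\<beta> *\<^sub>R g + v) (\<phi> p) = u p / (1 + p$3) ^ k + (\<alpha> + \<beta>) * (p$3 ^ k / (1 + p$3) ^ k)"
      if p: "p \<in> inf_pyramid" for p
      using u p phi_coords(8)[OF p] by (simp add: 1 scaleR_fun_def power_divide algebra_simps add_divide_distrib)
    then show ?thesis using u(1) by blast
  next
    case 2
    define w where "w = (\<lambda>p::point. \<Sum>i\<le>k - c - d. of_nat ((k - c - d) choose i) * (p$1 ^ a * p$2 ^ b * p$3 ^ (c + i)))"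
    have "w \<in> Q_poly (int k) (int k) (int k - 1)"
      unfolding w_def using 2
      by (intro subspace_pointwise_sum subspace_Q_poly subspace_pointwise(4) Q_poly_monomial) auto
    then have "(\<lambda>p. \<beta> * w p + u p) \<in> Q_poly (int k) (int k) (int k - 1)"
      using u by (intro subspace_pointwise(2,4)[OF subspace_Q_poly])
    moreover have "(\<beta> *\<^sub>R g + v) (\<phi> p) = (\<beta> * w p + u p) / (1 + p$3) ^ k + \<alpha> * (p$3 ^ k / (1 + p$3) ^ k)"
      if p: "p \<in> inf_pyramid" for p
    proof -
      have z: "1 + p$3 > 0" using p by (auto simp: inf_pyramid_def)
      have "(1 + p$3) ^ (k - c - d) = (\<Sum>i\<le>k - c - d. of_nat ((k - c - d) choose i) * p$3 ^ i)"
        using binomial_ring[of "p$3" 1 "k - c - d"] by (simp add: add.commute)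
      then have w: "w p = p$1 ^ a * p$2 ^ b * p$3 ^ c * (1 + p$3) ^ (k - c - d)"
        by (simp add: w_def sum_distrib_left power_add mult_ac)
      have "(1 + p$3) ^ k = (1 + p$3) ^ c * (1 + p$3) ^ d * (1 + p$3) ^ (k - c - d)"
        using 2 by (simp flip: power_add)
      then have "g (\<phi> p) = w p / (1 + p$3) ^ k"
        unfolding pyr_monomial_def 2(1) phi_coords(3,4)[OF p]
      unfolding phi_coords(5)[OF p] unfolding phi_coords(8)[OF p] w
        using z by (simp add: power_divide)
      then show ?thesis using u p by (simp add: scaleR_fun_def add_divide_distrib)
    qed
    ultimately show ?thesis
      by (intro bexI[of _ "\<lambda>p. \<beta> * w p + u p"] exI[of _ \<alpha>] ballI)
  qed
qed

lemma U_bar_inf_eq: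
  "U_bar_inf k = (\<lambda>f. ext0 inf_pyramid (\<lambda>p. f (\<phi> p))) ` pyr_space k"
proof (intro set_eqI iffI)
  fix u assume "u \<in> U_bar_inf k"
  then obtain v \<alpha> where v: "v \<in> Q_poly (int k) (int k) (int k - 1)"
    "u = ext0 inf_pyramid (\<lambda>p. v p / (1 + p$3) ^ k)
      + \<alpha> *\<^sub>R ext0 inf_pyramid (\<lambda>p. p$3 ^ k / (1 + p$3) ^ k)"
    by (auto simp: U_bar_inf_def Q_frac_def span_singleton)
  from Q_frac_pyr_space[OF v(1)] obtain h where
    h: "h \<in> pyr_space k" "\<forall>p\<in>inf_pyramid. v p / (1 + p$3) ^ k = h (\<phi> p)" by blast
  have "(\<lambda>p. p$3 ^ k) \<in> pyr_space k" unfolding pyr_space_def by (rule span_base) simp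
  then have "(\<lambda>p. h p + \<alpha> * p$3 ^ k) \<in> pyr_space k"
    using h by (intro subspace_pointwise(2,4)[OF subspace_pyr_space])
  moreover have "u = ext0 inf_pyramid (\<lambda>p. h (\<phi> p) + \<alpha> * \<phi> p $ 3 ^ k)"
    using h v by (auto simp: ext0_def fun_eq_iff scaleR_fun_def phi_coords(8) power_divide)
  ultimately show "u \<in> (\<lambda>f. ext0 inf_pyramid (\<lambda>p. f (\<phi> p))) ` pyr_space k"
    by (intro rev_image_eqI)
next
  fix u assume "u \<in> (\<lambda>f. ext0 inf_pyramid (\<lambda>p. f (\<phi> p))) ` pyr_space k"
  then obtain f where f: "f \<in> pyr_space k" "u = ext0 inf_pyramid (\<lambda>p. f (\<phi> p))" by blast
  from pyr_space_Q_frac[OF f(1)] obtain v \<alpha> where v: "v \<in> Q_poly (int k) (int k) (int k - 1)"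
    "\<forall>p\<in>inf_pyramid. f (\<phi> p) = v p / (1 + p$3) ^ k + \<alpha> * (p$3 ^ k / (1 + p$3) ^ k)" by blast
  then have "u = ext0 inf_pyramid (\<lambda>p. v p / (1 + p$3) ^ k)
      + \<alpha> *\<^sub>R ext0 inf_pyramid (\<lambda>p. p$3 ^ k / (1 + p$3) ^ k)"
    using f by (auto simp: ext0_def fun_eq_iff scaleR_fun_def)
  then show "u \<in> U_bar_inf k"
    using v(1) unfolding U_bar_inf_def Q_frac_def span_singleton by blast
qed

text \<open>The monomial \<open>w^a z^b\<close> over \<open>(1+z)^k\<close> becomes a product of
  finite coordinates with \<open>(1-zeta)^(k-a-b)\<close>: here \<open>1 - zeta\<close> is the
  homogenizing variable, and the total degree is k.\<close>

lemma P2_poly_homogenize: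
  assumes "u \<in> P2_poly (int k)"
  shows "\<exists>G\<in>P_poly (int k). \<forall>p\<in>inf_pyramid. u (p$i, p$3) / (1 + p$3) ^ k = G (\<phi> p)"
  using assms unfolding P2_poly_span
proof (induction rule: span_induct_alt)
  case base
  then show ?case using subspace_pointwise(1)[OF subspace_P_poly[of "int k"]] by (auto intro!: bexI[of _ "\<lambda>x. 0"])
next
  case (step \<alpha> g v)
  then obtain h where h: "h \<in> P_poly (int k)" "\<forall>p\<in>inf_pyramid. v (p$i, p$3) / (1 + p$3) ^ k = h (\<phi> p)" by auto
  obtain a b where g: "g = (\<lambda>x. fst x ^ a * snd x ^ b)" "a + b \<le> k"
    using step by auto
  have aff: "(\<lambda>p. 1 - p$3) \<in> P_poly 1"
    by (intro subspace_pointwise(3)[OF subspace_P_poly] P_poly_const P_poly_coord) auto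
  have "(\<lambda>p. p$i ^ a * p$3 ^ b * (1 - p$3) ^ (k - a - b)) \<in> P_poly (int a + int b + int (k - a - b))"
    by (intro P_poly_mult P_poly_power P_poly_coord aff) auto
  then have "(\<lambda>p. p$i ^ a * p$3 ^ b * (1 - p$3) ^ (k - a - b)) \<in> P_poly (int k)" using g by simp
  then have "(\<lambda>p. \<alpha> * (p$i ^ a * p$3 ^ b * (1 - p$3) ^ (k - a - b)) + h p) \<in> P_poly (int k)"
    using h by (intro subspace_pointwise(2,4)[OF subspace_P_poly])
  moreover have "(\<alpha> *\<^sub>R g + v) (p$i, p$3) / (1 + p$3) ^ k
      = \<alpha> * (\<phi> p $ i ^ a * \<phi> p $ 3 ^ b * (1 - \<phi> p $ 3) ^ (k - a - b)) + h (\<phi> p)"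
    if p: "p \<in> inf_pyramid" for p
  proof -
    have z: "1 + p$3 > 0" using p by (auto simp: inf_pyramid_def)
    have i: "\<phi> p $ i = p$i / (1 + p$3)" using exhaust_3[of i] phi_coords(6-8)[OF p] by auto
    have "(1 + p$3) ^ k = (1 + p$3) ^ a * (1 + p$3) ^ b * (1 + p$3) ^ (k - a - b)"
      using g by (simp flip: power_add)
    then have "\<phi> p $ i ^ a * \<phi> p $ 3 ^ b * (1 - \<phi> p $ 3) ^ (k - a - b) = g (p$i, p$3) / (1 + p$3) ^ k"
      unfolding g(1) i phi_coords(5)[OF p] unfolding phi_coords(8)[OF p] using z by (simp add: power_divide)
    then show ?thesis using h p by (simp add: scaleR_fun_def add_divide_distrib)
  qed
  ultimately show ?case by (intro bexI) auto
qed

text \<open>The affine functions \<open>v1\<close>, \<open>v2\<close> describe a vertical face in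
  terms of its free coordinate \<open>y\<close> and the height. Missing degrees are made up by
  powers of \<open>1 + z\<close>.\<close>

lemma P_poly_dehomogenize:
  assumes "G \<in> P_poly (int k)" "v1 \<in> P2_poly 1" "v2 \<in> P2_poly 1"
  shows "\<exists>u\<in>P2_poly (int k). \<forall>p\<in>inf_pyramid. \<forall>y.
    p$1 = v1 (y, p$3) \<longrightarrow> p$2 = v2 (y, p$3) \<longrightarrow> G (\<phi> p) = u (y, p$3) / (1 + p$3) ^ k"
  using assms(1) unfolding P_poly_def
proof (induction rule: span_induct_alt)
  case base
  then show ?case using subspace_pointwise(1)[OF subspace_P2_poly[of "int k"]] by (auto intro!: bexI[of _ "\<lambda>x. 0"])
next
  case (step \<alpha> g v)
  then obtain u where u: "u \<in> P2_poly (int k)" "\<forall>p\<in>inf_pyramid. \<forall>y.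
    p$1 = v1 (y, p$3) \<longrightarrow> p$2 = v2 (y, p$3) \<longrightarrow> v (\<phi> p) = u (y, p$3) / (1 + p$3) ^ k" by auto
  obtain a b c where g: "g = (\<lambda>p. p$1 ^ a * p$2 ^ b * p$3 ^ c)" "a + b + c \<le> k"
    using step by auto
  define w where "w = (\<lambda>x. v1 x ^ a * v2 x ^ b * snd x ^ c * (1 + snd x) ^ (k - a - b - c))"
  have aff: "(\<lambda>x. 1 + snd x) \<in> P2_poly 1"
    by (intro subspace_pointwise(2)[OF subspace_P2_poly] P2_poly_const P2_poly_coord) auto
  have "w \<in> P2_poly (int a + int b + int c + int (k - a - b - c))"
    unfolding w_def by (intro P2_poly_mult P2_poly_power P2_poly_coord aff assms) auto
  then have "w \<in> P2_poly (int k)" using g by simp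
  then have "(\<lambda>x. \<alpha> * w x + u x) \<in> P2_poly (int k)"
    using u by (intro subspace_pointwise(2,4)[OF subspace_P2_poly])
  moreover have "(\<alpha> *\<^sub>R g + v) (\<phi> p) = (\<alpha> * w (y, p$3) + u (y, p$3)) / (1 + p$3) ^ k"
    if p: "p \<in> inf_pyramid" "p$1 = v1 (y, p$3)" "p$2 = v2 (y, p$3)" for p y
  proof -
    have z: "1 + p$3 > 0" using p by (auto simp: inf_pyramid_def)
    have "(1 + p$3) ^ k = (1 + p$3) ^ a * (1 + p$3) ^ b * (1 + p$3) ^ c * (1 + p$3) ^ (k - a - b - c)"
      using g by (simp flip: power_add)
    then have "g (\<phi> p) = w (y, p$3) / (1 + p$3) ^ k"
      unfolding g(1) w_def phi_coords(6-8)[OF p(1)] using z p by (simp add: power_divide)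
    then show ?thesis using u p by (simp add: scaleR_fun_def add_divide_distrib)
  qed
  ultimately show ?case by (intro bexI) auto
qed

text \<open>The image of a vertical face misses the apex. The value there is reached by continuity
  along the edge from \<open>corner j\<close> to the apex.\<close>

lemma triangle_apex_extend:
  assumes f: "continuous_on pyramid f" and G: "continuous_on UNIV G"
    and eq: "\<And>x. x \<in> triangle_set (tri j) \<Longrightarrow> x \<noteq> apex \<Longrightarrow> f x = (G x :: real)"
    and x: "x \<in> triangle_set (tri j)"
  shows "f x = G x"
proof (cases "x = apex")
  case True
  let ?\<gamma> = "\<lambda>t. tri_param j (0, t)"
  have \<gamma>: "?\<gamma> t \<in> triangle_set (tri j)" if "t \<in> {0..1}" for t
    unfolding triangle_set_image using that by (intro imageI) (simp add: unit_triangle_def)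
  have \<gamma>c: "continuous_on {0..1} ?\<gamma>" unfolding tri_param_def by (intro continuous_intros)
  have cf: "continuous_on (?\<gamma> ` {0..1}) f"
    using \<gamma> triangle_set_subset_pyramid by (intro continuous_on_subset[OF f]) blast
  have "continuous_on {0..1} (\<lambda>t. f (?\<gamma> t))" by (rule continuous_on_compose2[OF cf \<gamma>c]) simp
  moreover have "continuous_on {0..1} (\<lambda>t. G (?\<gamma> t))" by (rule continuous_on_compose2[OF G \<gamma>c]) simp
  ultimately have "continuous_on {0..1} (\<lambda>t. f (?\<gamma> t) - G (?\<gamma> t))" by (rule continuous_on_diff)
  then have cont: "continuous_on (closure {0..<1}) (\<lambda>t. f (?\<gamma> t) - G (?\<gamma> t))" by simp
  have "f (?\<gamma> 1) - G (?\<gamma> 1) = 0"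
  proof (rule continuous_constant_on_closure[OF cont])
    fix t :: real assume t: "t \<in> {0..<1}"
    have "?\<gamma> t \<noteq> apex" using tri_param_coords(1)[of j "(0, t)"] t by (auto simp: apex_def)
    then show "f (?\<gamma> t) - G (?\<gamma> t) = 0" using eq[OF \<gamma>[of t]] t by simp
  qed simp_all
  moreover have "?\<gamma> 1 = apex" by (simp add: tri_param_def)
  ultimately show ?thesis using True by simp
qed (use eq x in auto)

text \<open>Homogenizing shows that the fractions allowed on a vertical face are exactly the
  polynomials of total degree at most k on the corresponding triangle; the apex is added by
  continuity.\<close>

lemma face_condition:
  assumes f: "f \<in> pyr_space k"
    and ii: "(i = 1 \<and> i' = 2) \<or> (i = 2 \<and> i' = 1)"
    and j: "triangle_set (tri j) = {x \<in> pyramid. x$i = c * (1 - x$3)}"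
  shows "(\<exists>g\<in>P2_frac k (int k). \<forall>p\<in>inf_pyramid. p$i = c \<longrightarrow>
      ext0 inf_pyramid (\<lambda>p. f (\<phi> p)) p = g (p$i', p$3)) \<longleftrightarrow>
    (\<exists>G\<in>P_poly (int k). \<forall>x\<in>triangle_set (tri j). f x = G x)" (is "?L \<longleftrightarrow> ?R")
proof
  assume ?L
  then obtain u where u: "u \<in> P2_poly (int k)"
    "\<And>p. p \<in> inf_pyramid \<Longrightarrow> p$i = c \<Longrightarrow> f (\<phi> p) = u (p$i', p$3) / (1 + p$3) ^ k"
    by (auto simp: P2_frac_def ext0_def)
  obtain G where G: "G \<in> P_poly (int k)"
    "\<And>p. p \<in> inf_pyramid \<Longrightarrow> u (p$i', p$3) / (1 + p$3) ^ k = G (\<phi> p)"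
    using P2_poly_homogenize[OF u(1), of i'] by blast
  have "f x = G x" if x: "x \<in> triangle_set (tri j)" "x \<noteq> apex" for x
  proof -
    have xp: "x \<in> pyramid" "x$i = c * (1 - x$3)" using x j by auto
    define p where "p = inv_into inf_pyramid \<phi> x"
    have p: "p \<in> inf_pyramid" "\<phi> p = x" using phi_inverse[OF xp(1) x(2)] by (auto simp: p_def)
    have "1 - x$3 \<noteq> 0" using pyramid_eq_apex[OF xp(1)] x by auto
    then have "p$i = c" using phi_coords(3,4)[OF p(1)] xp ii p by auto
    then show ?thesis using u(2)[OF p(1)] G(2)[OF p(1)] p by simp
  qed
  then have "f x = G x" if "x \<in> triangle_set (tri j)" for x
    using triangle_apex_extend[OF continuous_on_pyr_space[OF f] continuous_on_P_poly[OF G(1)]] that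
    by blast
  then show ?R using G(1) by blast
next
  assume ?R
  then obtain G where G: "G \<in> P_poly (int k)" "\<And>x. x \<in> triangle_set (tri j) \<Longrightarrow> f x = G x" by blast
  \<comment> \<open>On the face one horizontal coordinate is the constant \<open>c\<close>, the
    other is the free coordinate itself.\<close>
  obtain v1 v2 where v: "v1 \<in> P2_poly 1" "v2 \<in> P2_poly 1"
    "\<And>p. p$i = c \<Longrightarrow> p$1 = v1 (p$i', p$3) \<and> p$2 = v2 (p$i', p$3)"
  proof (cases "i = 1")
    case True
    then show ?thesis using ii by (intro that[of "\<lambda>x. c" fst] P2_poly_const P2_poly_coord) auto
  next
    case False
    then show ?thesis using ii by (intro that[of fst "\<lambda>x. c"] P2_poly_const P2_poly_coord) auto
  qed
  obtain u where u: "u \<in> P2_poly (int k)" "\<And>p y. p \<in> inf_pyramid \<Longrightarrow>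
    p$1 = v1 (y, p$3) \<Longrightarrow> p$2 = v2 (y, p$3) \<Longrightarrow> G (\<phi> p) = u (y, p$3) / (1 + p$3) ^ k"
    using P_poly_dehomogenize[OF G(1) v(1,2)] by blast
  have "ext0 inf_pyramid (\<lambda>p. f (\<phi> p)) p = u (p$i', p$3) / (1 + p$3) ^ k"
    if p: "p \<in> inf_pyramid" "p$i = c" for p
  proof -
    have "\<phi> p $ i = c * (1 - \<phi> p $ 3)"
      using phi_coords(5-7)[OF p(1)] ii p by auto
    then have "\<phi> p \<in> triangle_set (tri j)" using j phi_coords(1)[OF p(1)] by simp
    then show ?thesis using G(2) u(2)[OF p(1), of "p$i'"] v(3)[OF p(2)] p by (simp add: ext0_def)
  qed
  then show ?L using u(1)
    by (intro bexI[of _ "\<lambda>(w, z). u (w, z) / (1 + z) ^ k"]) (auto simp: P2_frac_def)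
qed

definition on_triangles :: "nat \<Rightarrow> scalar_field \<Rightarrow> bool" where
  "on_triangles k f \<longleftrightarrow> (\<forall>s\<in>triangles. \<exists>G\<in>P_poly (int k). \<forall>x\<in>triangle_set s. f x = G x)"

lemma U_inf_iff:
  assumes f: "f \<in> pyr_space k"
  shows "ext0 inf_pyramid (\<lambda>p. f (\<phi> p)) \<in> U_inf k \<longleftrightarrow> on_triangles k f"
proof -
  have T: "triangle_set (tri 0) = {x \<in> pyramid. x$2 = 0 * (1 - x$3)}"
    "triangle_set (tri 1) = {x \<in> pyramid. x$1 = 1 * (1 - x$3)}"
    "triangle_set (tri 2) = {x \<in> pyramid. x$2 = 1 * (1 - x$3)}"
    "triangle_set (tri 3) = {x \<in> pyramid. x$1 = 0 * (1 - x$3)}"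
    unfolding triangle_set_tri by (auto simp: bar_def)
  have tr: "triangles = {tri 0, tri 1, tri 2, tri 3}" using triangles_from[of 0] by simp
  have "ext0 inf_pyramid (\<lambda>p. f (\<phi> p)) \<in> U_bar_inf k" unfolding U_bar_inf_eq using f by blast
  then show ?thesis
    unfolding U_inf_def on_triangles_def tr
    using face_condition[OF f _ T(1), of 1] face_condition[OF f _ T(2), of 2]
      face_condition[OF f _ T(3), of 1] face_condition[OF f _ T(4), of 2]
    by simp blast
qed

text \<open>Combines the transport of the functions with that of the face conditions. After this
  description neither the infinite pyramid nor the map occurs again.\<close>

lemma U_space_eq:
  "U_space k = {ext0 pyramid f | f. f \<in> pyr_space k \<and> on_triangles k f}"
proof -
  have "U_inf k = {ext0 inf_pyramid (\<lambda>p. f (\<phi> p)) | f. f \<in> pyr_space k \<and> on_triangles k f}"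
  proof (intro set_eqI iffI)
    fix u assume u: "u \<in> U_inf k"
    then have "u \<in> U_bar_inf k" by (simp add: U_inf_def)
    then obtain f where "f \<in> pyr_space k" "u = ext0 inf_pyramid (\<lambda>p. f (\<phi> p))"
      unfolding U_bar_inf_eq by blast
    then show "u \<in> {ext0 inf_pyramid (\<lambda>p. f (\<phi> p)) | f. f \<in> pyr_space k \<and> on_triangles k f}"
      using u U_inf_iff by blast
  qed (use U_inf_iff in blast)
  then show ?thesis
    unfolding U_space_def
    by (auto simp: push_compose_phi continuous_on_pyr_space intro!: rev_image_eqI) 
qed

lemma U_spaceE:
  assumes "p \<in> U_space k"
  obtains f where "f \<in> pyr_space k" "on_triangles k f" "p = ext0 pyramid f"
  using assms unfolding U_space_eq by blast

lemma U_spaceI: "f \<in> pyr_space k \<Longrightarrow> on_triangles k f \<Longrightarrow> ext0 pyramid f \<in> U_space k"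
  unfolding U_space_eq by blast

lemma subspace_U_space: "subspace (U_space k)"
proof -
  have "on_triangles k 0"
    using subspace_pointwise(1)[OF subspace_P_poly[of "int k"]] by (auto simp: on_triangles_def)
  moreover have "on_triangles k (f + g)" if fg: "on_triangles k f" "on_triangles k g" for f g
    unfolding on_triangles_def
  proof
    fix s assume s: "s \<in> triangles"
    obtain F G where "F \<in> P_poly (int k)" "\<forall>x\<in>triangle_set s. f x = F x"
      "G \<in> P_poly (int k)" "\<forall>x\<in>triangle_set s. g x = G x"
      using fg s unfolding on_triangles_def by blast
    then show "\<exists>G\<in>P_poly (int k). \<forall>x\<in>triangle_set s. (f + g) x = G x"
      by (intro bexI[of _ "F + G"]) (auto intro: subspace_add[OF subspace_P_poly])
  qed
  moreover have "on_triangles k (c *\<^sub>R f)" if f: "on_triangles k f" for c f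
    unfolding on_triangles_def
  proof
    fix s assume s: "s \<in> triangles"
    obtain F where "F \<in> P_poly (int k)" "\<forall>x\<in>triangle_set s. f x = F x"
      using f s unfolding on_triangles_def by blast
    then show "\<exists>G\<in>P_poly (int k). \<forall>x\<in>triangle_set s. (c *\<^sub>R f) x = G x"
      by (intro bexI[of _ "c *\<^sub>R F"]) (auto simp: scaleR_fun_def[of c] intro: subspace_pointwise(4)[OF subspace_P_poly])
  qed
  ultimately have "subspace {f \<in> pyr_space k. on_triangles k f}"
    using subspace_pyr_space[of k] by (auto simp: subspace_def)
  moreover have "linear (ext0 pyramid)"
    by (intro linearI) (auto simp: ext0_def fun_eq_iff scaleR_fun_def)
  ultimately have "subspace (ext0 pyramid ` {f \<in> pyr_space k. on_triangles k f})"
    by (rule linear_subspace_image[rotated])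
  moreover have "ext0 pyramid ` {f \<in> pyr_space k. on_triangles k f} = U_space k"
    unfolding U_space_eq by blast
  ultimately show ?thesis by simp
qed

lemma continuous_on_U_space:
  assumes "p \<in> U_space k" shows "continuous_on pyramid p"
  using assms
proof (rule U_spaceE)
  fix f assume "f \<in> pyr_space k" "p = ext0 pyramid f"
  then show ?thesis using continuous_on_pyr_space[of f k]
    by (simp add: ext0_def cong: continuous_on_cong_simp)
qed

lemma U_space_triangle:
  assumes "p \<in> U_space k"
  obtains G where "G \<in> P_poly (int k)" "\<And>x. x \<in> triangle_set (tri j) \<Longrightarrow> p x = G x"
  using assms
proof (rule U_spaceE)
  fix f assume f: "f \<in> pyr_space k" "on_triangles k f" "p = ext0 pyramid f"
  have "tri j \<in> triangles" using triangles_tri by blast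
  then obtain G where "G \<in> P_poly (int k)" "\<forall>x\<in>triangle_set (tri j). f x = G x"
    using f unfolding on_triangles_def by blast
  then show thesis using f triangle_set_subset_pyramid[of j] by (intro that[of G]) (auto simp: ext0_def)
qed

text \<open>At height 0 every denominator equals 1, so a generator restricts to a monomial in the
  horizontal coordinates or to 0. The apex function has zero trace because
  \<open>k >= 1\<close>.\<close>

lemma U_space_base:
  assumes "p \<in> U_space k" "k \<ge> 1"
  obtains G where "G \<in> Q2_poly (int k) (int k)" "\<And>x. x \<in> base \<Longrightarrow> p x = G (x$1, x$2)"
  using assms(1)
proof (rule U_spaceE)
  fix f assume f: "f \<in> pyr_space k" "p = ext0 pyramid f"
  have "\<exists>G\<in>Q2_poly (int k) (int k). \<forall>x. x$3 = 0 \<longrightarrow> f x = G (x$1, x$2)"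
    using f(1) unfolding pyr_space_def
  proof (induction rule: span_induct_alt)
    case base
    then show ?case using subspace_pointwise(1)[OF subspace_Q2_poly[of "int k" "int k"]]
      by (auto intro!: bexI[of _ "\<lambda>x. 0"])
  next
    case (step \<alpha> g h)
    then obtain G where G: "G \<in> Q2_poly (int k) (int k)" "\<forall>x. x$3 = 0 \<longrightarrow> h x = G (x$1, x$2)" by blast
    have "\<exists>H\<in>Q2_poly (int k) (int k). \<forall>x. x$3 = 0 \<longrightarrow> g x = H (x$1, x$2)"
    proof -
      from step(1) consider "g = (\<lambda>p. p$3 ^ k)"
        | a b c d where "g = pyr_monomial a b c d" "a \<le> k" "b \<le> k" by auto
      then show ?thesis
      proof cases
        case 1
        then show ?thesis using \<open>k \<ge> 1\<close> subspace_pointwise(1)[OF subspace_Q2_poly[of "int k" "int k"]]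
          by (intro bexI[of _ "\<lambda>x. 0"]) (auto simp: zero_power)
      next
        case 2
        have "(\<lambda>x. 0 ^ c * (fst x ^ a * snd x ^ b)) \<in> Q2_poly (int k) (int k)"
          using 2 by (intro subspace_pointwise(4)[OF subspace_Q2_poly] Q2_poly_monomial) auto
        then show ?thesis using 2
          by (intro bexI[of _ "\<lambda>x. 0 ^ c * (fst x ^ a * snd x ^ b)"]) (auto simp: pyr_monomial_def)
      qed
    qed
    then obtain H where H: "H \<in> Q2_poly (int k) (int k)" "\<forall>x. x$3 = 0 \<longrightarrow> g x = H (x$1, x$2)" by blast
    have "(\<lambda>x. \<alpha> * H x + G x) \<in> Q2_poly (int k) (int k)"
      using G H by (intro subspace_pointwise(2,4)[OF subspace_Q2_poly])
    then show ?case using G H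
      by (intro bexI[of _ "\<lambda>x. \<alpha> * H x + G x"]) (auto simp: scaleR_fun_def)
  qed
  then show thesis using f that by (auto simp: base_def ext0_def)
qed

section \<open>Explicit members of the space\<close>

text \<open>With \<open>r = 1\<close> this is the rational nodal function of
  \<open>corner j\<close>: the numerator vanishes on the two triangles away from that corner. The
  factor \<open>r\<close> shapes the traces on the two triangles that meet there.\<close>

definition lift :: "nat \<Rightarrow> (real \<times> real \<Rightarrow> real) \<Rightarrow> scalar_field" where
  "lift j r = (\<lambda>p. bar j p * bar (j + 3) p / (1 - p$3) * r (bar (j + 1) p, p$3))"

text \<open>Each \<open>bar\<close> is \<open>1 - p$3\<close> times one of x, y, 1 - x, 1 - y in the
  quotients x, y. Two factors, one division and the power \<open>a\<close> leave
  \<open>(1 - p$3) ^ (a + 1)\<close>, so the admissibility condition reads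
  \<open>c + (a + 1) <= k\<close>.\<close>

lemma lift_monomial_pyr_space:
  assumes "a + c < k"
  shows "lift j (\<lambda>x. fst x ^ a * snd x ^ c) \<in> pyr_space k"
proof -
  let ?X = "[:0, 1:] :: real poly" and ?Y = "[:1, -1:] :: real poly"
  have deg: "degree (P * Q ^ a) \<le> k" "degree P \<le> k"
    if "degree P \<le> 1" "degree Q \<le> 1" for P Q :: "real poly"
  proof -
    have "degree (P * Q ^ a) \<le> degree P + degree Q * a"
      using degree_mult_le[of P "Q ^ a"] degree_power_le[of Q a] by linarith
    also have "\<dots> \<le> 1 + 1 * a" using that by (intro add_mono mult_mono) auto
    finally show "degree (P * Q ^ a) \<le> k" "degree P \<le> k" using assms that by auto
  qed
  \<comment> \<open>A common argument for the four positions of \<open>j\<close>: \<open>bj\<close>,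
    \<open>bj1\<close>, \<open>bj3\<close> express the three functions \<open>bar\<close> through
    the horizontal coordinates and \<open>e = 1 - p$3\<close>.\<close>
  have *: "lift j (\<lambda>x. fst x ^ a * snd x ^ c) \<in> pyr_space k"
    if "degree P \<le> k" "degree Q \<le> k" and
      eq: "\<And>e x y. e \<noteq> 0 \<Longrightarrow> bj (x * e) (y * e) e * bj3 (x * e) (y * e) e / e * (bj1 (x * e) (y * e) e) ^ a
        = poly P x * poly Q y * e ^ (a + 1)" and
      b: "\<And>p. bar j p = bj (p$1) (p$2) (1 - p$3)" "\<And>p. bar (j + 3) p = bj3 (p$1) (p$2) (1 - p$3)"
        "\<And>p. bar (j + 1) p = bj1 (p$1) (p$2) (1 - p$3)"
    for P Q bj bj1 bj3
  proof -
    \<comment> \<open>At \<open>p$3 = 1\<close> both sides are 0: the left by division by zero, the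
      right because its last exponent is positive.\<close>
    have "lift j (\<lambda>x. fst x ^ a * snd x ^ c) p
      = poly P (p$1 / (1 - p$3)) * poly Q (p$2 / (1 - p$3)) * p$3 ^ c * (1 - p$3) ^ (a + 1)" for p
    proof (cases "p$3 = 1")
      case False
      then show ?thesis
        using arg_cong[OF eq[of "1 - p$3" "p$1 / (1 - p$3)" "p$2 / (1 - p$3)"], of "\<lambda>t. t * p$3 ^ c"]
        by (simp add: lift_def b b(3)[simplified] mult_ac)
    qed (simp add: lift_def)
    then have "lift j (\<lambda>x. fst x ^ a * snd x ^ c)
      = (\<lambda>p. poly P (p$1 / (1 - p$3)) * poly Q (p$2 / (1 - p$3)) * p$3 ^ c * (1 - p$3) ^ (a + 1))" by blast
    then show ?thesis using pyr_space_poly_mem[OF that(1,2), of "a + 1" c] assms by simp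
  qed
  have f: "(e - x * e) ^ a = (1 - x) ^ a * e ^ a" for e x :: real
    by (simp flip: power_mult_distrib add: algebra_simps)
  show ?thesis
  proof (cases j rule: mod4_cases)
    case 1
    show ?thesis
    proof (rule *[of "?Y * ?X ^ a" ?Y "\<lambda>x y e. e - y" "\<lambda>x y e. e - x" "\<lambda>x y e. x"])
      fix e x y :: real assume "e \<noteq> 0"
      then show "(e - y * e) * (e - x * e) / e * (x * e) ^ a
          = poly (?Y * ?X ^ a) x * poly ?Y y * e ^ (a + 1)"
        by (simp add: poly_power power_mult_distrib field_simps)
    qed (use 1 assms in \<open>simp_all add: deg bar_def del: mult_pCons_left\<close>)
  next
    case 2
    show ?thesis
    proof (rule *[of ?X "?Y * ?X ^ a" "\<lambda>x y e. x" "\<lambda>x y e. e - y" "\<lambda>x y e. y"])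
      fix e x y :: real assume "e \<noteq> 0"
      then show "x * e * (e - y * e) / e * (y * e) ^ a
          = poly ?X x * poly (?Y * ?X ^ a) y * e ^ (a + 1)"
        by (simp add: poly_power power_mult_distrib field_simps)
    qed (use 2 assms in \<open>simp_all add: deg bar_def del: mult_pCons_left\<close>)
  next
    case 3
    show ?thesis
    proof (rule *[of "?X * ?Y ^ a" ?X "\<lambda>x y e. y" "\<lambda>x y e. x" "\<lambda>x y e. e - x"])
      fix e x y :: real assume "e \<noteq> 0"
      then show "y * e * (x * e) / e * (e - x * e) ^ a
          = poly (?X * ?Y ^ a) x * poly ?X y * e ^ (a + 1)"
        by (simp add: poly_power f)
    qed (use 3 assms in \<open>simp_all add: deg bar_def del: mult_pCons_left\<close>)
  next
    case 4
    show ?thesis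
    proof (rule *[of ?Y "?X * ?Y ^ a" "\<lambda>x y e. e - x" "\<lambda>x y e. y" "\<lambda>x y e. e - y"])
      fix e x y :: real assume "e \<noteq> 0"
      then show "(e - x * e) * (y * e) / e * (e - y * e) ^ a
          = poly ?Y x * poly (?X * ?Y ^ a) y * e ^ (a + 1)"
        by (simp add: poly_power f) (simp add: algebra_simps)
    qed (use 4 assms in \<open>simp_all add: deg bar_def del: mult_pCons_left\<close>)
  qed
qed

lemma lift_pyr_space:
  assumes "r \<in> P2_poly (int k - 1)"
  shows "lift j r \<in> pyr_space k"
  using assms unfolding P2_poly_span lift_def
proof (rule span_weighted_compose[OF _ subspace_pyr_space])
  fix g :: "real \<times> real \<Rightarrow> real"
  assume "g \<in> {\<lambda>x. fst x ^ a * snd x ^ b |a b. int (a + b) \<le> int k - 1}"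
  then obtain a c where g: "g = (\<lambda>x. fst x ^ a * snd x ^ c)" "int (a + c) \<le> int k - 1" by blast
  then show "(\<lambda>p. bar j p * bar (j + 3) p / (1 - p$3) * g (bar (j + 1) p, p$3)) \<in> pyr_space k"
    using lift_monomial_pyr_space[of a c k j] by (simp add: lift_def)
qed

text \<open>On triangle \<open>j\<close> the factor \<open>bar j\<close> equals the denominator
  since \<open>bar (j + 2)\<close> vanishes; on triangle \<open>j + 3\<close> the factor
  \<open>bar (j + 3)\<close> does, since \<open>bar (j + 1)\<close> vanishes. On the other two
  triangles a numerator factor is zero. At the apex every \<open>bar\<close> is 0, so both sides
  agree there too.\<close>

lemma lift_triangle:
  "x \<in> triangle_set (tri j) \<Longrightarrow> lift j r x = bar (j + 3) x * r (bar (j + 1) x, x$3)"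
  "x \<in> triangle_set (tri (j + 3)) \<Longrightarrow> lift j r x = bar j x * r (0, x$3)"
  "x \<in> triangle_set (tri (j + 1)) \<Longrightarrow> lift j r x = 0"
  "x \<in> triangle_set (tri (j + 2)) \<Longrightarrow> lift j r x = 0"
proof -
  have at_apex: "bar i x = 0" if "x \<in> pyramid" "x$3 = 1" for i
    using pyramid_bar_nonneg[OF that(1), of i] pyramid_bar_le[OF that(1), of i] that by simp
  have opp: "bar (j + 5) x = bar (j + 1) x" "bar (j + 4) x = bar j x"
    using bar_plus_4[of "j + 1"] bar_plus_4[of j] by (simp_all add: numeral_eq_Suc)
  show "lift j r x = bar (j + 3) x * r (bar (j + 1) x, x$3)" if "x \<in> triangle_set (tri j)"
  proof (cases "x$3 = 1")
    case True
    then show ?thesis using that at_apex[of "j + 3"] by (simp add: triangle_set_tri lift_def)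
  next
    case False
    then show ?thesis using that bar_opposite[of j x] by (simp add: triangle_set_tri lift_def)
  qed
  show "lift j r x = bar j x * r (0, x$3)" if "x \<in> triangle_set (tri (j + 3))"
  proof (cases "x$3 = 1")
    case True
    then show ?thesis using that at_apex[of j] by (simp add: triangle_set_tri lift_def)
  next
    case False
    have "bar (j + 1) x = 0" using that opp by (simp add: triangle_set_tri add.assoc)
    then show ?thesis using False bar_plus_3[of j x] by (simp add: lift_def)
  qed
  show "lift j r x = 0" if "x \<in> triangle_set (tri (j + 1))"
  proof -
    have j: "j + 1 + 2 = j + 3" by simp
    have "bar (j + 1 + 2) x = 0" using that by (simp only: triangle_set_tri mem_Collect_eq)
    then have "bar (j + 3) x = 0" by (simp only: j)
    then show ?thesis by (simp add: lift_def)
  qed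
  show "lift j r x = 0" if "x \<in> triangle_set (tri (j + 2))"
  proof -
    have j: "j + 2 + 2 = j + 4" by simp
    have "bar (j + 2 + 2) x = 0" using that by (simp only: triangle_set_tri mem_Collect_eq)
    then have "bar j x = 0" by (simp only: j opp)
    then show ?thesis by (simp add: lift_def)
  qed
qed

lemma lift_U_space:
  assumes r: "r \<in> P2_poly (int k - 1)"
  shows "ext0 pyramid (lift j r) \<in> U_space k"
proof (rule U_spaceI[OF lift_pyr_space[OF r]])
  have z: "(\<lambda>p. p$3) \<in> P_poly 1" by (rule P_poly_coord) simp
  have "(\<lambda>x. bar (j + 3) x * r (bar (j + 1) x, x$3)) \<in> P_poly (1 + (int k - 1))"
    by (intro P_poly_mult bar_P_poly P2_poly_compose_P[OF r bar_P_poly z])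
  moreover have "(\<lambda>x. bar j x * r (0, x$3)) \<in> P_poly (1 + (int k - 1))"
    by (intro P_poly_mult bar_P_poly P2_poly_compose_P[OF r P_poly_const z]) simp
  moreover have "(\<lambda>x. 0) \<in> P_poly (int k)" by (rule subspace_pointwise(1)[OF subspace_P_poly])
  ultimately show "on_triangles k (lift j r)"
    unfolding on_triangles_def triangles_from[of j] using lift_triangle[of _ j r] by fastforce
qed

text \<open>The square bubble and \<open>r\<close> are evaluated at the quotients, hence are
  constant along rays from the apex. One factor \<open>1 - p$3\<close> restores continuity at the
  apex and is 1 on the base.\<close>

definition base_lift :: "(real \<times> real \<Rightarrow> real) \<Rightarrow> scalar_field" where
  "base_lift r = (\<lambda>p. p$1 / (1 - p$3) * (1 - p$1 / (1 - p$3)) *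
     (p$2 / (1 - p$3) * (1 - p$2 / (1 - p$3))) * (1 - p$3) * r (p$1 / (1 - p$3), p$2 / (1 - p$3)))"

lemma base_lift_pyr_space:
  assumes "r \<in> Q2_poly (int k - 2) (int k - 2)" "k \<ge> 1"
  shows "base_lift r \<in> pyr_space k"
  using assms(1) unfolding Q2_poly_def base_lift_def
proof (rule span_weighted_compose[OF _ subspace_pyr_space])
  fix g :: "real \<times> real \<Rightarrow> real"
  assume "g \<in> {\<lambda>x. fst x ^ a * snd x ^ b |a b. int a \<le> int k - 2 \<and> int b \<le> int k - 2}"
  then obtain a c where g: "g = (\<lambda>x. fst x ^ a * snd x ^ c)" "a + 2 \<le> k" "c + 2 \<le> k" by auto
  let ?P = "\<lambda>a. [:0, 1:] * [:1, -1:] * [:0, 1:] ^ a :: real poly"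
  have deg: "degree (?P a) \<le> k" if "a + 2 \<le> k" for a
  proof -
    have "degree (?P a) \<le> degree ([:0, 1:] * [:1, -1:] :: real poly) + degree ([:0, 1:] :: real poly) * a"
      using degree_mult_le[of "[:0, 1:] * [:1, -1:] :: real poly" "[:0, 1:] ^ a"]
        degree_power_le[of "[:0, 1:] :: real poly" a] by linarith
    also have "\<dots> \<le> 2 + a" by simp
    finally show ?thesis using that by simp
  qed
  let ?f = "\<lambda>p::point. p$1 / (1 - p$3) * (1 - p$1 / (1 - p$3)) * (p$2 / (1 - p$3) * (1 - p$2 / (1 - p$3))) *
      (1 - p$3) * g (p$1 / (1 - p$3), p$2 / (1 - p$3))"
  have "?f = (\<lambda>p. poly (?P a) (p$1 / (1 - p$3)) * poly (?P c) (p$2 / (1 - p$3)) * p$3 ^ 0 * (1 - p$3) ^ 1)"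
    by (simp only: g(1) poly_mult poly_power fun_eq_iff) (simp add: mult_ac)
  moreover have "\<dots> \<in> pyr_space k"
    using assms(2) by (intro pyr_space_poly_mem[OF deg deg, OF g(2,3)]) auto
  ultimately show "?f \<in> pyr_space k" by (simp only:)
qed

text \<open>On a triangle one of the two quotients is 0 or 1, which kills the bubble; at the apex
  the factor \<open>1 - p$3\<close> is zero.\<close>

lemma base_lift_triangle:
  assumes "x \<in> triangle_set (tri j)" shows "base_lift r x = 0"
proof (cases "x$3 = 1")
  case False
  have "bar (j + 2) x = 0" using assms by (simp add: triangle_set_tri)
  then show ?thesis using False
    by (cases j rule: mod4_cases) (auto simp: bar_def base_lift_def diff_eq_eq divide_simps)
qed (simp add: base_lift_def)

lemma base_lift_U_space:
  assumes "r \<in> Q2_poly (int k - 2) (int k - 2)" "k \<ge> 1"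
  shows "ext0 pyramid (base_lift r) \<in> U_space k"
proof (rule U_spaceI[OF base_lift_pyr_space[OF assms]])
  show "on_triangles k (base_lift r)"
    unfolding on_triangles_def
  proof
    fix s assume "s \<in> triangles"
    then obtain j where "s = tri j" by (auto simp: triangles_tri)
    then show "\<exists>G\<in>P_poly (int k). \<forall>x\<in>triangle_set s. base_lift r x = G x"
      using subspace_pointwise(1)[OF subspace_P_poly[of "int k"]] base_lift_triangle
      by (intro bexI[of _ "\<lambda>x. 0"]) (simp_all del: triangle_set.simps)
  qed
qed

lemma apex_function_U_space: "ext0 pyramid (\<lambda>p. p$3 ^ k) \<in> U_space k"
proof (rule U_spaceI)
  show "(\<lambda>p. p$3 ^ k) \<in> pyr_space k" unfolding pyr_space_def by (rule span_base) simp
  have "(\<lambda>p. p$3 ^ k) \<in> P_poly (int k)" by (intro P_poly_power P_poly_coord) simp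
  then show "on_triangles k (\<lambda>p. p$3 ^ k)" by (auto simp: on_triangles_def)
qed

section \<open>Gradients and the Sobolev space\<close>

lemma pyramid_halfspaces:
  "pyramid = {p. 0 \<le> p$1} \<inter> {p. 0 \<le> p$2} \<inter> {p. 0 \<le> p$3} \<inter>
    {p. p$1 \<le> 1 - p$3} \<inter> {p. p$2 \<le> 1 - p$3}"
  by (auto simp: pyramid_def)

lemma interior_pyramid:
  "interior pyramid = {p. 0 < p$1 \<and> 0 < p$2 \<and> 0 < p$3 \<and> p$1 < 1 - p$3 \<and> p$2 < 1 - p$3}"
proof -
  have ge: "interior {p::point. 0 \<le> p$i} = {p. 0 < p$i}" for i
    using interior_halfspace_ge[of "axis i 1 :: point" 0] by (simp add: inner_axis' axis_eq_0_iff)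
  have le: "interior {p::point. p$i \<le> 1 - p$3} = {p. p$i < 1 - p$3}" if "i \<noteq> 3" for i
  proof -
    have "axis i 1 + axis 3 1 \<noteq> (0 :: point)"
    proof
      assume "axis i 1 + axis 3 1 = (0 :: point)"
      then have "(axis i 1 + axis 3 1) $ 3 = (0 :: point) $ 3" by simp
      then show False using that by (simp add: axis_def)
    qed
    then show ?thesis
      using interior_halfspace_le[of "axis i 1 + axis 3 1 :: point" 1]
      by (simp add: inner_axis' inner_add_left le_diff_eq less_diff_eq)
  qed
  show ?thesis
    unfolding pyramid_halfspaces interior_Int using le[of 1] le[of 2] by (auto simp: ge)
qed

lemma compact_pyramid: "compact pyramid"
proof -
  have "closed pyramid"
    unfolding pyramid_halfspaces by (intro closed_Int closed_Collect_le continuous_intros)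
  moreover have "pyramid \<subseteq> cbox 0 1"
    by (auto simp: pyramid_def mem_box_cart forall_3)
  then have "bounded pyramid" using bounded_cbox bounded_subset by blast
  ultimately show ?thesis by (simp add: compact_eq_bounded_closed)
qed

lemma frontier_pyramid: "frontier pyramid = \<Union>faces"
proof -
  have "frontier pyramid = pyramid - interior pyramid"
    using compact_imp_closed[OF compact_pyramid] by (simp add: frontier_def)
  also have "\<dots> = base \<union> (\<Union>j\<in>{0, 1, 2, 3}. triangle_set (tri j))"
    unfolding triangle_set_tri base_def interior_pyramid by (auto simp: bar_def pyramid_def)
  also have "\<dots> = \<Union>faces"
    unfolding faces_def triangles_from[of 0] by auto
  finally show ?thesis .
qed

lemma has_derivative_nth: "((\<lambda>x::real^'n. x$i) has_derivative (\<lambda>h. h$i)) F"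
  by (rule bounded_linear_imp_has_derivative[OF bounded_linear_vec_nth])

text \<open>Differentiation lowers the exponent of \<open>1 - p$3\<close> by at most one. In the
  vertical direction each quotient reproduces itself divided by \<open>1 - p$3\<close>, which
  contributes the coefficients \<open>a\<close> and \<open>b\<close> beside that of the outer
  power.\<close>

lemma pyr_monomial_has_derivative:
  assumes "p$3 < 1"
  shows "(pyr_monomial a b c (Suc d) has_derivative (\<lambda>h.
      real a * pyr_monomial (a - 1) b c d p * h$1 + real b * pyr_monomial a (b - 1) c d p * h$2 +
      ((real a + real b - real (Suc d)) * pyr_monomial a b c d p
        + real c * pyr_monomial a b (c - 1) (Suc d) p) * h$3)) (at p)"
proof -
  define e where "e = 1 - p$3"
  have e: "e > 0" using assms by (simp add: e_def)
  define x y z where "x = p$1 / e" and "y = p$2 / e" and "z = p$3"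
  have X: "((\<lambda>p. p$i / (1 - p$3)) has_derivative (\<lambda>h. (h$i + p$i / e * h$3) / e)) (at p)" for i
    using e by (auto intro!: derivative_eq_intros has_derivative_nth simp: e_def field_simps power2_eq_square)
  have A: "((\<lambda>p. (p$i / (1 - p$3)) ^ n) has_derivative
      (\<lambda>h. real n * (p$i / e) ^ (n - 1) * ((h$i + p$i / e * h$3) / e))) (at p)" for i n
    by (rule has_derivative_eq_rhs, rule has_derivative_power, rule X)
      (simp add: e_def mult_ac)
  have C: "((\<lambda>p. p$3 ^ c) has_derivative (\<lambda>h. real c * z ^ (c - 1) * h$3)) (at p)"
    by (rule has_derivative_eq_rhs, rule has_derivative_power, rule has_derivative_nth)
      (simp add: z_def mult_ac)
  have E: "((\<lambda>p. (1 - p$3) ^ Suc d) has_derivative (\<lambda>h. - (real (Suc d) * e ^ d * h$3))) (at p)"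
    by (rule has_derivative_eq_rhs, rule has_derivative_power, rule has_derivative_diff,
        rule has_derivative_const, rule has_derivative_nth) (simp add: e_def mult_ac)
  have D: "(pyr_monomial a b c (Suc d) has_derivative (\<lambda>h.
      (real a * x ^ (a - 1) * ((h$1 + x * h$3) / e)) * y ^ b * z ^ c * e ^ Suc d
      + x ^ a * (real b * y ^ (b - 1) * ((h$2 + y * h$3) / e)) * z ^ c * e ^ Suc d
      + x ^ a * y ^ b * (real c * z ^ (c - 1) * h$3) * e ^ Suc d
      - x ^ a * y ^ b * z ^ c * (real (Suc d) * e ^ d * h$3))) (at p)"
    unfolding pyr_monomial_def
    by (rule has_derivative_eq_rhs[OF has_derivative_mult[OF has_derivative_mult[OF
          has_derivative_mult[OF A[of 1 a] A[of 2 b]] C] E]])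
      (simp only: e_def[symmetric], simp only: x_def[symmetric] y_def[symmetric] z_def[symmetric],
       simp add: fun_eq_iff algebra_simps)
  \<comment> \<open>The factor \<open>x\<close> produced by the chain rule restores the exponent;
    for exponent 0 the coefficient makes both sides 0 despite the truncated subtraction.\<close>
  have xa: "real a * x ^ (a - 1) * x = real a * x ^ a" by (cases a) simp_all
  have yb: "real b * y ^ (b - 1) * y = real b * y ^ b" by (cases b) simp_all
  have T1: "real a * x ^ (a - 1) * ((u + x * w) / e) * y ^ b * z ^ c * e ^ Suc d
      = real a * (x ^ (a - 1) * y ^ b * z ^ c * e ^ d) * u
        + real a * x ^ a * y ^ b * z ^ c * e ^ d * w" for u w
    unfolding xa[symmetric] using e by (simp add: field_simps)
  have T2: "x ^ a * (real b * y ^ (b - 1) * ((u + y * w) / e)) * z ^ c * e ^ Suc d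
      = real b * (x ^ a * y ^ (b - 1) * z ^ c * e ^ d) * u
        + x ^ a * (real b * y ^ b) * z ^ c * e ^ d * w" for u w
    unfolding yb[symmetric] using e by (simp add: field_simps)
  have M: "pyr_monomial i j m n p = x ^ i * y ^ j * z ^ m * e ^ n" for i j m n
    by (simp add: pyr_monomial_def x_def y_def z_def e_def)
  show ?thesis
    by (rule has_derivative_eq_rhs[OF D]) (simp only: T1 T2 M, simp add: fun_eq_iff algebra_simps)
qed

text \<open>Here \<open>d = 0\<close> is allowed, so members are bounded on the pyramid but need not
  have a limit at the apex.\<close>

definition pyr_gradients :: "scalar_field set" where
  "pyr_gradients = span {pyr_monomial a b c d | a b c d. True}"

lemma subspace_pyr_gradients: "subspace pyr_gradients"
  by (simp add: pyr_gradients_def)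

lemma pyr_monomial_gradients: "pyr_monomial a b c d \<in> pyr_gradients"
  unfolding pyr_gradients_def by (rule span_base) blast

lemma pyr_space_has_derivative:
  assumes "f \<in> pyr_space k"
  shows "\<exists>G :: 3 \<Rightarrow> scalar_field. (\<forall>i. G i \<in> pyr_gradients) \<and>
    (\<forall>p. p$3 < 1 \<longrightarrow> (f has_derivative (\<lambda>h. G 1 p * h$1 + G 2 p * h$2 + G 3 p * h$3)) (at p))"
  using assms unfolding pyr_space_def
proof (induction rule: span_induct_alt)
  case base
  show ?case using subspace_pointwise(1)[OF subspace_pyr_gradients]
    by (intro exI[of _ "\<lambda>i p. 0"]) (auto simp: zero_fun_def)
next
  case (step \<alpha> g v)
  then obtain G :: "3 \<Rightarrow> scalar_field" where G: "\<forall>i. G i \<in> pyr_gradients"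
    "\<And>p. p$3 < 1 \<Longrightarrow> (v has_derivative (\<lambda>h. G 1 p * h$1 + G 2 p * h$2 + G 3 p * h$3)) (at p)" by blast
  have "\<exists>H1\<in>pyr_gradients. \<exists>H2\<in>pyr_gradients. \<exists>H3\<in>pyr_gradients. \<forall>p. p$3 < 1 \<longrightarrow>
    (g has_derivative (\<lambda>h. H1 p * h$1 + H2 p * h$2 + H3 p * h$3)) (at p)"
  proof -
    from step(1) consider "g = (\<lambda>p. p$3 ^ k)"
      | a b c d where "g = pyr_monomial a b c (Suc d)"
      by (auto, metis One_nat_def Suc_le_D)
    then show ?thesis
    proof cases
      case 1
      have "(\<lambda>p. real k * pyr_monomial 0 0 (k - 1) 0 p) \<in> pyr_gradients"
        by (intro subspace_pointwise(4)[OF subspace_pyr_gradients] pyr_monomial_gradients)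
      then have "(\<lambda>p. real k * p$3 ^ (k - 1)) \<in> pyr_gradients" by (simp add: pyr_monomial_def)
      moreover have "(g has_derivative (\<lambda>h. 0 * h$1 + 0 * h$2 + real k * p$3 ^ (k - 1) * h$3)) (at p)" for p
        unfolding 1 by (auto intro!: derivative_eq_intros has_derivative_nth)
      moreover have "(\<lambda>p. 0) \<in> pyr_gradients" by (rule subspace_pointwise(1)[OF subspace_pyr_gradients])
      ultimately show ?thesis
        by (intro bexI[of _ "\<lambda>p. 0"] bexI[of _ "\<lambda>p. real k * p$3 ^ (k - 1)"]) auto
    next
      case 2
      have 3: "(\<lambda>p. (real a + real b - real (Suc d)) * pyr_monomial a b c d p
        + real c * pyr_monomial a b (c - 1) (Suc d) p) \<in> pyr_gradients"
        by (intro subspace_pointwise(2,4)[OF subspace_pyr_gradients] pyr_monomial_gradients)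
      have 1: "(\<lambda>p. real a * pyr_monomial (a - 1) b c d p) \<in> pyr_gradients"
        "(\<lambda>p. real b * pyr_monomial a (b - 1) c d p) \<in> pyr_gradients"
        by (intro subspace_pointwise(4)[OF subspace_pyr_gradients] pyr_monomial_gradients)+
      show ?thesis unfolding 2
        by (rule bexI[OF _ 1(1)], rule bexI[OF _ 1(2)], rule bexI[OF _ 3])
          (intro allI impI pyr_monomial_has_derivative)
    qed
  qed
  then obtain H1 H2 H3 where H: "H1 \<in> pyr_gradients" "H2 \<in> pyr_gradients" "H3 \<in> pyr_gradients"
    "\<And>p. p$3 < 1 \<Longrightarrow> (g has_derivative (\<lambda>h. H1 p * h$1 + H2 p * h$2 + H3 p * h$3)) (at p)" by blast
  define K where "K = (\<lambda>i::3. if i = 1 then (\<lambda>p. \<alpha> * H1 p + G 1 p)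
    else if i = 2 then (\<lambda>p. \<alpha> * H2 p + G 2 p) else (\<lambda>p. \<alpha> * H3 p + G 3 p))"
  have "K i \<in> pyr_gradients" for i
    unfolding K_def using G H by (auto intro!: subspace_pointwise(2,4)[OF subspace_pyr_gradients])
  moreover have "(\<alpha> *\<^sub>R g + v has_derivative (\<lambda>h. K 1 p * h$1 + K 2 p * h$2 + K 3 p * h$3)) (at p)"
    if "p$3 < 1" for p
    unfolding plus_fun_def scaleR_fun_def K_def
    by (rule has_derivative_eq_rhs, rule derivative_intros, rule has_derivative_scaleR_right,
        rule H(4)[OF that], rule G(2)[OF that]) (simp add: fun_eq_iff algebra_simps)
  ultimately show ?case by blast
qed

lemma pyr_gradients_bounded:
  assumes "g \<in> pyr_gradients"
  shows "\<exists>B. \<forall>p\<in>pyramid. \<bar>g p\<bar> \<le> B"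
  using assms unfolding pyr_gradients_def
proof (induction rule: span_induct_alt)
  case (step \<alpha> g v)
  then obtain a b c d B where g: "g = pyr_monomial a b c d" and B: "\<forall>p\<in>pyramid. \<bar>v p\<bar> \<le> B" by blast
  have "\<bar>g p\<bar> \<le> 1" if "p \<in> pyramid" for p
  proof -
    have "\<bar>1 - p$3\<bar> ^ d \<le> 1" using pyramid_coord[OF that] by (intro power_le_one) auto
    then show ?thesis unfolding g by (rule order_trans[OF pyr_monomial_bound[OF that]])
  qed
  then have "\<bar>(\<alpha> *\<^sub>R g + v) p\<bar> \<le> \<bar>\<alpha>\<bar> * 1 + B" if "p \<in> pyramid" for p
  proof -
    have "\<bar>\<alpha> * g p\<bar> \<le> \<bar>\<alpha>\<bar> * 1" using \<open>\<And>p. p \<in> pyramid \<Longrightarrow> \<bar>g p\<bar> \<le> 1\<close>[OF that]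
      by (simp only: abs_mult) (intro mult_left_mono, auto)
    then show ?thesis using B that abs_triangle_ineq[of "\<alpha> * g p" "v p"]
      by (fastforce simp: scaleR_fun_def)
  qed
  then show ?case by blast
qed (auto simp: zero_fun_def)

text \<open>In the open interior the extension by zero agrees with the rational function, so its
  partial derivatives are there members of \<open>pyr_gradients\<close>.\<close>

lemma U_space_gradient:
  assumes "p \<in> U_space k"
  shows "x \<in> interior pyramid \<Longrightarrow>
      (p has_derivative (\<lambda>h. \<Sum>i\<in>UNIV. partial i p x * h$i)) (at x)"
    and "continuous_on (interior pyramid) (partial i p)"
    and "\<exists>B. \<forall>x\<in>interior pyramid. \<bar>partial i p x\<bar> \<le> B"
proof -
  obtain f where f: "f \<in> pyr_space k" "p = ext0 pyramid f" using assms by (rule U_spaceE)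
  obtain G where G: "\<And>i::3. G i \<in> pyr_gradients" "\<And>x. x$3 < 1 \<Longrightarrow>
    (f has_derivative (\<lambda>h. G 1 x * h$1 + G 2 x * h$2 + G 3 x * h$3)) (at x)"
    using pyr_space_has_derivative[OF f(1)] by blast
  have D: "(p has_derivative (\<lambda>h. \<Sum>i\<in>UNIV. G i x * h$i)) (at x)" if "x \<in> interior pyramid" for x
  proof (rule has_derivative_transform_within_open[OF _ open_interior that])
    show "(f has_derivative (\<lambda>h. \<Sum>i\<in>UNIV. G i x * h$i)) (at x)"
      using G(2)[of x] that by (simp add: interior_pyramid sum_3)
    show "f y = p y" if "y \<in> interior pyramid" for y
      using that interior_subset[of pyramid] by (auto simp: f ext0_def)
  qed
  have P: "partial i p x = G i x" if "x \<in> interior pyramid" for i x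
  proof -
    have "partial i p x = (\<Sum>j\<in>UNIV. G j x * axis i 1 $ j)"
      unfolding partial_def frechet_derivative_at[OF D[OF that], symmetric] ..
    also have "\<dots> = G i x" by (simp add: axis_def if_distrib cong: if_cong)
    finally show ?thesis .
  qed
  show "x \<in> interior pyramid \<Longrightarrow> (p has_derivative (\<lambda>h. \<Sum>i\<in>UNIV. partial i p x * h$i)) (at x)"
    using D P by simp
  have "continuous_on (interior pyramid) (G i)"
    using G(1)[of i] unfolding pyr_gradients_def
    by (rule continuous_on_span)
      (auto intro!: continuous_on_subset[OF continuous_on_pyr_monomial] simp: interior_pyramid)
  then show "continuous_on (interior pyramid) (partial i p)"
    using P continuous_on_cong[of "interior pyramid" "interior pyramid" "partial i p" "G i"] by simp
  show "\<exists>B. \<forall>x\<in>interior pyramid. \<bar>partial i p x\<bar> \<le> B"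
    using pyr_gradients_bounded[OF G(1), of i] P interior_subset[of pyramid] by (metis subsetD)
qed

lemma set_integrable_lebesgue_bounded:
  fixes f :: "'a::euclidean_space \<Rightarrow> real"
  assumes "open D" "bounded D" "continuous_on D f" "\<And>x. x \<in> D \<Longrightarrow> \<bar>f x\<bar> \<le> B"
  shows "set_integrable lebesgue D f"
proof -
  have meas: "(\<lambda>x. indicator D x *\<^sub>R f x) \<in> borel_measurable borel"
    using assms by (intro borel_measurable_continuous_on_indicator) auto
  have "integrable lborel (\<lambda>x. indicator D x *\<^sub>R f x)"
  proof (rule Bochner_Integration.integrable_bound)
    show "integrable lborel (\<lambda>x. indicator D x * B)"
      using assms emeasure_bounded_finite[of D] by (intro integrable_mult_left) auto
    show "AE x in lborel. norm (indicator D x *\<^sub>R f x) \<le> norm (indicator D x * B)"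
      using assms(4) by (intro AE_I2) (auto simp: indicator_def intro: order_trans[OF _ abs_ge_self])
  qed (use meas in simp)
  then show ?thesis
    unfolding set_integrable_def using meas by (subst integrable_completion) auto
qed

section \<open>Classical derivatives as weak derivatives\<close>

lemma partial_has_derivative:
  assumes "(f has_derivative D) (at x)" shows "partial i f x = D (axis i 1)"
  unfolding partial_def frechet_derivative_at[OF assms, symmetric] ..

text \<open>Restriction to a line in an axis direction turns the partial derivative into a real
  derivative, to which the mean value theorem applies.\<close>

lemma differentiable_along_axis:
  assumes "\<And>x. F differentiable (at x)"
  shows "((\<lambda>t. F (x + t *\<^sub>R axis i 1)) has_real_derivative partial i F (x + t *\<^sub>R axis i 1)) (at t)"
proof -
  let ?y = "x + t *\<^sub>R axis i 1"
  have "(F has_derivative frechet_derivative F (at ?y)) (at ?y)"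
    using assms frechet_derivative_works by blast
  moreover have "((\<lambda>t. x + t *\<^sub>R axis i 1) has_derivative (\<lambda>h. h *\<^sub>R axis i 1)) (at t)"
    by (auto intro!: derivative_eq_intros)
  ultimately have "((\<lambda>t. F (x + t *\<^sub>R axis i 1)) has_derivative
      (\<lambda>h. frechet_derivative F (at ?y) (h *\<^sub>R axis i 1))) (at t)"
    by (rule has_derivative_compose[rotated])
  moreover have "frechet_derivative F (at ?y) (h *\<^sub>R axis i 1) = h * partial i F ?y" for h
    using linear_frechet_derivative[OF assms, of ?y] by (simp add: linear_scale partial_def)
  ultimately show ?thesis
    by (simp add: has_field_derivative_def mult_commute_abs)
qed

text \<open>By translation invariance every difference quotient of \<open>F\<close> has integral zero, and the
  difference quotients converge dominatedly to the partial derivative.\<close>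

lemma integral_partial_compact_support:
  fixes F :: scalar_field
  assumes diff: "\<And>x. F differentiable (at x)" and cont: "continuous_on UNIV (partial i F)"
    and K: "compact K" "\<And>x. x \<notin> K \<Longrightarrow> F x = 0"
  shows "integral\<^sup>L lborel (partial i F) = 0"
proof -
  let ?v = "axis i 1 :: point"
  have F_cont: "continuous_on UNIV F"
    using diff by (simp add: continuous_at_imp_continuous_on differentiable_imp_continuous_within)
  have zero: "partial i F x = 0" if "x \<notin> K" for x
  proof -
    have "(F has_derivative (\<lambda>h. 0)) (at x)"
    proof (rule has_derivative_transform_within_open[of "\<lambda>_. 0"])
      show "open (- K)" using K(1) compact_imp_closed by blast
    qed (use that K(2) in auto)
    then show ?thesis by (simp add: partial_has_derivative)
  qed
  obtain B where B: "\<And>x. \<bar>partial i F x\<bar> \<le> B" "0 \<le> B"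
  proof -
    have "compact (partial i F ` K)" using K(1) cont continuous_on_subset compact_continuous_image by blast
    then obtain B where "\<forall>y\<in>partial i F ` K. norm y \<le> B" "B > 0"
      using compact_imp_bounded bounded_pos by blast
    then show thesis using zero that[of B] by (metis abs_zero imageI less_eq_real_def real_norm_def)
  qed
  obtain R where R: "K \<subseteq> cball 0 R"
    using compact_imp_bounded[OF K(1)] by (auto simp: bounded_iff subset_iff)
  \<comment> \<open>Step sizes tend to 0 and never exceed 1, so a ball enlarged by 1 contains the
    supports of all difference quotients.\<close>
  define s where "s n = inverse (real (Suc n))" for n
  have s: "0 < s n" "s n \<le> 1" for n by (auto simp: s_def inverse_le_1_iff)
  define q where "q n x = (F (x + s n *\<^sub>R ?v) - F x) / s n" for n x
  have F_int: "integrable lborel F"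
  proof -
    have "integrable lborel (\<lambda>x. indicator K x *\<^sub>R F x)"
      by (intro borel_integrable_compact K(1) continuous_on_subset[OF F_cont]) simp
    moreover have "(\<lambda>x. indicator K x *\<^sub>R F x) = F" using K(2) by (auto simp: indicator_def fun_eq_iff)
    ultimately show ?thesis by simp
  qed
  have F_meas: "F \<in> borel_measurable borel" using F_cont by (rule borel_measurable_continuous_onI)
  have shift_int: "integrable lborel (\<lambda>x. F (x + c))" and
    shift: "integral\<^sup>L lborel (\<lambda>x. F (x + c)) = integral\<^sup>L lborel F" for c
    using integrable_distr_eq[of "(+) c" lborel borel F] integral_distr[of "(+) c" lborel borel F]
      F_int F_meas by (simp_all add: lborel_distr_plus add.commute)
  have q_int: "integral\<^sup>L lborel (q n) = 0" for n
    unfolding q_def using shift_int[of "s n *\<^sub>R ?v"] F_int shift[of "s n *\<^sub>R ?v"] by simp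
  \<comment> \<open>The integrable majorant: inside the ball the mean value theorem bounds the
    quotient by \<open>B\<close>; outside, both \<open>x\<close> and its translate miss
    \<open>K\<close>.\<close>
  have q_bound: "\<bar>q n x\<bar> \<le> indicator (cball 0 (R + 1)) x * B" for n x
  proof (cases "x \<in> cball 0 (R + 1)")
    case True
    obtain z where "F (x + s n *\<^sub>R ?v) - F (x + 0 *\<^sub>R ?v) = (s n - 0) * partial i F (x + z *\<^sub>R ?v)"
      using MVT2[of 0 "s n" "\<lambda>t. F (x + t *\<^sub>R ?v)" "\<lambda>t. partial i F (x + t *\<^sub>R ?v)"] s(1)[of n]
        differentiable_along_axis[OF diff] by blast
    then have "q n x = partial i F (x + z *\<^sub>R ?v)" using s(1)[of n] by (simp add: q_def)
    then show ?thesis using True B by simp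
  next
    case False
    have "norm (x + s n *\<^sub>R ?v) \<ge> norm x - norm (s n *\<^sub>R ?v)" by (rule norm_diff_ineq)
    moreover have "norm (s n *\<^sub>R ?v) \<le> 1" using s[of n] by simp
    ultimately have "x + s n *\<^sub>R ?v \<notin> K" "x \<notin> K" using False R by auto
    then show ?thesis using False K(2) by (simp add: q_def)
  qed
  have q_lim: "(\<lambda>n. q n x) \<longlonglongrightarrow> partial i F x" for x
  proof -
    have "((\<lambda>h. (F (x + (0 + h) *\<^sub>R ?v) - F (x + 0 *\<^sub>R ?v)) / h) \<longlongrightarrow> partial i F (x + 0 *\<^sub>R ?v)) (at 0)"
      using differentiable_along_axis[OF diff, of x i 0] unfolding DERIV_def .
    moreover have "filterlim s (at 0) sequentially"
      unfolding filterlim_at using LIMSEQ_inverse_real_of_nat s by (auto simp: s_def[abs_def])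
    ultimately show ?thesis
      unfolding q_def by (auto dest: filterlim_compose)
  qed
  have "(\<lambda>n. integral\<^sup>L lborel (q n)) \<longlonglongrightarrow> integral\<^sup>L lborel (partial i F)"
  proof (rule integral_dominated_convergence)
    show "partial i F \<in> borel_measurable lborel" using borel_measurable_continuous_onI[OF cont] by simp
    have "continuous_on UNIV (q n)" for n
      unfolding q_def using s(1)[of n]
      by (intro continuous_intros continuous_on_compose2[OF F_cont]) auto
    then show "q n \<in> borel_measurable lborel" for n by (simp add: borel_measurable_continuous_onI)
    show "integrable lborel (\<lambda>x::point. indicator (cball 0 (R + 1)) x * B)"
      using emeasure_bounded_finite[OF bounded_cball[of "0::point" "R + 1"]]
      by (intro integrable_mult_left integrable_real_indicator) auto
    show "AE x in lborel. (\<lambda>n. q n x) \<longlonglongrightarrow> partial i F x" using q_lim by simp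
    show "AE x in lborel. norm (q n x) \<le> indicator (cball 0 (R + 1)) x * B" for n
      using q_bound by simp
  qed
  then show ?thesis by (simp add: q_int LIMSEQ_const_iff)
qed

text \<open>The product \<open>p * h\<close>, extended by zero, has continuous partial derivative in
  direction \<open>i\<close> and compact support: \<open>D\<close> and the complement of the support
  of \<open>h\<close> are open and cover the whole space. Its partial derivative integrates to zero,
  and the product rule splits that integral.\<close>

lemma weak_partial_classical:
  assumes D: "open D" "bounded D"
    and p: "\<And>x. x \<in> D \<Longrightarrow> p differentiable (at x)" "\<And>x. x \<in> D \<Longrightarrow> \<bar>p x\<bar> \<le> A"
    and dp: "continuous_on D (partial i p)" "\<And>x. x \<in> D \<Longrightarrow> \<bar>partial i p x\<bar> \<le> B"
  shows "weak_partial D i p (partial i p)"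
  unfolding weak_partial_def
proof (intro allI impI)
  fix h assume h: "test_function D h"
  define K where "K = closure {x. h x \<noteq> 0}"
  have K: "compact K" "K \<subseteq> D" "\<And>x. x \<notin> K \<Longrightarrow> h x = 0"
    using h closure_subset[of "{x. h x \<noteq> 0}"] by (auto simp: test_function_def K_def)
  have "Ck (Suc 0) h" using h unfolding test_function_def by blast
  then have h_diff: "\<And>x. h differentiable (at x)" and dh_cont: "continuous_on UNIV (partial i h)" by auto
  have h_cont: "continuous_on UNIV h"
    using h_diff by (simp add: continuous_at_imp_continuous_on differentiable_imp_continuous_within)
  have p_cont: "continuous_on D p"
    using p(1) by (simp add: continuous_at_imp_continuous_on differentiable_imp_continuous_within)
  define F where "F = (\<lambda>x. if x \<in> D then p x * h x else 0)"
  have openK: "open (- K)" using K(1) compact_imp_closed by blast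
  have dh_zero: "partial i h x = 0" if "x \<notin> K" for x
  proof -
    have "(h has_derivative (\<lambda>h. 0)) (at x)"
      by (rule has_derivative_transform_within_open[of "\<lambda>_. 0" _ _ _ "- K"]) (use that openK K(3) in auto)
    then show ?thesis by (simp add: partial_has_derivative)
  qed
  have in_D: "(F has_derivative (\<lambda>v. p x * frechet_derivative h (at x) v + frechet_derivative p (at x) v * h x)) (at x)"
    if "x \<in> D" for x
  proof (rule has_derivative_transform_within_open[OF _ D(1) that])
    show "((\<lambda>x. p x * h x) has_derivative
        (\<lambda>v. p x * frechet_derivative h (at x) v + frechet_derivative p (at x) v * h x)) (at x)"
      using p(1)[OF that] h_diff[of x] by (intro has_derivative_mult) (auto simp: frechet_derivative_works)
  qed (simp add: F_def)
  have out_K: "(F has_derivative (\<lambda>v. 0)) (at x)" if "x \<notin> K" for x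
    by (rule has_derivative_transform_within_open[of "\<lambda>_. 0" _ _ _ "- K"])
      (use that openK K(3) in \<open>auto simp: F_def\<close>)
  have F_diff: "F differentiable (at x)" for x
    using in_D[of x] out_K[of x] K(2) unfolding differentiable_def by blast
  have dF: "partial i F x = indicator D x *\<^sub>R (p x * partial i h x) + indicator D x *\<^sub>R (partial i p x * h x)" for x
  proof (cases "x \<in> D")
    case True
    then show ?thesis using partial_has_derivative[OF in_D[OF True], of i] by (simp add: partial_def)
  next
    case False
    then show ?thesis using partial_has_derivative[OF out_K[of x], of i] K(2) by auto
  qed
  have dF_cont: "continuous_on UNIV (partial i F)"
  proof -
    have "continuous_on D (\<lambda>x. p x * partial i h x + partial i p x * h x)"
      using p_cont dp(1) continuous_on_subset[OF dh_cont] continuous_on_subset[OF h_cont]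
      by (intro continuous_intros) auto
    then have "continuous_on D (partial i F)" by (rule continuous_on_eq) (simp add: dF)
    moreover have "continuous_on (- K) (partial i F)"
      by (rule continuous_on_eq[of _ "\<lambda>_. 0"]) (simp_all add: dF dh_zero K(3))
    ultimately have "continuous_on (D \<union> - K) (partial i F)"
      by (intro continuous_on_open_Un D(1) openK)
    moreover have "D \<union> - K = UNIV" using K(2) by auto
    ultimately show ?thesis by simp
  qed
  have bound: "\<exists>C. \<forall>x\<in>D. \<bar>g x\<bar> \<le> C" if "continuous_on UNIV g" for g :: scalar_field
  proof -
    have "compact (g ` closure D)"
      using D(2) that continuous_on_subset by (intro compact_continuous_image) (auto simp: compact_closure)
    then obtain C where "\<forall>y\<in>g ` closure D. norm y \<le> C"
      using compact_imp_bounded bounded_iff by blast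
    then show ?thesis using closure_subset[of D] by (intro exI[of _ C]) auto
  qed
  obtain C1 C2 where C: "\<And>x. x \<in> D \<Longrightarrow> \<bar>h x\<bar> \<le> C1" "\<And>x. x \<in> D \<Longrightarrow> \<bar>partial i h x\<bar> \<le> C2"
    using bound[OF h_cont] bound[OF dh_cont] by blast
  have int1: "set_integrable lebesgue D (\<lambda>x. p x * partial i h x)"
    using p_cont continuous_on_subset[OF dh_cont] p(2) C(2)
    by (intro set_integrable_lebesgue_bounded[OF D, of _ "A * C2"] continuous_intros)
      (auto simp: abs_mult intro!: mult_mono order_trans[OF abs_ge_zero])
  have int2: "set_integrable lebesgue D (\<lambda>x. partial i p x * h x)"
    using dp continuous_on_subset[OF h_cont] C(1)
    by (intro set_integrable_lebesgue_bounded[OF D, of _ "B * C1"] continuous_intros)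
      (auto simp: abs_mult intro!: mult_mono order_trans[OF abs_ge_zero])
  have "integral\<^sup>L lebesgue (partial i F) = integral\<^sup>L lborel (partial i F)"
    using borel_measurable_continuous_onI[OF dF_cont] by (intro integral_completion) simp
  also have "\<dots> = 0"
    by (rule integral_partial_compact_support[OF F_diff dF_cont K(1)]) (simp add: F_def K(3))
  finally have "integral\<^sup>L lebesgue (partial i F) = 0" .
  moreover have "integral\<^sup>L lebesgue (partial i F)
      = (LINT x:D|lebesgue. p x * partial i h x) + (LINT x:D|lebesgue. partial i p x * h x)"
    using int1 int2 unfolding dF[abs_def] set_integrable_def set_lebesgue_integral_def
    by (rule Bochner_Integration.integral_add)
  ultimately show "(LINT x:D|lebesgue. p x * partial i h x) = - (LINT x:D|lebesgue. partial i p x * h x)"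
    by simp
qed

lemma in_L2_bounded:
  assumes "open D" "bounded D" "continuous_on D f" "\<And>x. x \<in> D \<Longrightarrow> \<bar>f x\<bar> \<le> B"
  shows "in_L2 D f"
proof -
  have "set_integrable lebesgue D (\<lambda>x. (f x)\<^sup>2)"
  proof (rule set_integrable_lebesgue_bounded[OF assms(1,2)])
    show "\<bar>(f x)\<^sup>2\<bar> \<le> B\<^sup>2" if "x \<in> D" for x using assms(4)[OF that] abs_le_square_iff[of "f x" B] by auto
  qed (intro continuous_intros assms(3))
  moreover have "set_borel_measurable lebesgue D f"
    using set_integrable_lebesgue_bounded[OF assms] borel_measurable_integrable
    unfolding set_integrable_def set_borel_measurable_def by blast
  ultimately show ?thesis by (simp add: in_L2_def)
qed

lemma U_space_bounded:
  assumes "p \<in> U_space k"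
  obtains B where "\<And>x. x \<in> pyramid \<Longrightarrow> \<bar>p x\<bar> \<le> B"
proof -
  have "compact (p ` pyramid)"
    by (rule compact_continuous_image[OF continuous_on_U_space[OF assms] compact_pyramid])
  then obtain B where "\<forall>y\<in>p ` pyramid. norm y \<le> B" using compact_imp_bounded bounded_iff by blast
  then show thesis using that by auto
qed

lemma bounded_interior_pyramid: "bounded (interior pyramid)"
  using compact_imp_bounded[OF compact_pyramid] interior_subset bounded_subset by blast

lemma in_H1_U_space:
  assumes p: "p \<in> U_space k" shows "in_H1 (interior pyramid) p"
  unfolding in_H1_def
proof (intro conjI allI)
  obtain A where A: "\<And>x. x \<in> interior pyramid \<Longrightarrow> \<bar>p x\<bar> \<le> A"
    using U_space_bounded[OF p] interior_subset by (metis subsetD)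
  have cont: "continuous_on (interior pyramid) p"
    using continuous_on_U_space[OF p] interior_subset continuous_on_subset by blast
  show "in_L2 (interior pyramid) p"
    by (rule in_L2_bounded[OF open_interior bounded_interior_pyramid cont A])
  fix i
  obtain B where B: "\<And>x. x \<in> interior pyramid \<Longrightarrow> \<bar>partial i p x\<bar> \<le> B"
    using U_space_gradient(3)[OF p] by blast
  have "in_L2 (interior pyramid) (partial i p)"
    by (rule in_L2_bounded[OF open_interior bounded_interior_pyramid U_space_gradient(2)[OF p] B])
  moreover have "weak_partial (interior pyramid) i p (partial i p)"
    using U_space_gradient(1)[OF p] differentiable_def
    by (intro weak_partial_classical[OF open_interior bounded_interior_pyramid _ A U_space_gradient(2)[OF p] B]) blast+
  ultimately show "\<exists>g. in_L2 (interior pyramid) g \<and> weak_partial (interior pyramid) i p g" by blast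
qed

section \<open>The Dirichlet form\<close>

definition energy :: "scalar_field \<Rightarrow> scalar_field \<Rightarrow> real" where
  "energy p q = pyramid_integral (\<lambda>x. grad p x \<bullet> grad q x)"

lemma energy_sym: "energy p q = energy q p"
  by (simp add: energy_def inner_commute)

lemma grad_inner: "grad p x \<bullet> grad q x = (\<Sum>i\<in>UNIV. partial i p x * partial i q x)"
  by (simp add: grad_def inner_vec_def)

lemma energy_integrable:
  assumes p: "p \<in> U_space k" and q: "q \<in> U_space k"
  shows "set_integrable lebesgue (interior pyramid) (\<lambda>x. grad p x \<bullet> grad q x)"
    and "continuous_on (interior pyramid) (\<lambda>x. grad p x \<bullet> grad q x)"
proof -
  show cont: "continuous_on (interior pyramid) (\<lambda>x. grad p x \<bullet> grad q x)"
    unfolding grad_inner by (intro continuous_intros U_space_gradient(2)[OF p] U_space_gradient(2)[OF q])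
  obtain B C where B: "\<And>i x. x \<in> interior pyramid \<Longrightarrow> \<bar>partial i p x\<bar> \<le> B i"
    "\<And>i x. x \<in> interior pyramid \<Longrightarrow> \<bar>partial i q x\<bar> \<le> C i"
    using U_space_gradient(3)[OF p] U_space_gradient(3)[OF q] by metis
  show "set_integrable lebesgue (interior pyramid) (\<lambda>x. grad p x \<bullet> grad q x)"
  proof (rule set_integrable_lebesgue_bounded[OF open_interior bounded_interior_pyramid cont])
    fix x assume x: "x \<in> interior pyramid"
    have "\<bar>grad p x \<bullet> grad q x\<bar> \<le> (\<Sum>i\<in>UNIV. \<bar>partial i p x * partial i q x\<bar>)"
      unfolding grad_inner by (rule sum_abs)
    also have "\<dots> \<le> (\<Sum>i\<in>UNIV. B i * C i)"
      unfolding abs_mult using B(1)[OF x] B(2)[OF x]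
      by (intro sum_mono mult_mono) (auto intro: order_trans[OF abs_ge_zero])
    finally show "\<bar>grad p x \<bullet> grad q x\<bar> \<le> (\<Sum>i\<in>UNIV. B i * C i)" .
  qed
qed

text \<open>Restricted to interior points because the chosen Frechet derivative is linear only where
  the functions are differentiable.\<close>

lemma grad_linear:
  assumes "x \<in> interior pyramid" "p \<in> U_space k" "q \<in> U_space k"
  shows "grad (p + q) x = grad p x + grad q x" "grad (c *\<^sub>R p) x = c *\<^sub>R grad p x"
proof -
  note P = U_space_gradient(1)[OF assms(2,1)] and Q = U_space_gradient(1)[OF assms(3,1)]
  have "(p + q has_derivative (\<lambda>h. (\<Sum>i\<in>UNIV. partial i p x * h$i) + (\<Sum>i\<in>UNIV. partial i q x * h$i))) (at x)"
    unfolding plus_fun_def by (rule has_derivative_add[OF P Q])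
  from partial_has_derivative[OF this] show "grad (p + q) x = grad p x + grad q x"
    by (simp add: grad_def vec_eq_iff axis_def if_distrib cong: if_cong)
  have "(c *\<^sub>R p has_derivative (\<lambda>h. c *\<^sub>R (\<Sum>i\<in>UNIV. partial i p x * h$i))) (at x)"
    unfolding scaleR_fun_def[of c p] by (rule has_derivative_scaleR_right[OF P])
  from partial_has_derivative[OF this] show "grad (c *\<^sub>R p) x = c *\<^sub>R grad p x"
    by (simp add: grad_def vec_eq_iff axis_def if_distrib cong: if_cong)
qed

lemma energy_linear:
  assumes q: "q \<in> U_space k" shows "linear_functional_on (U_space k) (\<lambda>p. energy p q)"
  unfolding linear_functional_on_def
proof (intro conjI ballI allI)
  fix p r assume p: "p \<in> U_space k" and r: "r \<in> U_space k"
  have "energy (p + r) q = (LINT x:interior pyramid|lebesgue. grad p x \<bullet> grad q x + grad r x \<bullet> grad q x)"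
    unfolding energy_def pyramid_integral_def
    by (intro set_lebesgue_integral_cong) (auto simp: grad_linear[OF _ p r] inner_add_left)
  also have "\<dots> = energy p q + energy r q"
    unfolding energy_def pyramid_integral_def
    by (rule set_integral_add(2)[OF energy_integrable(1)[OF p q] energy_integrable(1)[OF r q]])
  finally show "energy (p + r) q = energy p q + energy r q" .
next
  fix p c assume p: "p \<in> U_space k"
  have "energy (c *\<^sub>R p) q = (LINT x:interior pyramid|lebesgue. c * (grad p x \<bullet> grad q x))"
    unfolding energy_def pyramid_integral_def
    by (intro set_lebesgue_integral_cong) (auto simp: grad_linear[OF _ p p])
  then show "energy (c *\<^sub>R p) q = c * energy p q"
    by (simp add: energy_def pyramid_integral_def)
qed

text \<open>The gradient vanishes on the open convex interior, so \<open>p\<close> is constant there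
  and, by continuity, on the whole pyramid. The boundary value at the apex fixes the constant as 0;
  outside, \<open>p\<close> is 0 as an extension by zero.\<close>

lemma energy_definite:
  assumes p: "p \<in> U_space k" and zero: "energy p p = 0" and boundary: "\<And>x. x \<in> frontier pyramid \<Longrightarrow> p x = 0"
  shows "p = 0"
proof -
  have grad0: "grad p x = 0" if "x \<in> interior pyramid" for x
  proof -
    have "grad p x \<bullet> grad p x = 0"
      using zero energy_integrable[OF p p] that unfolding energy_def pyramid_integral_def
      by (intro nonneg_set_integral_zero_interior[of "interior pyramid" "\<lambda>x. grad p x \<bullet> grad p x"]) auto
    then show ?thesis by simp
  qed
  have deriv0: "(p has_derivative (\<lambda>h. 0)) (at x)" if "x \<in> interior pyramid" for x
  proof -
    have "partial i p x = 0" for i using grad0[OF that] by (simp add: grad_def vec_eq_iff)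
    then show ?thesis using U_space_gradient(1)[OF p that] by simp
  qed
  have conv: "convex (interior pyramid)" using convex_pyramid by (rule convex_interior)
  then obtain c where c: "\<And>x. x \<in> interior pyramid \<Longrightarrow> p x = c"
    using has_derivative_zero_constant[OF conv, of p] deriv0 has_derivative_at_withinI by metis
  have ne: "interior pyramid \<noteq> {}"
  proof -
    have "vector [1/4, 1/4, 1/4] \<in> interior pyramid" by (simp add: interior_pyramid)
    then show ?thesis by blast
  qed
  then have cl: "closure (interior pyramid) = pyramid"
    using convex_closure_interior[OF convex_pyramid] compact_imp_closed[OF compact_pyramid] by simp
  have const: "p x = c" if "x \<in> pyramid" for x
    using continuous_constant_on_closure[of "interior pyramid" p c x] continuous_on_U_space[OF p] c that
    by (simp add: cl)
  have "apex \<in> frontier pyramid"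
    using apex_in_pyramid compact_imp_closed[OF compact_pyramid]
    by (simp add: frontier_def interior_pyramid apex_def)
  then have "c = 0" using boundary const[OF apex_in_pyramid] by simp
  moreover have "p x = 0" if "x \<notin> pyramid" for x
    using p that unfolding U_space_eq by (auto simp: ext0_def)
  ultimately show ?thesis using const by (auto simp: fun_eq_iff)
qed

section \<open>Traces on edges and faces\<close>

text \<open>The bases of weight functions are arbitrary, so their finiteness has to be derived: an
  independent set in the span of a finite set is finite. \<open>definite_form_solve\<close> relies
  on it.\<close>

lemma finite_basis:
  assumes "basis_of B V" "V \<subseteq> span T" "finite T"
  shows "finite B"
  using assms independent_span_bound[of T B] span_superset[of B] by (auto simp: basis_of_def)

lemma linear_ext0: "linear (ext0 A)"
  by (intro linearI) (auto simp: ext0_def fun_eq_iff scaleR_fun_def)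

lemma finite_monomials:
  "finite {\<lambda>p::point. p$1 ^ a * p$2 ^ b * p$3 ^ c | a b c. int a \<le> l \<and> int b \<le> m \<and> int c \<le> n}"
proof -
  have "{\<lambda>p::point. p$1 ^ a * p$2 ^ b * p$3 ^ c | a b c. int a \<le> l \<and> int b \<le> m \<and> int c \<le> n}
    \<subseteq> (\<lambda>(a, b, c) p. p$1 ^ a * p$2 ^ b * p$3 ^ c) ` ({..nat l} \<times> {..nat m} \<times> {..nat n})"
    by (force simp: image_iff)
  then show ?thesis by (rule finite_subset) simp
qed

lemma finite_basis_P_on:
  assumes "basis_of B (P_on n A)" shows "finite B"
proof (rule finite_basis[OF assms])
  let ?T = "{\<lambda>p::point. p$1 ^ a * p$2 ^ b * p$3 ^ c | a b c. int a \<le> n \<and> int b \<le> n \<and> int c \<le> n}"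
  have "P_poly n \<subseteq> span ?T" unfolding P_poly_def by (intro span_mono) force
  then show "P_on n A \<subseteq> span (ext0 A ` ?T)"
    unfolding P_on_def linear_span_image[OF linear_ext0, of A ?T] by (rule image_mono)
  show "finite (ext0 A ` ?T)" by (intro finite_imageI finite_monomials)
qed

lemma finite_basis_Q_base:
  assumes "basis_of B (Q_base m n)" shows "finite B"
proof (rule finite_basis[OF assms])
  let ?T = "{\<lambda>p::point. p$1 ^ a * p$2 ^ b * p$3 ^ c | a b c. int a \<le> m \<and> int b \<le> n \<and> int c \<le> 0}"
  show "Q_base m n \<subseteq> span (ext0 base ` ?T)"
    unfolding Q_base_def Q_poly_def linear_span_image[OF linear_ext0, of base ?T] by simp
  show "finite (ext0 base ` ?T)" by (intro finite_imageI finite_monomials)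
qed

lemma finite_basis_U0_space:
  assumes "basis_of B (U0_space k)" shows "finite B"
proof (rule finite_basis[OF assms])
  let ?S = "insert (\<lambda>p. p$3 ^ k) {pyr_monomial a b c d | a b c d. a \<le> k \<and> b \<le> k \<and> 1 \<le> d \<and> c + d \<le> k}"
  have "U0_space k \<subseteq> ext0 pyramid ` pyr_space k" by (auto simp: U0_space_def U_space_eq)
  then show "U0_space k \<subseteq> span (ext0 pyramid ` ?S)"
    unfolding pyr_space_def linear_span_image[OF linear_ext0] .
  have "{pyr_monomial a b c d | a b c d. a \<le> k \<and> b \<le> k \<and> 1 \<le> d \<and> c + d \<le> k}
    \<subseteq> (\<lambda>(a, b, c, d). pyr_monomial a b c d) ` ({..k} \<times> {..k} \<times> {..k} \<times> {..k})"
    by (force simp: image_iff)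
  then have "finite {pyr_monomial a b c d | a b c d. a \<le> k \<and> b \<le> k \<and> 1 \<le> d \<and> c + d \<le> k}"
    by (rule finite_subset) simp
  then have "finite ?S" by simp
  then show "finite (ext0 pyramid ` ?S)" by (rule finite_imageI)
qed

lemma subspace_P_on: "subspace (P_on n A)"
  unfolding P_on_def by (rule linear_subspace_image[OF linear_ext0 subspace_P_poly])

lemma subspace_Q_base: "subspace (Q_base m n)"
  unfolding Q_base_def by (rule linear_subspace_image[OF linear_ext0 subspace_Q_poly])

text \<open>An entity \<open>A = \<gamma> ` K\<close> of the pyramid with a bubble function \<open>w\<close> on its parameter domain.
  The pairing weighted by \<open>w\<close> is definite on the weight functions \<open>V\<close>; this gives both uniqueness
  (a trace \<open>w * q\<close> orthogonal to \<open>V\<close> vanishes) and existence (the Gram system is solvable).\<close>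

locale trace_entity =
  fixes K :: "'a::euclidean_space set" and \<gamma> :: "'a \<Rightarrow> point" and w :: "'a \<Rightarrow> real"
    and A :: "point set" and V B :: "scalar_field set" and C :: real and D :: "scalar_field \<Rightarrow> dof"
  assumes compact_K: "compact K" and K_closure: "K \<subseteq> closure (interior K)"
    and w_cont: "continuous_on K w" and w_nonneg: "\<And>x. x \<in> K \<Longrightarrow> 0 \<le> w x"
    and w_pos: "\<And>x. x \<in> interior K \<Longrightarrow> 0 < w x"
    and \<gamma>_cont: "continuous_on K \<gamma>" and \<gamma>_image: "\<gamma> ` K = A" and A_pyramid: "A \<subseteq> pyramid"
    and subspace_V: "subspace V" and V_cont: "\<And>q. q \<in> V \<Longrightarrow> continuous_on K (\<lambda>x. q (\<gamma> x))"
    and V_zero: "\<And>q y. q \<in> V \<Longrightarrow> y \<notin> A \<Longrightarrow> q y = 0"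
    and basis_B: "basis_of B V" and finite_B: "finite B"
    and C_nonzero: "C \<noteq> 0" and inj_D: "inj D"
    and eval_D: "\<And>q p. dof_eval (D q) p = C * (LINT x:K|lebesgue. p (\<gamma> x) * q (\<gamma> x))"
begin

lemma K_measurable: "K \<in> sets lebesgue"
  using compact_K lmeasurable_compact fmeasurableD by blast

lemma U_cont: "p \<in> U_space k \<Longrightarrow> continuous_on K (\<lambda>x. p (\<gamma> x))"
  using continuous_on_compose2[OF continuous_on_U_space \<gamma>_cont] \<gamma>_image A_pyramid by simp

lemma weighted_form_linear:
  assumes "\<And>p. p \<in> W \<Longrightarrow> continuous_on K (\<lambda>x. p (\<gamma> x))" "continuous_on K g"
  shows "linear_functional_on W (\<lambda>p. LINT x:K|lebesgue. p (\<gamma> x) * g x)"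
  unfolding linear_functional_on_def
proof (intro conjI ballI allI)
  fix p r assume "p \<in> W" "r \<in> W"
  then have "set_integrable lebesgue K (\<lambda>x. p (\<gamma> x) * g x)" "set_integrable lebesgue K (\<lambda>x. r (\<gamma> x) * g x)"
    using assms by (auto intro!: set_integrable_lebesgue_compact compact_K continuous_intros)
  from set_integral_add(2)[OF this]
  show "(LINT x:K|lebesgue. (p + r) (\<gamma> x) * g x)
    = (LINT x:K|lebesgue. p (\<gamma> x) * g x) + (LINT x:K|lebesgue. r (\<gamma> x) * g x)"
    by (simp add: distrib_right)
next
  fix p c
  show "(LINT x:K|lebesgue. (c *\<^sub>R p) (\<gamma> x) * g x) = c * (LINT x:K|lebesgue. p (\<gamma> x) * g x)"
    by (simp add: scaleR_fun_def mult.assoc)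
qed

lemma eval_linear:
  assumes "q \<in> B" shows "linear_functional_on (U_space k) (dof_eval (D q))"
proof -
  have "q \<in> V" using assms basis_B span_base by (auto simp: basis_of_def)
  then have "linear_functional_on (U_space k) (\<lambda>p. LINT x:K|lebesgue. p (\<gamma> x) * q (\<gamma> x))"
    by (intro weighted_form_linear U_cont V_cont)
  then show ?thesis
    unfolding linear_functional_on_def by (simp add: eval_D algebra_simps)
qed

text \<open>Vanishing moments pass from the basis \<open>B\<close> to its span \<open>V\<close>,
  which contains the cofactor \<open>q\<close> of the bubble. Testing with \<open>q\<close> gives a
  zero integral of \<open>w\<close> times a square.\<close>

lemma zero_on_entity:
  assumes p: "p \<in> U_space k" and zero: "\<And>q. q \<in> B \<Longrightarrow> dof_eval (D q) p = 0"
    and q: "q \<in> V" and bubble: "\<And>x. x \<in> K \<Longrightarrow> p (\<gamma> x) = w x * q (\<gamma> x)" and y: "y \<in> A"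
  shows "p y = 0"
proof -
  have lin: "linear_functional_on V (\<lambda>q. LINT x:K|lebesgue. q (\<gamma> x) * p (\<gamma> x))"
    by (intro weighted_form_linear V_cont U_cont[OF p])
  have B: "B \<subseteq> V" "q \<in> span B" using basis_B q span_superset by (auto simp: basis_of_def)
  have "(LINT x:K|lebesgue. b (\<gamma> x) * p (\<gamma> x)) = 0" if "b \<in> B" for b
    using zero[OF that] C_nonzero by (simp add: eval_D mult.commute)
  then have "(LINT x:K|lebesgue. q (\<gamma> x) * p (\<gamma> x)) = 0"
    by (rule linear_functional_on_span_zero[OF lin subspace_V B(1) _ B(2)])
  moreover have "(LINT x:K|lebesgue. q (\<gamma> x) * p (\<gamma> x)) = (LINT x:K|lebesgue. w x * q (\<gamma> x) * q (\<gamma> x))"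
    using bubble by (intro set_lebesgue_integral_cong K_measurable) auto
  ultimately have "(LINT x:K|lebesgue. w x * q (\<gamma> x) * q (\<gamma> x)) = 0" by simp
  from positive_weight_integral_zero[OF compact_K K_closure w_cont w_nonneg w_pos V_cont[OF q] this]
  have "q (\<gamma> x) = 0" if "x \<in> K" for x using that by blast
  then show ?thesis using y bubble \<gamma>_image by auto
qed

text \<open>Solving the Gram system of the \<open>w\<close>-weighted form on \<open>V\<close> gives
  a \<open>q\<close> whose bubble multiple has the required moments; by assumption that trace is
  attained in \<open>W\<close>. The constant \<open>C\<close> is the length or area factor and is
  divided out beforehand.\<close>

lemma entity_interpolates:
  assumes lift: "\<And>q. q \<in> V \<Longrightarrow> \<exists>u\<in>W. \<forall>x\<in>K. u (\<gamma> x) = w x * q (\<gamma> x)"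
  shows "interpolates W dof_eval (D ` B)"
  unfolding interpolates_def
proof
  fix c :: "dof \<Rightarrow> real"
  let ?b = "\<lambda>p q. LINT x:K|lebesgue. p (\<gamma> x) * (w x * q (\<gamma> x))"
  have lin1: "linear_functional_on V (\<lambda>p. ?b p q)" if "q \<in> V" for q
    using w_cont that by (intro weighted_form_linear V_cont continuous_intros)
  have sym: "?b p q = ?b q p" for p q by (simp add: mult_ac)
  have lin2: "linear_functional_on V (?b p)" if "p \<in> V" for p
    using lin1[OF that] by (subst sym[abs_def])
  \<comment> \<open>Weight functions are extensions by zero from \<open>A\<close>, so vanishing on
    \<open>A\<close> makes them zero as elements of \<open>V\<close>.\<close>
  have definite: "q = 0" if q: "q \<in> V" and zero: "?b q q = 0" for q
  proof -
    have "(LINT x:K|lebesgue. w x * q (\<gamma> x) * q (\<gamma> x)) = 0" using zero by (simp add: mult_ac)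
    from positive_weight_integral_zero[OF compact_K K_closure w_cont w_nonneg w_pos V_cont[OF q] this]
    have "q y = 0" if "y \<in> A" for y using that \<gamma>_image by blast
    then show ?thesis using V_zero[OF q] by (auto simp: fun_eq_iff)
  qed
  have B: "independent B" "B \<subseteq> V" "span B = V" using basis_B span_superset by (auto simp: basis_of_def)
  obtain q where q: "q \<in> V" "\<forall>b\<in>B. ?b q b = c (D b) / C"
    using definite_form_solve[of V ?b B "\<lambda>b. c (D b) / C", OF subspace_V lin1 lin2 definite finite_B B(1,2)] B(3)
    by blast
  obtain u where u: "u \<in> W" "\<And>x. x \<in> K \<Longrightarrow> u (\<gamma> x) = w x * q (\<gamma> x)" using lift[OF q(1)] by blast
  have "dof_eval (D b) u = c (D b)" if "b \<in> B" for b
  proof -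
    have "(LINT x:K|lebesgue. u (\<gamma> x) * b (\<gamma> x)) = ?b q b"
      using u(2) by (intro set_lebesgue_integral_cong K_measurable) auto
    then show ?thesis using q(2) that C_nonzero by (simp add: eval_D)
  qed
  then show "\<exists>u\<in>W. \<forall>m\<in>D ` B. dof_eval m u = c m" using u(1) by blast
qed

end

lemma P_on_cont:
  assumes "q \<in> P_on n A" "\<gamma> ` K \<subseteq> A" "continuous_on K \<gamma>"
  shows "continuous_on K (\<lambda>x. q (\<gamma> x))"
proof -
  obtain g where g: "g \<in> P_poly n" "q = ext0 A g" using assms(1) by (auto simp: P_on_def)
  have "continuous_on K (\<lambda>x. g (\<gamma> x))"
    using continuous_on_compose2[OF continuous_on_P_poly[OF g(1)] assms(3)] by blast
  then show ?thesis by (rule continuous_on_eq) (use assms(2) g in \<open>auto simp: ext0_def\<close>)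
qed

lemma edge_subset_triangle:
  "closed_segment (corner j) (corner (j + 1)) \<subseteq> triangle_set (tri j)"
  "closed_segment (corner j) apex \<subseteq> triangle_set (tri j)"
  "closed_segment (corner (j + 1)) apex \<subseteq> triangle_set (tri j)"
  unfolding tri_def triangle_set.simps segment_convex_hull by (intro hull_mono; blast)+

lemma edge_in_triangle:
  assumes "e \<in> edges" obtains j where "edge_set e \<subseteq> triangle_set (tri j)"
  using assms edge_subset_triangle unfolding edges_corner by (metis edge_set.simps)

lemma corner_distinct: "corner j \<noteq> corner (j + 1)" "corner j \<noteq> apex"
  by (cases j rule: mod4_cases; force simp: corner_def apex_def vec_eq_iff forall_3)+

lemma edge_trace_entity:
  assumes e: "(v, w) \<in> edges" and B: "basis_of B (P_on n (edge_set (v, w)))"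
  shows "trace_entity {0..1} (linepath v w) (\<lambda>t. t * (1 - t)) (edge_set (v, w))
    (P_on n (edge_set (v, w))) B (dist v w) (Edge_dof (v, w))"
proof
  show "linepath v w ` {0..1} = edge_set (v, w)" by (simp add: linepath_image_01)
  show "edge_set (v, w) \<subseteq> pyramid"
    using edge_in_triangle[OF e] triangle_set_subset_pyramid by blast
  show "finite B" using finite_basis_P_on B by blast
  show "dist v w \<noteq> 0" using e corner_distinct unfolding edges_corner by auto
  show "continuous_on {0..1} (\<lambda>x. q (linepath v w x))" if "q \<in> P_on n (edge_set (v, w))" for q
    using that by (rule P_on_cont) (auto simp: linepath_image_01)
  show "q y = 0" if "q \<in> P_on n (edge_set (v, w))" "y \<notin> edge_set (v, w)" for q y
    using that by (auto simp: P_on_def ext0_def)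
qed (use B in \<open>auto simp: subspace_P_on inj_def intro!: continuous_intros\<close>)

lemma unit_triangle_halfspaces:
  "unit_triangle = {x. (1, 0) \<bullet> x \<ge> 0} \<inter> {x. (0, 1) \<bullet> x \<ge> 0} \<inter> {x. (1, 1) \<bullet> x \<le> 1}"
  by (auto simp: unit_triangle_def inner_prod_def)

lemma interior_unit_triangle:
  "interior unit_triangle = {x. 0 < fst x \<and> 0 < snd x \<and> fst x + snd x < 1}"
proof -
  have "(1, 0) \<noteq> (0 :: real \<times> real)" "(0, 1) \<noteq> (0 :: real \<times> real)" "(1, 1) \<noteq> (0 :: real \<times> real)"
    by (simp_all add: zero_prod_def)
  note this[THEN interior_halfspace_ge] this[THEN interior_halfspace_le]
  then show ?thesis
    unfolding unit_triangle_halfspaces interior_Int by (simp only:) (auto simp: inner_prod_def)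
qed

lemma convex_unit_triangle: "convex unit_triangle"
  unfolding unit_triangle_halfspaces
  by (intro convex_Int convex_halfspace_le convex_halfspace_ge)

lemma compact_unit_triangle: "compact unit_triangle"
proof -
  have "closed unit_triangle"
    unfolding unit_triangle_halfspaces by (intro closed_Int closed_halfspace_le closed_halfspace_ge)
  moreover have "bounded ({0..1::real} \<times> {0..1::real})" by (intro bounded_Times bounded_closed_interval)
  then have "bounded unit_triangle" by (rule bounded_subset) (auto simp: unit_triangle_def)
  ultimately show ?thesis by (simp add: compact_eq_bounded_closed)
qed

abbreviation area_factor :: "nat \<Rightarrow> real" where
  "area_factor j \<equiv> norm (cross3 (corner (j + 1) - corner j) (apex - corner j))"

lemma cross3_triangle: "cross3 (corner (j + 1) - corner j) (apex - corner j) \<noteq> 0"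
  by (cases j rule: mod4_cases; force simp: corner_def apex_def cross3_def vec_eq_iff forall_3)

lemma triangle_trace_entity:
  assumes B: "basis_of B (P_on n (triangle_set (tri j)))"
  shows "trace_entity unit_triangle (tri_param j) triangle_bubble
    (triangle_set (tri j)) (P_on n (triangle_set (tri j))) B
    (area_factor j) (Triangle_dof (tri j))"
proof
  have "(1/4, 1/4) \<in> interior unit_triangle" by (simp add: interior_unit_triangle)
  then have "closure (interior unit_triangle) = closure unit_triangle"
    by (intro convex_closure_interior convex_unit_triangle) auto
  then show "unit_triangle \<subseteq> closure (interior unit_triangle)" using closure_subset by auto
  show \<gamma>: "continuous_on unit_triangle (tri_param j)"
    unfolding tri_param_def by (intro continuous_intros)
  show "triangle_set (tri j) \<subseteq> pyramid" by (rule triangle_set_subset_pyramid)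
  show "finite B" using finite_basis_P_on B by blast
  show "continuous_on unit_triangle (\<lambda>x. q (tri_param j x))" if "q \<in> P_on n (triangle_set (tri j))" for q
    using that by (rule P_on_cont) (auto simp: triangle_set_image \<gamma>)
  show "q y = 0" if "q \<in> P_on n (triangle_set (tri j))" "y \<notin> triangle_set (tri j)" for q y
    using that by (auto simp: P_on_def ext0_def)
  show "area_factor j \<noteq> 0"
    using cross3_triangle by simp
  show "dof_eval (Triangle_dof (tri j) q) p = area_factor j *
    (LINT x:unit_triangle|lebesgue. p (tri_param j x) * q (tri_param j x))" for p q
    by (simp add: tri_def tri_param_def unit_triangle_def)
  show "compact unit_triangle" by (rule compact_unit_triangle)
  show "tri_param j ` unit_triangle = triangle_set (tri j)" by (rule triangle_set_image[symmetric])
  show "0 \<le> triangle_bubble x" if "x \<in> unit_triangle" for x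
    using that by (auto simp: unit_triangle_def)
  show "0 < triangle_bubble x" if "x \<in> interior unit_triangle" for x
    using that by (auto simp: interior_unit_triangle)
qed (use B in \<open>auto simp: subspace_P_on inj_def simp del: triangle_set.simps intro!: continuous_intros\<close>)

definition base_param :: "real \<times> real \<Rightarrow> point" where
  "base_param x = vector [fst x, snd x, 0]"

lemma base_param_coords [simp]:
  "base_param x $ 1 = fst x" "base_param x $ 2 = snd x" "base_param x $ 3 = 0"
  by (simp_all add: base_param_def)

lemma base_image: "base_param ` ({0..1} \<times> {0..1}) = base"
proof (intro set_eqI iffI)
  fix p assume p: "p \<in> base"
  then have "p = base_param (p$1, p$2)" by (auto simp: vec_eq_iff forall_3 base_def)
  moreover have "(p$1, p$2) \<in> {0..1} \<times> {0..1}" using p by (auto simp: base_def pyramid_def)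
  ultimately show "p \<in> base_param ` ({0..1} \<times> {0..1})" by blast
qed (auto simp: base_def pyramid_def)

lemma continuous_on_base_param: "continuous_on A base_param"
proof -
  have eq: "base_param = (\<lambda>x. fst x *\<^sub>R axis 1 1 + snd x *\<^sub>R axis 2 1)"
    by (auto simp: fun_eq_iff vec_eq_iff forall_3 axis_def)
  show ?thesis unfolding eq by (intro continuous_intros)
qed

lemma base_trace_entity:
  assumes B: "basis_of B (Q_base m n)"
  shows "trace_entity ({0..1} \<times> {0..1}) base_param
    square_bubble base (Q_base m n) B 1 Base_dof"
proof
  show "compact ({0..1::real} \<times> {0..1::real})" by (intro compact_Times) auto
  show "finite B" using finite_basis_Q_base B by blast
  show "base \<subseteq> pyramid" by (auto simp: base_def)
  show "base_param ` ({0..1} \<times> {0..1}) = base" by (rule base_image)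
  show "continuous_on ({0..1} \<times> {0..1}) (\<lambda>x. q (base_param x))" if q: "q \<in> Q_base m n" for q
  proof -
    obtain g where g: "g \<in> Q_poly m n 0" "q = ext0 base g" using q by (auto simp: Q_base_def)
    have "continuous_on ({0..1} \<times> {0..1}) (\<lambda>x. g (base_param x))"
      using continuous_on_compose2[OF continuous_on_Q_poly[OF g(1)] continuous_on_base_param] by blast
    then show ?thesis by (rule continuous_on_eq) (use base_image g in \<open>auto simp: ext0_def\<close>)
  qed
  show "q y = 0" if "q \<in> Q_base m n" "y \<notin> base" for q y
    using that by (auto simp: Q_base_def ext0_def)
  show "dof_eval (Base_dof q) p = 1 * (LINT x:{0..1} \<times> {0..1}|lebesgue. p (base_param x) * q (base_param x))" for p q
    by (simp add: base_integral_def base_param_def)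
qed (use B in \<open>auto simp: subspace_Q_base inj_def interior_Times closure_Times
    intro!: continuous_intros continuous_on_base_param\<close>)

lemma set_integral_zero:
  assumes "\<And>x. x \<in> K \<Longrightarrow> f x = 0" shows "(LINT x:K|M. f x) = (0::real)"
proof -
  have "(\<lambda>x. indicator K x *\<^sub>R f x) = (\<lambda>x. 0)" using assms by (auto simp: indicator_def fun_eq_iff)
  then show ?thesis by (simp add: set_lebesgue_integral_def)
qed

text \<open>Every functional except the volume ones depends only on the values of \<open>p\<close>
  on its entity; the volume ones integrate gradients.\<close>

lemma dof_eval_zero:
  assumes "\<And>y. y \<in> dof_entity m \<Longrightarrow> p y = 0" and "\<And>q. m \<noteq> Volume_dof q"
  shows "dof_eval m p = 0"
proof (cases m)
  case (Vertex_dof v)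
  then show ?thesis using assms by simp
next
  case (Edge_dof e q)
  obtain v w where "e = (v, w)" by (cases e)
  then show ?thesis using assms(1) Edge_dof
    by (auto simp: linepath_in_path intro!: set_integral_zero disjI2)
next
  case (Triangle_dof s q)
  obtain a b c where s: "s = (a, b, c)" by (cases s)
  have "p (a + u *\<^sub>R (b - a) + v *\<^sub>R (c - a)) = 0" if "0 \<le> u" "0 \<le> v" "u + v \<le> 1" for u v
    using assms(1) Triangle_dof s that by (auto simp: convex_hull_3_alt)
  then show ?thesis using Triangle_dof s by (auto intro!: set_integral_zero disjI2)
next
  case (Base_dof q)
  have "p (base_param x) = 0" if "x \<in> {0..1} \<times> {0..1}" for x
    using assms(1) Base_dof base_image that by auto
  then have "(LINT x:{0..1} \<times> {0..1}|lebesgue. p (base_param x) * q (base_param x)) = 0"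
    by (intro set_integral_zero) simp
  then show ?thesis by (simp add: Base_dof base_integral_def base_param_def)
next
  case (Volume_dof q)
  then show ?thesis using assms(2) by blast
qed

section \<open>Vanishing degrees of freedom force vanishing traces\<close>

lemma linepath_P2_poly: "(\<lambda>x. linepath v w (snd x) $ i) \<in> P2_poly 1"
proof -
  have "(\<lambda>x. v$i + (w$i - v$i) * snd x) \<in> P2_poly 1"
    by (intro subspace_pointwise(2,4)[OF subspace_P2_poly] P2_poly_const P2_poly_coord) auto
  then show ?thesis by (simp add: linepath_def algebra_simps)
qed

text \<open>Each edge lies in a triangle, so the trace is a polynomial of degree at most k in the
  edge parameter. Zero end values split off \<open>t * (1 - t)\<close> and leave degree at most k -
  2, the degree of the weight functions.\<close>

lemma U_space_edge_zero:
  assumes p: "p \<in> U_space k" and e: "(v, w) \<in> edges"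
    and B: "basis_of B (P_on (int k - 2) (edge_set (v, w)))"
    and ends: "p v = 0" "p w = 0"
    and zero: "\<And>q. q \<in> B \<Longrightarrow> dof_eval (Edge_dof (v, w) q) p = 0"
    and y: "y \<in> edge_set (v, w)"
  shows "p y = 0"
proof -
  interpret trace_entity "{0..1}" "linepath v w" "\<lambda>t. t * (1 - t)" "edge_set (v, w)"
    "P_on (int k - 2) (edge_set (v, w))" B "dist v w" "Edge_dof (v, w)"
    by (rule edge_trace_entity[OF e B])
  obtain j where j: "edge_set (v, w) \<subseteq> triangle_set (tri j)" using edge_in_triangle[OF e] .
  obtain G where G: "G \<in> P_poly (int k)" "\<And>x. x \<in> triangle_set (tri j) \<Longrightarrow> p x = G x"
    using U_space_triangle[OF p] by blast
  have pG: "p x = G x" if "x \<in> edge_set (v, w)" for x using G(2) j that by blast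
  have "(\<lambda>x. G (linepath v w (snd x))) \<in> P2_poly (int k)"
    by (rule P_poly_compose_P2[OF G(1) linepath_P2_poly])
  moreover have "G (linepath v w 0) = 0" "G (linepath v w 1) = 0"
    using pG[of v] pG[of w] ends by (auto simp: linepath_0' linepath_1')
  ultimately obtain r where r: "(\<lambda>x. r (snd x)) \<in> P2_poly (int k - 2)"
    "\<And>t. G (linepath v w t) = t * (1 - t) * r t"
    using P2_poly_interval_bubble[of "\<lambda>t. G (linepath v w t)"] by blast
  define c where "c = (w - v) \<bullet> (w - v)"
  have c: "c \<noteq> 0" using C_nonzero by (simp add: c_def)
  \<comment> \<open>Orthogonal projection to the line of the edge: an affine function of the point
    that returns the parameter \<open>t\<close>, so the cofactor becomes an ambient polynomial of
    the same degree.\<close>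
  define l where "l x = (x - v) \<bullet> (w - v) / c" for x
  have l_eq: "l = (\<lambda>x. (\<Sum>i\<in>UNIV. ((w - v) $ i / c) * x $ i) - v \<bullet> (w - v) / c)"
  proof
    fix x
    have "x \<bullet> (w - v) = (\<Sum>i\<in>UNIV. (w - v) $ i * x $ i)" by (simp add: inner_vec_def mult.commute)
    then show "l x = (\<Sum>i\<in>UNIV. ((w - v) $ i / c) * x $ i) - v \<bullet> (w - v) / c"
      by (simp only: l_def inner_diff_left diff_divide_distrib sum_divide_distrib times_divide_eq_left)
  qed
  have "l \<in> P_poly 1"
    unfolding l_eq
    by (intro subspace_pointwise(3)[OF subspace_P_poly] subspace_pointwise_sum subspace_P_poly
        subspace_pointwise(4)[OF subspace_P_poly] P_poly_coord P_poly_const) auto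
  then have "(\<lambda>x. r (l x)) \<in> P_poly (int k - 2)"
    using P2_poly_compose_P[OF r(1) P_poly_const[of 1 0]] by simp
  then have "ext0 (edge_set (v, w)) (\<lambda>x. r (l x)) \<in> P_on (int k - 2) (edge_set (v, w))"
    by (simp add: P_on_def)
  moreover have "p (linepath v w t) = t * (1 - t) * ext0 (edge_set (v, w)) (\<lambda>x. r (l x)) (linepath v w t)"
    if t: "t \<in> {0..1}" for t
  proof -
    have m: "linepath v w t \<in> edge_set (v, w)" using t by (simp add: linepath_in_path)
    have "linepath v w t - v = t *\<^sub>R (w - v)" by (simp add: linepath_def algebra_simps)
    then have "l (linepath v w t) = t" using c by (simp add: l_def c_def)
    then show ?thesis using m pG[OF m] r(2)[of t] by (simp add: ext0_def)
  qed
  ultimately show ?thesis using zero_on_entity[OF p zero _ _ y] by blast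
qed

lemma tri_param_edges:
  "tri_param j (s, 0) = linepath (corner j) (corner (j + 1)) s"
  "tri_param j (0, s) = linepath (corner j) apex s"
  "tri_param j (1 - s, s) = linepath (corner (j + 1)) apex s"
  by (simp_all add: tri_param_def linepath_def algebra_simps)

lemma U_space_triangle_zero:
  assumes p: "p \<in> U_space k"
    and B: "basis_of B (P_on (int k - 3) (triangle_set (tri j)))"
    and edges: "\<And>t. 0 < t \<Longrightarrow> t < 1 \<Longrightarrow> p (linepath (corner j) (corner (j + 1)) t) = 0"
      "\<And>t. 0 < t \<Longrightarrow> t < 1 \<Longrightarrow> p (linepath (corner j) apex t) = 0"
      "\<And>t. 0 < t \<Longrightarrow> t < 1 \<Longrightarrow> p (linepath (corner (j + 1)) apex t) = 0"
    and zero: "\<And>q. q \<in> B \<Longrightarrow> dof_eval (Triangle_dof (tri j) q) p = 0"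
    and y: "y \<in> triangle_set (tri j)"
  shows "p y = 0"
proof -
  interpret trace_entity unit_triangle "tri_param j" triangle_bubble
    "triangle_set (tri j)" "P_on (int k - 3) (triangle_set (tri j))" B
    "area_factor j" "Triangle_dof (tri j)"
    by (rule triangle_trace_entity[OF B])
  obtain G where G: "G \<in> P_poly (int k)" "\<And>x. x \<in> triangle_set (tri j) \<Longrightarrow> p x = G x"
    using U_space_triangle[OF p] by blast
  have pG: "G (tri_param j x) = p (tri_param j x)" if "x \<in> unit_triangle" for x
    using G(2) \<gamma>_image that by (metis imageI)
  have "(\<lambda>x. G (tri_param j x)) \<in> P2_poly (int k)"
    by (rule P_poly_compose_P2[OF G(1) tri_param_P2])
  moreover have "G (tri_param j (s, 0)) = 0" if "0 < s" "s < 1" for s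
    using pG[of "(s, 0)"] edges(1)[OF that] that by (simp only: tri_param_edges) (simp add: unit_triangle_def)
  moreover have "G (tri_param j (0, s)) = 0" if "0 < s" "s < 1" for s
    using pG[of "(0, s)"] edges(2)[OF that] that by (simp only: tri_param_edges) (simp add: unit_triangle_def)
  moreover have "G (tri_param j (s, 1 - s)) = 0" if "0 < s" "s < 1" for s
    using pG[of "(s, 1 - s)"] edges(3)[of "1 - s"] tri_param_edges(3)[of j "1 - s"] that
    by (simp add: unit_triangle_def)
  ultimately obtain r where r: "r \<in> P2_poly (int k - 3)"
    "\<And>x. G (tri_param j x) = triangle_bubble x * r x"
    using P2_poly_triangle_bubble[of "\<lambda>x. G (tri_param j x)" "int k"] by blast
  \<comment> \<open>The inverse of the parametrisation is affine, so this is a weight function of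
    degree at most k - 3.\<close>
  let ?q = "ext0 (triangle_set (tri j)) (\<lambda>x. r (bar (j + 1) x, x $ 3))"
  have "(\<lambda>x. r (bar (j + 1) x, x $ 3)) \<in> P_poly (int k - 3)"
    by (intro P2_poly_compose_P[OF r(1) bar_P_poly] P_poly_coord) simp
  then have "?q \<in> P_on (int k - 3) (triangle_set (tri j))" by (simp add: P_on_def)
  moreover have "p (tri_param j x) = triangle_bubble x * ?q (tri_param j x)"
    if x: "x \<in> unit_triangle" for x
  proof -
    have "tri_param j x \<in> triangle_set (tri j)" using x \<gamma>_image by blast
    then show ?thesis using pG[OF x] r(2)[of x] tri_param_coords[of j x] by (simp add: ext0_def)
  qed
  ultimately show ?thesis using zero_on_entity[OF p zero _ _ y] by blast
qed

lemma base_param_edges: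
  "base_param (s, 0) = linepath (corner 0) (corner 1) s"
  "base_param (1, s) = linepath (corner 1) (corner 2) s"
  "base_param (s, 1) = linepath (corner 2) (corner 3) (1 - s)"
  "base_param (0, s) = linepath (corner 3) (corner 0) (1 - s)"
  by (simp_all add: vec_eq_iff forall_3 linepath_def corner_def)

lemma corner_3: "corner j $ 3 = 0"
  by (simp add: corner_def)

lemma base_edge_subset: "closed_segment (corner j) (corner (j + 1)) \<subseteq> base"
proof
  fix x assume x: "x \<in> closed_segment (corner j) (corner (j + 1))"
  then have "x \<in> pyramid" using edge_subset_triangle(1) triangle_set_subset_pyramid by blast
  moreover have "x $ 3 = 0" using x by (auto simp: closed_segment_def corner_3)
  ultimately show "x \<in> base" by (simp add: base_def)
qed

lemma U_space_base_zero:
  assumes p: "p \<in> U_space k" and k: "k \<ge> 1"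
    and B: "basis_of B (Q_base (int k - 2) (int k - 2))"
    and edges: "\<And>j t. 0 < t \<Longrightarrow> t < 1 \<Longrightarrow> p (linepath (corner j) (corner (j + 1)) t) = 0"
    and zero: "\<And>q. q \<in> B \<Longrightarrow> dof_eval (Base_dof q) p = 0"
    and y: "y \<in> base"
  shows "p y = 0"
proof -
  interpret trace_entity "{0..1} \<times> {0..1}" base_param
    square_bubble base "Q_base (int k - 2) (int k - 2)" B 1 Base_dof
    by (rule base_trace_entity[OF B])
  obtain G where G: "G \<in> Q2_poly (int k) (int k)" "\<And>x. x \<in> base \<Longrightarrow> p x = G (x$1, x$2)"
    using U_space_base[OF p k] by blast
  have pG: "G x = p (base_param x)" if "x \<in> {0..1} \<times> {0..1}" for x
  proof -
    have "base_param x \<in> base" using that \<gamma>_image by blast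
    then show ?thesis using G(2)[of "base_param x"] by simp
  qed
  \<comment> \<open>The fourth base edge runs from \<open>corner 3\<close> to
    \<open>corner 4\<close>, which is \<open>corner 0\<close> again.\<close>
  have c0: "corner (Suc (Suc (Suc (Suc 0)))) = corner 0" by (simp add: corner_def)
  have G0: "G (s, 0) = 0" "G (1, s) = 0" "G (s, 1) = 0" "G (0, s) = 0" if s: "0 < s" "s < 1" for s
    using s pG[of "(s, 0)"] pG[of "(1, s)"] pG[of "(s, 1)"] pG[of "(0, s)"]
      edges[of s 0] edges[of s 1] edges[of "1 - s" 2] edges[of "1 - s" 3]
    by (simp_all add: base_param_edges c0 numeral_2_eq_2 numeral_3_eq_3)
  obtain r where r: "r \<in> Q2_poly (int k - 2) (int k - 2)"
    "\<And>x. G x = square_bubble x * r x"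
    using Q2_poly_square_bubble[OF G(1) G0(1) G0(3) G0(4) G0(2)] by blast
  have "ext0 base (\<lambda>x. r (x$1, x$2)) \<in> Q_base (int k - 2) (int k - 2)"
    unfolding Q_base_def by (intro imageI Q2_poly_compose_Q r(1))
  moreover have "p (base_param x) = square_bubble x *
      ext0 base (\<lambda>x. r (x$1, x$2)) (base_param x)" if x: "x \<in> {0..1} \<times> {0..1}" for x
  proof -
    have "base_param x \<in> base" using x \<gamma>_image by blast
    then show ?thesis using pG[OF x] r(2)[of x] by (simp add: ext0_def)
  qed
  ultimately show ?thesis using zero_on_entity[OF p zero _ _ y] by blast
qed

section \<open>Functions with prescribed traces\<close>

lemma corner_around:
  "\<exists>m\<in>{0, 1, 2, 3}. corner i = corner (j + m) \<and> corner (i + 1) = corner (j + m + 1)"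
proof
  \<comment> \<open>The cyclic distance from \<open>j\<close> to \<open>i\<close>, with
    \<open>3 * j\<close> in place of \<open>- j\<close> modulo 4.\<close>
  let ?m = "(i + 3 * j) mod 4"
  have "(j + ?m) mod 4 = (4 * j + i) mod 4" by (simp add: mod_add_right_eq algebra_simps)
  then have m: "i mod 4 = (j + ?m) mod 4" by simp
  then have "(i + 1) mod 4 = (j + ?m + 1) mod 4" by (rule mod_add_cong) simp
  with m show "corner i = corner (j + ?m) \<and> corner (i + 1) = corner (j + ?m + 1)"
    by (intro conjI corner_mod)
  have "?m < 4" by simp
  then show "?m \<in> {0, 1, 2, 3}" by (simp only: insert_iff empty_iff) linarith
qed

lemma corner_plus_4: "corner (j + 4) = corner j"
  by (rule corner_mod) simp

text \<open>On these three triangles \<open>lift j r\<close> vanishes once \<open>r\<close> is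
  divisible by its first argument, so such a function is zero on all edges but the base edge of
  triangle \<open>j\<close>.\<close>

lemma edges_except_base_edge:
  assumes "e \<in> edges" "e \<noteq> (corner j, corner (j + 1))"
  shows "\<exists>m\<in>{1, 2, 3}. edge_set e \<subseteq> triangle_set (tri (j + m))"
proof -
  obtain i where "e = (corner i, corner (i + 1)) \<or> e = (corner i, apex)"
    using assms(1) edges_corner by blast
  then obtain m where m: "m \<in> {0, 1, 2, 3}"
    "e = (corner (j + m), corner (j + m + 1)) \<or> e = (corner (j + m), apex)"
    using corner_around[of i j] by metis
  have "corner (j + 3 + 1) = corner j"
    using corner_plus_4[of j] by (simp only: add.assoc) simp
  then have "edge_set (corner j, apex) \<subseteq> triangle_set (tri (j + 3))"
    using edge_subset_triangle(3)[of "j + 3"] by (simp del: triangle_set.simps)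
  moreover have "edge_set e \<subseteq> triangle_set (tri (j + m))"
    using m(2) edge_subset_triangle(1,2)[of "j + m"] by (auto simp del: triangle_set.simps)
  ultimately show ?thesis using m assms(2) by auto
qed

text \<open>On this union \<open>lift j r\<close> vanishes once \<open>r\<close> is divisible by its
  second argument, which is the height and hence 0 on the base.\<close>

lemma edges_except_vertical_edge:
  assumes "e \<in> edges" "e \<noteq> (corner j, apex)"
  shows "edge_set e \<subseteq> triangle_set (tri (j + 1)) \<union> triangle_set (tri (j + 2)) \<union> base"
proof -
  obtain i where "e = (corner i, corner (i + 1)) \<or> e = (corner i, apex)"
    using assms(1) edges_corner by blast
  then obtain m where m: "m \<in> {0, 1, 2, 3}"
    "e = (corner (j + m), corner (j + m + 1)) \<or> e = (corner (j + m), apex)"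
    using corner_around[of i j] by metis
  from m(2) show ?thesis
  proof
    assume "e = (corner (j + m), corner (j + m + 1))"
    then show ?thesis using base_edge_subset[of "j + m"] by auto
  next
    assume e: "e = (corner (j + m), apex)"
    have j3: "j + 2 + 1 = j + 3" by simp
    have "closed_segment (corner (j + 3)) apex \<subseteq> triangle_set (tri (j + 2))"
      using edge_subset_triangle(3)[of "j + 2"] by (simp only: j3)
    then show ?thesis using e m(1) assms(2) edge_subset_triangle(2)[of "j + 1"] edge_subset_triangle(2)[of "j + 2"]
      by (auto simp del: triangle_set.simps)
  qed
qed

lemma ext0_lift_triangle:
  "x \<in> triangle_set (tri j) \<Longrightarrow> ext0 pyramid (lift j r) x = bar (j + 3) x * r (bar (j + 1) x, x$3)"
  "x \<in> triangle_set (tri (j + 3)) \<Longrightarrow> ext0 pyramid (lift j r) x = bar j x * r (0, x$3)"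
  "x \<in> triangle_set (tri (j + 1)) \<Longrightarrow> ext0 pyramid (lift j r) x = 0"
  "x \<in> triangle_set (tri (j + 2)) \<Longrightarrow> ext0 pyramid (lift j r) x = 0"
  using lift_triangle[of x j r] triangle_set_subset_pyramid by (auto simp: ext0_def simp del: triangle_set.simps)

lemma ext0_lift_param:
  assumes "x \<in> unit_triangle"
  shows "ext0 pyramid (lift j r) (tri_param j x) = (1 - fst x - snd x) * r x"
proof -
  have "tri_param j x \<in> triangle_set (tri j)" using assms triangle_set_image by blast
  from ext0_lift_triangle(1)[OF this, of r] show ?thesis
    using tri_param_coords[of j x] tri_param_bar[of j x] by simp
qed

lemma vertices_on_edges:
  assumes "v \<in> vertices" obtains e where "e \<in> edges" "v = fst e \<or> v = snd e"
proof (cases "v = apex")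
  case True
  then show ?thesis using that[of "(corner 0, apex)"] edges_corner by auto
next
  case False
  then obtain j where "v = corner j" using assms vertices_corner by blast
  then show ?thesis using that[of "(corner j, apex)"] edges_corner by auto
qed

lemma edge_lift:
  assumes e: "e \<in> edges" and q: "q \<in> P_on (int k - 2) (edge_set e)"
  obtains u where "u \<in> U_space k"
    "\<And>t. t \<in> {0..1} \<Longrightarrow> u (linepath (fst e) (snd e) t) = t * (1 - t) * q (linepath (fst e) (snd e) t)"
    "\<And>e' y. e' \<in> edges - {e} \<Longrightarrow> y \<in> edge_set e' \<Longrightarrow> u y = 0"
proof -
  obtain g where g: "g \<in> P_poly (int k - 2)" "q = ext0 (edge_set e) g" using q by (auto simp: P_on_def)
  have qg: "q (linepath (fst e) (snd e) t) = g (linepath (fst e) (snd e) t)" if "t \<in> {0..1}" for t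
    using that g(2) by (cases e) (simp add: ext0_def linepath_in_path)
  have gP: "(\<lambda>x. g (linepath v w (snd x))) \<in> P2_poly (int k - 2)" for v w
    by (rule P_poly_compose_P2[OF g(1) linepath_P2_poly])
  obtain j where "e = (corner j, corner (j + 1)) \<or> e = (corner j, apex)" using e edges_corner by blast
  then show thesis
  proof
    assume ej: "e = (corner j, corner (j + 1))"
    \<comment> \<open>The factor \<open>fst x\<close> removes the trace on triangle
      \<open>j + 3\<close> and supplies \<open>t\<close>; the trace of \<open>lift\<close> on
      triangle \<open>j\<close> supplies \<open>1 - t\<close>. The degree is 1 + (k - 2), just what
      \<open>lift\<close> admits.\<close>
    let ?r = "\<lambda>x. fst x * g (linepath (corner j) (corner (j + 1)) (fst x))"
    have "(\<lambda>x. g (linepath (corner j) (corner (j + 1)) (fst x))) \<in> P2_poly (int k - 2)"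
      using P2_poly_compose[OF gP P2_poly_coord(2,1)] by simp
    then have "?r \<in> P2_poly (1 + (int k - 2))" by (intro P2_poly_mult P2_poly_coord) auto
    then have "ext0 pyramid (lift j ?r) \<in> U_space k" by (intro lift_U_space) (simp add: algebra_simps)
    then show thesis
    proof (rule that)
      fix t :: real assume t: "t \<in> {0..1}"
      then have "(t, 0) \<in> unit_triangle" by (auto simp: unit_triangle_def)
      from ext0_lift_param[OF this, of j ?r] show "ext0 pyramid (lift j ?r) (linepath (fst e) (snd e) t)
          = t * (1 - t) * q (linepath (fst e) (snd e) t)"
        unfolding qg[OF t] by (simp add: ej tri_param_edges(1)[simplified])
    next
      fix e' y assume e': "e' \<in> edges - {e}" and y: "y \<in> edge_set e'"
      then obtain m where "m \<in> {1, 2, 3}" "y \<in> triangle_set (tri (j + m))"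
        using edges_except_base_edge[of e' j] ej by blast
      then show "ext0 pyramid (lift j ?r) y = 0"
        using ext0_lift_triangle(2-4)[of y j ?r] by (auto simp del: triangle_set.simps)
    qed
  next
    assume ej: "e = (corner j, apex)"
    \<comment> \<open>The factor \<open>snd x\<close> makes the function vanish on the base and
      supplies \<open>t\<close>. The trace on triangle \<open>j + 3\<close> may remain, since no
      other vertical edge relies on that triangle.\<close>
    let ?r = "\<lambda>x. snd x * g (linepath (corner j) apex (snd x))"
    have "?r \<in> P2_poly (1 + (int k - 2))" by (intro P2_poly_mult P2_poly_coord gP) auto
    then have "ext0 pyramid (lift j ?r) \<in> U_space k" by (intro lift_U_space) (simp add: algebra_simps)
    then show thesis
    proof (rule that)
      fix t :: real assume t: "t \<in> {0..1}"
      then have "(0, t) \<in> unit_triangle" by (auto simp: unit_triangle_def)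
      from ext0_lift_param[OF this, of j ?r] show "ext0 pyramid (lift j ?r) (linepath (fst e) (snd e) t)
          = t * (1 - t) * q (linepath (fst e) (snd e) t)"
        unfolding qg[OF t] by (simp add: ej tri_param_edges(2))
    next
      fix e' y assume e': "e' \<in> edges - {e}" and y: "y \<in> edge_set e'"
      then consider "y \<in> triangle_set (tri (j + 1))" | "y \<in> triangle_set (tri (j + 2))" | "y \<in> base"
        using edges_except_vertical_edge[of e' j] ej by blast
      then show "ext0 pyramid (lift j ?r) y = 0"
      proof cases
        case 3
        then show ?thesis by (simp add: base_def ext0_def lift_def)
      qed (simp_all only: ext0_lift_triangle)
    qed
  qed
qed

lemma triangle_lift:
  assumes q: "q \<in> P_on (int k - 3) (triangle_set (tri j))"
  obtains u where "u \<in> U_space k"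
    "\<And>x. x \<in> unit_triangle \<Longrightarrow>
      u (tri_param j x) = triangle_bubble x * q (tri_param j x)"
    "\<And>s y. s \<in> triangles - {tri j} \<Longrightarrow> y \<in> triangle_set s \<Longrightarrow> u y = 0"
    "\<And>e y. e \<in> edges \<Longrightarrow> y \<in> edge_set e \<Longrightarrow> u y = 0"
proof -
  obtain g where g: "g \<in> P_poly (int k - 3)" "q = ext0 (triangle_set (tri j)) g"
    using q by (auto simp: P_on_def)
  \<comment> \<open>The factors \<open>fst x\<close> and \<open>snd x\<close> remove the traces on
    triangle \<open>j + 3\<close> and on the base. With the factor \<open>1 - fst x - snd x\<close>
    from \<open>lift\<close> they form the triangle bubble, and the degree is 2 + (k - 3).\<close>
  let ?r = "\<lambda>x. fst x * (snd x * g (tri_param j x))"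
  have "?r \<in> P2_poly (1 + (1 + (int k - 3)))"
    by (intro P2_poly_mult P2_poly_coord P_poly_compose_P2[OF g(1) tri_param_P2]) auto
  then have "ext0 pyramid (lift j ?r) \<in> U_space k" by (intro lift_U_space) (simp add: algebra_simps)
  moreover have "ext0 pyramid (lift j ?r) (tri_param j x)
      = triangle_bubble x * q (tri_param j x)" if x: "x \<in> unit_triangle" for x
  proof -
    have "tri_param j x \<in> triangle_set (tri j)" using x triangle_set_image by blast
    then show ?thesis using ext0_lift_param[OF x, of j ?r] g(2) by (simp add: ext0_def)
  qed
  moreover have z: "ext0 pyramid (lift j ?r) y = 0" if "m \<in> {1, 2, 3}" "y \<in> triangle_set (tri (j + m))" for m y
    using that ext0_lift_triangle(2-4)[of y j ?r] by (auto simp del: triangle_set.simps)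
  moreover have "ext0 pyramid (lift j ?r) y = 0" if s: "s \<in> triangles - {tri j}" and y: "y \<in> triangle_set s" for s y
  proof -
    have "\<exists>m\<in>{1, 2, 3}. s = tri (j + m)"
      using s unfolding triangles_from[of j] by auto
    then show ?thesis using z y by blast
  qed
  moreover have "ext0 pyramid (lift j ?r) y = 0" if "e \<in> edges" "y \<in> edge_set e" for e y
  proof (cases "e = (corner j, corner (j + 1))")
    case True
    then have "y \<in> base" using that(2) base_edge_subset[of j] by auto
    then show ?thesis by (simp add: base_def ext0_def lift_def)
  next
    case False
    then show ?thesis using edges_except_base_edge[OF that(1)] that(2) z by blast
  qed
  ultimately show thesis using that[of "ext0 pyramid (lift j ?r)"] by blast
qed

lemma base_lift_exists:
  assumes q: "q \<in> Q_base (int k - 2) (int k - 2)" and k: "k \<ge> 1"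
  obtains u where "u \<in> U_space k"
    "\<And>x. x \<in> {0..1} \<times> {0..1} \<Longrightarrow>
      u (base_param x) = square_bubble x * q (base_param x)"
    "\<And>s y. s \<in> triangles \<Longrightarrow> y \<in> triangle_set s \<Longrightarrow> u y = 0"
proof -
  obtain g where g: "g \<in> Q_poly (int k - 2) (int k - 2) 0" "q = ext0 base g"
    using q by (auto simp: Q_base_def)
  let ?r = "\<lambda>x. g (base_param x)"
  have r: "?r \<in> Q2_poly (int k - 2) (int k - 2)"
    using Q_poly_compose_Q2[OF g(1)] by (simp add: base_param_def)
  show thesis
  proof (rule that[OF base_lift_U_space[OF r k]])
    fix x :: "real \<times> real" assume x: "x \<in> {0..1} \<times> {0..1}"
    then have "base_param x \<in> base" using base_image by blast
    then show "ext0 pyramid (base_lift ?r) (base_param x)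
        = square_bubble x * q (base_param x)"
      by (simp add: ext0_def base_lift_def g(2)) (simp add: base_def)
  next
    fix s y assume "s \<in> triangles" "y \<in> triangle_set s"
    then show "ext0 pyramid (base_lift ?r) y = 0"
      using base_lift_triangle unfolding triangles_tri by (auto simp: ext0_def simp del: triangle_set.simps)
  qed
qed

text \<open>For a base corner \<open>lift j\<close> of the constant 1 serves, because all other
  vertices lie on triangles \<open>j + 1\<close> and \<open>j + 2\<close>, where it vanishes. For
  the apex the power \<open>p$3 ^ k\<close> serves, as \<open>k >= 1\<close> makes it zero at the
  corners.\<close>

lemma vertex_function:
  assumes v: "v \<in> vertices" and k: "k \<ge> 1"
  obtains u where "u \<in> U_space k" "u v = 1" "\<And>v'. v' \<in> vertices - {v} \<Longrightarrow> u v' = 0"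
proof (cases "v = apex")
  case True
  show thesis
  proof (rule that[OF apex_function_U_space])
    show "ext0 pyramid (\<lambda>p. p$3 ^ k) v = 1"
      using apex_in_pyramid by (simp add: True ext0_def) (simp add: apex_def)
    show "ext0 pyramid (\<lambda>p. p$3 ^ k) v' = 0" if "v' \<in> vertices - {v}" for v'
      using that True k by (auto simp: vertices_corner ext0_def corner_3)
  qed
next
  case False
  then obtain j where j: "v = corner j" using v vertices_corner by blast
  have "(\<lambda>x. 1) \<in> P2_poly (int k - 1)" using k by (intro P2_poly_const) simp
  then have U: "ext0 pyramid (lift j (\<lambda>x. 1)) \<in> U_space k" by (rule lift_U_space)
  have ends: "corner i \<in> triangle_set (tri i)" "corner (i + 1) \<in> triangle_set (tri i)"
    "apex \<in> triangle_set (tri i)" for i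
    using edge_subset_triangle(1,2)[of i] by (auto simp del: triangle_set.simps)
  show thesis
  proof (rule that[OF U])
    show "ext0 pyramid (lift j (\<lambda>x. 1)) v = 1"
      using ext0_lift_param[of "(0, 0)" j "\<lambda>x. 1"] by (simp add: j unit_triangle_def tri_param_def)
  next
    fix v' assume v': "v' \<in> vertices - {v}"
    have "v' \<in> triangle_set (tri (j + 1)) \<or> v' \<in> triangle_set (tri (j + 2))"
    proof (cases "v' = apex")
      case True
      then show ?thesis using ends by blast
    next
      case False
      then obtain i where "v' = corner i" using v' vertices_corner by blast
      then obtain m where m: "m \<in> {0, 1, 2, 3}" "v' = corner (j + m)" using corner_around[of i j] by blast
      have j3: "j + 2 + 1 = j + 3" by simp
      have "corner (j + 3) \<in> triangle_set (tri (j + 2))" using ends(2)[of "j + 2"] by (simp only: j3)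
      then show ?thesis using m v' j ends(1)[of "j + 1"] ends(1)[of "j + 2"] by (auto simp del: triangle_set.simps)
    qed
    then show "ext0 pyramid (lift j (\<lambda>x. 1)) v' = 0" using ext0_lift_triangle(3,4) by blast
  qed
qed

section \<open>Conformity and unisolvence\<close>

lemma U0_space_eq: "U0_space k = {p \<in> U_space k. \<forall>F\<in>faces. \<forall>x\<in>F. p x = 0}"
  by (auto simp: U0_space_def frontier_pyramid)

lemma subspace_U0_space: "subspace (U0_space k)"
  using subspace_U_space[of k] by (auto simp: subspace_def U0_space_def scaleR_fun_def)

lemma linear_functional_on_subset:
  "linear_functional_on V F \<Longrightarrow> W \<subseteq> V \<Longrightarrow> linear_functional_on W F"
  unfolding linear_functional_on_def by blast

lemma edge_subset_triangles: "e \<in> edges \<Longrightarrow> edge_set e \<subseteq> \<Union>(triangle_set ` triangles)"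
  using edge_in_triangle[of e] triangles_tri by (metis UN_I UN_upper order_trans)

locale pyramid_element =
  fixes k :: nat
    and BE :: "point \<times> point \<Rightarrow> scalar_field set"
    and BT :: "point \<times> point \<times> point \<Rightarrow> scalar_field set"
    and BB BV :: "scalar_field set"
  assumes k: "k \<ge> 1"
    and BE: "\<And>e. e \<in> edges \<Longrightarrow> basis_of (BE e) (P_on (int k - 2) (edge_set e))"
    and BT: "\<And>s. s \<in> triangles \<Longrightarrow> basis_of (BT s) (P_on (int k - 3) (triangle_set s))"
    and BB: "basis_of BB (Q_base (int k - 2) (int k - 2))"
    and BV: "basis_of BV (U0_space k)"
begin

abbreviation "U \<equiv> U_space k"
abbreviation "\<Sigma> \<equiv> dofs BE BT BB BV"
abbreviation "vertex_dofs \<equiv> Vertex_dof ` vertices"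
abbreviation "edge_dofs \<equiv> \<Union>e\<in>edges. Edge_dof e ` BE e"
abbreviation "triangle_dofs \<equiv> \<Union>s\<in>triangles. Triangle_dof s ` BT s"

lemma dofs_eq: "\<Sigma> = vertex_dofs \<union> edge_dofs \<union> triangle_dofs \<union> Base_dof ` BB \<union> Volume_dof ` BV"
  by (auto simp: dofs_def)

lemma BV_U: "q \<in> BV \<Longrightarrow> q \<in> U0_space k" "q \<in> BV \<Longrightarrow> q \<in> U"
  using BV span_base by (auto simp: basis_of_def U0_space_def)

lemma edge_entity:
  assumes "(v, w) \<in> edges"
  shows "trace_entity {0..1} (linepath v w) (\<lambda>t. t * (1 - t)) (edge_set (v, w))
    (P_on (int k - 2) (edge_set (v, w))) (BE (v, w)) (dist v w) (Edge_dof (v, w))"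
  by (rule edge_trace_entity[OF assms BE[OF assms]])

lemma triangle_entity:
  "trace_entity unit_triangle (tri_param j) triangle_bubble
    (triangle_set (tri j)) (P_on (int k - 3) (triangle_set (tri j))) (BT (tri j))
    (area_factor j) (Triangle_dof (tri j))"
  using triangles_tri by (intro triangle_trace_entity BT) blast

lemma dof_linear:
  assumes "m \<in> \<Sigma>" shows "linear_functional_on U (dof_eval m)"
proof -
  consider v where "m = Vertex_dof v" | e q where "m = Edge_dof e q" "e \<in> edges" "q \<in> BE e"
    | j q where "m = Triangle_dof (tri j) q" "q \<in> BT (tri j)"
    | q where "m = Base_dof q" "q \<in> BB" | q where "m = Volume_dof q" "q \<in> BV"
    using assms unfolding dofs_def triangles_tri by blast
  then show ?thesis
  proof cases
    case 1
    then show ?thesis by (simp add: linear_functional_on_def scaleR_fun_def)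
  next
    case 2
    then show ?thesis by (cases e) (simp add: trace_entity.eval_linear[OF edge_entity])
  next
    case 3
    then show ?thesis using trace_entity.eval_linear[OF triangle_entity] by simp
  next
    case 4
    then show ?thesis using trace_entity.eval_linear[OF base_trace_entity[OF BB]] by simp
  next
    case 5
    then have "dof_eval m = (\<lambda>p. energy p q)" by (simp add: fun_eq_iff energy_def)
    then show ?thesis using energy_linear[OF BV_U(2)] 5 by simp
  qed
qed

text \<open>The functionals attached to a face include those of its edges and vertices, so vanishing
  propagates from vertices to edges and from edges to the face, each stage supplying the boundary
  zeros for the next.\<close>

lemma face_zero:
  assumes p: "p \<in> U" and F: "F \<in> faces"
    and zero: "\<And>m. m \<in> face_dofs \<Sigma> F \<Longrightarrow> dof_eval m p = 0" and y: "y \<in> F"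
  shows "p y = 0"
proof -
  have vertex: "p v = 0" if "v \<in> vertices" "v \<in> F" for v
    using zero[of "Vertex_dof v"] that by (auto simp: face_dofs_def dofs_def)
  have edge: "p x = 0" if "(v, w) \<in> edges" "closed_segment v w \<subseteq> F" "x \<in> closed_segment v w" for v w x
  proof (rule U_space_edge_zero[OF p that(1) BE[OF that(1)]])
    have "v \<in> vertices" "w \<in> vertices" using that(1) unfolding edges_corner vertices_corner by auto
    then show "p v = 0" "p w = 0" using vertex that(2) by auto
    show "dof_eval (Edge_dof (v, w) q) p = 0" if "q \<in> BE (v, w)" for q
      using zero[of "Edge_dof (v, w) q"] that \<open>(v, w) \<in> edges\<close> \<open>closed_segment v w \<subseteq> F\<close>
      unfolding face_dofs_def dofs_def by auto
  qed (use that in simp)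
  have corners: "(corner j, corner (j + 1)) \<in> edges" "(corner j, apex) \<in> edges" for j
    using edges_corner by blast+
  have "F = base \<or> F \<in> triangle_set ` triangles" using F by (simp only: faces_def insert_iff)
  then consider "F = base" | j where "F = triangle_set (tri j)" using triangles_tri by (metis imageE)
  then show ?thesis
  proof cases
    case 1
    show ?thesis
    proof (rule U_space_base_zero[OF p k BB])
      show "p (linepath (corner j) (corner (j + 1)) t) = 0" if "0 < t" "t < 1" for j t
        using that base_edge_subset[of j] 1 by (intro edge[OF corners(1)[of j]]) (auto simp: linepath_in_path)
      show "dof_eval (Base_dof q) p = 0" if "q \<in> BB" for q
        using zero[of "Base_dof q"] that 1 by (simp add: face_dofs_def dofs_def)
    qed (use y 1 in simp)
  next
    case 2
    have tri: "tri j \<in> triangles" using triangles_tri by blast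
    show ?thesis
    proof (rule U_space_triangle_zero[OF p BT[OF tri]])
      fix t :: real assume t: "0 < t" "t < 1"
      then show "p (linepath (corner j) (corner (j + 1)) t) = 0" "p (linepath (corner j) apex t) = 0"
        "p (linepath (corner (j + 1)) apex t) = 0"
        using edge_subset_triangle[of j] 2
        using edge[OF corners(1)[of j]] edge[OF corners(2)[of j]] edge[OF corners(2)[of "j + 1"]]
        by (simp_all add: linepath_in_path del: triangle_set.simps)
    next
      show "dof_eval (Triangle_dof (tri j) q) p = 0" if "q \<in> BT (tri j)" for q
      proof (rule zero)
        have "Triangle_dof (tri j) q \<in> \<Sigma>" using that tri unfolding dofs_eq by blast
        then show "Triangle_dof (tri j) q \<in> face_dofs \<Sigma> F"
          by (simp add: face_dofs_def 2 del: triangle_set.simps)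
      qed
    qed (use y 2 in simp)
  qed
qed

lemma conforming: "H1_conforming U \<Sigma>"
  unfolding H1_conforming_def
proof (intro conjI ballI)
  show "in_H1 (interior pyramid) p" if "p \<in> U" for p using in_H1_U_space[OF that] .
next
  fix F p assume F: "F \<in> faces" and p: "p \<in> U"
  show "(\<forall>m\<in>face_dofs \<Sigma> F. dof_eval m p = 0) \<longleftrightarrow> (\<forall>x\<in>F. p x = 0)"
  proof
    assume "\<forall>m\<in>face_dofs \<Sigma> F. dof_eval m p = 0"
    then show "\<forall>x\<in>F. p x = 0" using face_zero[OF p F] by blast
  next
    assume zero: "\<forall>x\<in>F. p x = 0"
    \<comment> \<open>An interior point shows that the pyramid is contained in no face, so no volume
      functional belongs to \<open>face_dofs\<close> and \<open>dof_eval_zero\<close>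
      applies.\<close>
    have "vector [1/4, 1/4, 1/4] \<in> interior pyramid" by (simp add: interior_pyramid)
    moreover have "F \<inter> interior pyramid = {}"
      using F frontier_pyramid by (auto simp: frontier_def)
    ultimately have "\<not> pyramid \<subseteq> F" using interior_subset by blast
    then show "\<forall>m\<in>face_dofs \<Sigma> F. dof_eval m p = 0"
      using zero by (auto simp: face_dofs_def intro!: dof_eval_zero)
  qed
qed

lemma interpolates_vertices: "interpolates U dof_eval vertex_dofs"
proof -
  have "interpolates U dof_eval ({} \<union> (\<Union>v\<in>vertices. {Vertex_dof v}))"
  proof (rule interpolates_UN[OF subspace_U_space])
    show "linear_functional_on U (dof_eval m)" if "m \<in> {} \<union> (\<Union>v\<in>vertices. {Vertex_dof v})" for m
      using that by (intro dof_linear) (auto simp: dofs_def)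
    fix v assume v: "v \<in> vertices"
    let ?W = "{u \<in> U. \<forall>m\<in>{} \<union> (\<Union>v'\<in>vertices - {v}. {Vertex_dof v'}). dof_eval m u = 0}"
    show "interpolates ?W dof_eval {Vertex_dof v}"
      unfolding interpolates_def
    proof
      fix c :: "dof \<Rightarrow> real"
      obtain u where u: "u \<in> U" "u v = 1" "\<And>v'. v' \<in> vertices - {v} \<Longrightarrow> u v' = 0"
        using vertex_function[OF v k] by blast
      have "c (Vertex_dof v) *\<^sub>R u \<in> U" by (rule subspace_scale[OF subspace_U_space u(1)])
      then show "\<exists>u\<in>?W. \<forall>m\<in>{Vertex_dof v}. dof_eval m u = c m"
        using u by (intro bexI[of _ "c (Vertex_dof v) *\<^sub>R u"]) (auto simp: scaleR_fun_def)
    qed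
  qed (simp_all add: interpolates_empty subspace_U_space finite_entities)
  then show ?thesis by (simp add: UNION_singleton_eq_range)
qed

lemma vertex_dofs_zero:
  assumes "\<And>e y. e \<in> edges \<Longrightarrow> y \<in> {fst e, snd e} \<Longrightarrow> u y = 0" "m \<in> vertex_dofs"
  shows "dof_eval m u = 0"
  using assms vertices_on_edges by (auto, metis insertCI)

text \<open>The function of an edge vanishes at its own end points because of the bubble, and at the
  end points of every other edge because it vanishes on that edge. So all vertex functionals are
  zero on it.\<close>

lemma interpolates_edges: "interpolates U dof_eval (vertex_dofs \<union> edge_dofs)"
proof (rule interpolates_UN[OF subspace_U_space _ interpolates_vertices finite_entities(2)])
  show "linear_functional_on U (dof_eval m)" if "m \<in> vertex_dofs \<union> edge_dofs" for m
    using that by (intro dof_linear) (auto simp: dofs_def)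
  fix e assume "e \<in> edges"
  moreover obtain v w where vw: "e = (v, w)" by (cases e)
  ultimately have e: "(v, w) \<in> edges" by simp
  interpret trace_entity "{0..1}" "linepath v w" "\<lambda>t. t * (1 - t)" "edge_set (v, w)"
    "P_on (int k - 2) (edge_set (v, w))" "BE (v, w)" "dist v w" "Edge_dof (v, w)"
    by (rule edge_entity[OF e])
  let ?W = "{u \<in> U. \<forall>m\<in>vertex_dofs \<union> (\<Union>e'\<in>edges - {(v, w)}. Edge_dof e' ` BE e'). dof_eval m u = 0}"
  have "interpolates ?W dof_eval (Edge_dof (v, w) ` BE (v, w))"
  proof (rule entity_interpolates)
    fix q assume "q \<in> P_on (int k - 2) (edge_set (v, w))"
    from edge_lift[OF e this] obtain u where u: "u \<in> U"
      "\<And>t. t \<in> {0..1} \<Longrightarrow> u (linepath v w t) = t * (1 - t) * q (linepath v w t)"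
      "\<And>e' y. e' \<in> edges - {(v, w)} \<Longrightarrow> y \<in> edge_set e' \<Longrightarrow> u y = 0"
      unfolding fst_conv snd_conv by blast
    have "dof_eval m u = 0" if m: "m \<in> vertex_dofs" for m
    proof (rule vertex_dofs_zero[OF _ m])
      fix e' y assume e': "e' \<in> edges" "y \<in> {fst e', snd e'}"
      show "u y = 0"
      proof (cases "e' = (v, w)")
        case True
        then show ?thesis using e' u(2)[of 0] u(2)[of 1] by (auto simp: linepath_0' linepath_1')
      next
        case False
        then show ?thesis using e' u(3)[of e' y] by (cases e') auto
      qed
    qed
    moreover have "dof_eval (Edge_dof e' b) u = 0" if "e' \<in> edges - {(v, w)}" for e' b
      using u(3)[OF that] by (intro dof_eval_zero) simp_all
    ultimately have "u \<in> ?W" using u(1) by blast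
    then show "\<exists>u\<in>?W. \<forall>t\<in>{0..1}. u (linepath v w t) = t * (1 - t) * q (linepath v w t)"
      using u(2) by blast
  qed
  then show "interpolates {u \<in> U. \<forall>m\<in>vertex_dofs \<union> (\<Union>e'\<in>edges - {e}. Edge_dof e' ` BE e'). dof_eval m u = 0}
    dof_eval (Edge_dof e ` BE e)"
    by (simp only: vw)
qed

lemma interpolates_triangles:
  "interpolates U dof_eval (vertex_dofs \<union> edge_dofs \<union> triangle_dofs)"
proof (rule interpolates_UN[OF subspace_U_space _ interpolates_edges finite_entities(3)])
  show "linear_functional_on U (dof_eval m)" if "m \<in> vertex_dofs \<union> edge_dofs \<union> triangle_dofs" for m
    using that by (intro dof_linear) (auto simp: dofs_def)
  fix s assume "s \<in> triangles"
  then obtain j where j: "s = tri j" using triangles_tri by blast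
  interpret trace_entity unit_triangle "tri_param j" triangle_bubble
    "triangle_set (tri j)" "P_on (int k - 3) (triangle_set (tri j))" "BT (tri j)"
    "area_factor j" "Triangle_dof (tri j)"
    by (rule triangle_entity)
  let ?M = "vertex_dofs \<union> edge_dofs \<union> (\<Union>s'\<in>triangles - {tri j}. Triangle_dof s' ` BT s')"
  show "interpolates {u \<in> U. \<forall>m\<in>vertex_dofs \<union> edge_dofs \<union>
      (\<Union>s'\<in>triangles - {s}. Triangle_dof s' ` BT s'). dof_eval m u = 0} dof_eval (Triangle_dof s ` BT s)"
    unfolding j
  proof (rule entity_interpolates)
    fix q assume "q \<in> P_on (int k - 3) (triangle_set (tri j))"
    from triangle_lift[OF this] obtain u where u: "u \<in> U"
      "\<And>x. x \<in> unit_triangle \<Longrightarrow> u (tri_param j x) = triangle_bubble x * q (tri_param j x)"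
      "\<And>s y. s \<in> triangles - {tri j} \<Longrightarrow> y \<in> triangle_set s \<Longrightarrow> u y = 0"
      "\<And>e y. e \<in> edges \<Longrightarrow> y \<in> edge_set e \<Longrightarrow> u y = 0"
      by blast
    have "dof_eval m u = 0"
      if m: "m \<in> ?M" for m
    proof -
      consider (vertex) "m \<in> vertex_dofs" | (edge) e b where "m = Edge_dof e b" "e \<in> edges"
        | (triangle) s b where "m = Triangle_dof s b" "s \<in> triangles - {tri j}"
        using m by blast
      then show ?thesis
      proof cases
        case vertex
        show ?thesis
        proof (rule vertex_dofs_zero[OF _ vertex])
          fix e y assume "e \<in> edges" "y \<in> {fst e, snd e}"
          then show "u y = 0" using u(4)[of e y] by (cases e) auto
        qed
      next
        case edge
        show ?thesis unfolding edge(1) using u(4)[OF edge(2)] by (intro dof_eval_zero) simp_all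
      next
        case triangle
        show ?thesis unfolding triangle(1) using u(3)[OF triangle(2)] by (intro dof_eval_zero) simp_all
      qed
    qed
    then have "u \<in> {u \<in> U. \<forall>m\<in>?M. dof_eval m u = 0}" using u(1) by simp
    then show "\<exists>u\<in>{u \<in> U. \<forall>m\<in>?M. dof_eval m u = 0}. \<forall>x\<in>unit_triangle. u (tri_param j x) = triangle_bubble x * q (tri_param j x)"
      using u(2) by (intro bexI[of _ u]) simp_all
  qed
qed

text \<open>Every edge lies on a triangle and every vertex is an end point of an edge, so the four
  triangles carry all these functionals.\<close>

lemma skeleton_zero:
  assumes "\<And>s y. s \<in> triangles \<Longrightarrow> y \<in> triangle_set s \<Longrightarrow> u y = 0"
    and m: "m \<in> vertex_dofs \<union> edge_dofs \<union> triangle_dofs"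
  shows "dof_eval m u = 0"
proof -
  have edge: "u y = 0" if "e \<in> edges" "y \<in> edge_set e" for e y
    using edge_subset_triangles[OF that(1)] that(2) assms(1) by blast
  have "u y = 0" if "e \<in> edges" "y \<in> {fst e, snd e}" for e y
    using edge[OF that(1), of y] that(2) by (cases e) auto
  then have "dof_eval m u = 0" if "m \<in> vertex_dofs" for m
    using vertex_dofs_zero[OF _ that] by blast
  moreover have "dof_eval (Edge_dof e b) u = 0" if "e \<in> edges" for e b
    using edge[OF that] by (intro dof_eval_zero) simp_all
  moreover have "dof_eval (Triangle_dof s b) u = 0" if "s \<in> triangles" for s b
    using assms(1)[OF that] by (intro dof_eval_zero) simp_all
  ultimately show ?thesis using m by blast
qed

lemma interpolates_base:
  "interpolates U dof_eval (vertex_dofs \<union> edge_dofs \<union> triangle_dofs \<union> Base_dof ` BB)"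
proof (rule interpolates_Un[OF subspace_U_space _ interpolates_triangles])
  show "linear_functional_on U (dof_eval m)"
    if "m \<in> vertex_dofs \<union> edge_dofs \<union> triangle_dofs \<union> Base_dof ` BB" for m
    using that by (intro dof_linear) (auto simp: dofs_def)
  interpret trace_entity "{0..1} \<times> {0..1}" base_param
    square_bubble base "Q_base (int k - 2) (int k - 2)" BB 1 Base_dof
    by (rule base_trace_entity[OF BB])
  let ?W = "{u \<in> U. \<forall>m\<in>vertex_dofs \<union> edge_dofs \<union> triangle_dofs. dof_eval m u = 0}"
  show "interpolates ?W dof_eval (Base_dof ` BB)"
  proof (rule entity_interpolates)
    fix q assume "q \<in> Q_base (int k - 2) (int k - 2)"
    from base_lift_exists[OF this k] obtain u where u: "u \<in> U"
      "\<And>x. x \<in> {0..1} \<times> {0..1} \<Longrightarrow>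
        u (base_param x) = square_bubble x * q (base_param x)"
      "\<And>s y. s \<in> triangles \<Longrightarrow> y \<in> triangle_set s \<Longrightarrow> u y = 0"
      by blast
    have "dof_eval m u = 0" if "m \<in> vertex_dofs \<union> edge_dofs \<union> triangle_dofs" for m
      using u(3) that by (rule skeleton_zero)
    then have "u \<in> ?W" using u(1) by simp
    then show "\<exists>u\<in>?W. \<forall>x\<in>{0..1} \<times> {0..1}.
        u (base_param x) = square_bubble x * q (base_param x)"
      by (rule bexI[rotated]) (intro ballI u(2))
  qed
qed

text \<open>Functions vanishing on the boundary annihilate all vertex, edge and face functionals. On
  them the energy form is definite, so the volume moments can be prescribed within
  \<open>U0_space k\<close> alone.\<close>

lemma interpolates_dofs: "interpolates U dof_eval \<Sigma>"
  unfolding dofs_eq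
proof (rule interpolates_Un[OF subspace_U_space _ interpolates_base])
  show "linear_functional_on U (dof_eval m)"
    if "m \<in> vertex_dofs \<union> edge_dofs \<union> triangle_dofs \<union> Base_dof ` BB \<union> Volume_dof ` BV" for m
    using that by (intro dof_linear) (simp add: dofs_eq)
  let ?W = "{u \<in> U. \<forall>m\<in>vertex_dofs \<union> edge_dofs \<union> triangle_dofs \<union> Base_dof ` BB. dof_eval m u = 0}"
  have sub: "U0_space k \<subseteq> ?W"
  proof
    fix u assume u: "u \<in> U0_space k"
    then have zero: "u y = 0" if "F \<in> faces" "y \<in> F" for F y using that by (auto simp: U0_space_eq)
    have "dof_eval m u = 0"
      if m: "m \<in> vertex_dofs \<union> edge_dofs \<union> triangle_dofs \<union> Base_dof ` BB" for m
    proof (cases "m \<in> Base_dof ` BB")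
      case True
      then obtain b where "m = Base_dof b" by blast
      then show ?thesis using zero[of base] by (intro dof_eval_zero) (simp_all add: faces_def)
    next
      case False
      with m have "m \<in> vertex_dofs \<union> edge_dofs \<union> triangle_dofs" by (elim UnE; simp only: Un_iff simp_thms)
      then show ?thesis by (rule skeleton_zero[rotated]) (rule zero, auto simp: faces_def)
    qed
    moreover have "u \<in> U" using u by (simp add: U0_space_def)
    ultimately show "u \<in> ?W" by (intro CollectI conjI ballI)
  qed
  show "interpolates ?W dof_eval (Volume_dof ` BV)"
    unfolding interpolates_def
  proof
    fix c :: "dof \<Rightarrow> real"
    have lin: "linear_functional_on (U0_space k) (\<lambda>p. energy p q)" if "q \<in> U0_space k" for q
      using that by (intro linear_functional_on_subset[OF energy_linear]) (auto simp: U0_space_def)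
    have "\<exists>v\<in>span BV. \<forall>q\<in>BV. energy v q = c (Volume_dof q)"
    proof (rule definite_form_solve[OF subspace_U0_space lin])
      show "linear_functional_on (U0_space k) (energy p)" if "p \<in> U0_space k" for p
        using lin[OF that] by (subst energy_sym[abs_def])
      show "p = 0" if "p \<in> U0_space k" "energy p p = 0" for p
        using that energy_definite[of p k] by (auto simp: U0_space_def)
      show "finite BV" by (rule finite_basis_U0_space[OF BV])
      show "independent BV" "BV \<subseteq> U0_space k" using BV BV_U by (auto simp: basis_of_def)
    qed
    then obtain v where v: "v \<in> U0_space k" "\<forall>q\<in>BV. energy v q = c (Volume_dof q)"
      using BV by (auto simp: basis_of_def)
    have "v \<in> ?W" using sub v(1) by (rule subsetD)
    moreover have "\<forall>m\<in>Volume_dof ` BV. dof_eval m v = c m" using v(2) by (simp add: energy_def)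
    ultimately show "\<exists>u\<in>?W. \<forall>m\<in>Volume_dof ` BV. dof_eval m u = c m" by (intro bexI[of _ v])
  qed
qed

text \<open>Vanishing on all faces puts \<open>p\<close> into the span of \<open>BV\<close>; since
  it is orthogonal to \<open>BV\<close> in the energy form, it is orthogonal to itself.\<close>

lemma dofs_determine:
  assumes p: "p \<in> U" and zero: "\<And>m. m \<in> \<Sigma> \<Longrightarrow> dof_eval m p = 0"
  shows "p = 0"
proof -
  have faces: "p y = 0" if "F \<in> faces" "y \<in> F" for F y
    using face_zero[OF p that(1) _ that(2)] zero by (simp add: face_dofs_def)
  then have p0: "p \<in> U0_space k" using p by (simp add: U0_space_eq)
  have "energy q p = 0" if "q \<in> BV" for q
    using zero[of "Volume_dof q"] that by (simp add: dofs_def energy_def inner_commute)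
  moreover have "BV \<subseteq> U" "p \<in> span BV" using BV BV_U p0 by (auto simp: basis_of_def)
  ultimately have "energy p p = 0"
    using linear_functional_on_span_zero[OF energy_linear[OF p] subspace_U_space] by blast
  then show ?thesis using p0 by (intro energy_definite[OF p]) (auto simp: U0_space_def)
qed

lemma unisolvence: "unisolvent U \<Sigma>"
  unfolding unisolvent_def
proof
  fix c :: "dof \<Rightarrow> real"
  obtain u where u: "u \<in> U" "\<forall>m\<in>\<Sigma>. dof_eval m u = c m"
    using interpolates_dofs unfolding interpolates_def by blast
  show "\<exists>!u. u \<in> U \<and> (\<forall>m\<in>\<Sigma>. dof_eval m u = c m)"
  proof (rule ex1I[of _ u])
    fix v assume v: "v \<in> U \<and> (\<forall>m\<in>\<Sigma>. dof_eval m v = c m)"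
    have "dof_eval m (v - u) = 0" if "m \<in> \<Sigma>" for m
      using linear_functional_onD(4)[OF dof_linear[OF that] subspace_U_space] u v that by simp
    moreover have "v - u \<in> U" using u v by (intro subspace_diff[OF subspace_U_space]) auto
    ultimately have "v - u = 0" by (intro dofs_determine)
    then show "v = u" by simp
  qed (use u in blast)
qed

end

theorem theorem6p1:
  fixes k :: nat
    and BE :: "point \<times> point \<Rightarrow> scalar_field set"
    and BT :: "point \<times> point \<times> point \<Rightarrow> scalar_field set"
    and BB BV :: "scalar_field set"
  assumes "k \<ge> 1"
    and "\<And>e. e \<in> edges \<Longrightarrow> basis_of (BE e) (P_on (int k - 2) (edge_set e))"
    and "\<And>s. s \<in> triangles \<Longrightarrow> basis_of (BT s) (P_on (int k - 3) (triangle_set s))"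
    and "basis_of BB (Q_base (int k - 2) (int k - 2))"
    and "basis_of BV (U0_space k)"
  shows "H1_conforming (U_space k) (dofs BE BT BB BV) \<and>
         unisolvent (U_space k) (dofs BE BT BB BV)"
proof -
  interpret pyramid_element k BE BT BB BV
    using assms by unfold_locales
  show ?thesis using conforming unisolvence ..
qed

end
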